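(* Let $m,\gamma,\kappa>0$ and let $f\in L^\infty([0,\infty);\mathcal{P}_2(\mathbb{T}\times\mathbb{R}))$ be a measure-valued solution to the kinetic Kuramoto equation with inertia $$\partial_t f+\partial_\theta(\omega f)+\partial_\omega(\mathcal{F}_a[f]f)=0,\quad \mathcal{F}_a[f](\theta,\omega,t)=\frac1m\left(-\gamma\omega+\kappa\int_{\mathbb{T}\times\mathbb{R}}\sin(\theta_*-\theta)f(\theta_*,\omega_*,t)\,d\theta_*d\omega_*\right),$$ with initial data $f^{in}$ satisfying $$\frac12\int_{\mathbb{T}\times\mathbb{R}}\omega^2 f^{in}(\theta,\omega)\,d\theta d\omega\le\frac{\kappa R_k(0)^2}{2m}.$$ Then: (1) If $R_k(0)=0$, then the solution stays as a phase-locked (stationary) state and $R_k(t)=0$ for all $t>0$. (2) If $R_k(0)>0$, then the measure-valued solution $d\mu_t=f(t)\,d\theta d\omega$ tends, as $t\to\infty$ (in the sense of weak convergence of measures), to a bi-polar state of type $(c_1,c_2)$.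
   Context: $\mathbb{T}=\mathbb{R}/2\pi\mathbb{Z}$. $\mathcal{P}_2(\mathbb{T}\times\mathbb{R})$ is the set of probability measures on $\mathbb{T}\times\mathbb{R}$ with finite second moment; measures are written in density notation even if they have no density. A measure-valued solution with initial datum $\mu_0$ on $[0,T)$ is a weakly continuous family $\mu_t\in\mathcal{P}_2(\mathbb{T}\times\mathbb{R})$ with total mass one such that for all $\varphi\in C_0^1(\mathbb{T}\times\mathbb{R}\times[0,T))$ and $t\in[0,T)$, $$\langle\mu_t,\varphi(\cdot,\cdot,t)\rangle-\langle\mu_0,\varphi(\cdot,\cdot,0)\rangle=\int_0^t\langle\mu_s,\partial_s\varphi+\omega\,\partial_\theta\varphi+\mathcal{F}_a[\mu_s]\,\partial_\omega\varphi\rangle\,ds,$$ where $\langle\mu,g\rangle=\int g\,d\mu$; a solution on $[0,\infty)$ is a solution on $[0,T)$ for every $T>0$. The order parameter $R_k(t)\ge0$ and average phase $\varphi_k(t)$ are defined by $R_k(t)e^{\mathrm{i}\varphi_k(t)}=\int_{\mathbb{T}\times\mathbb{R}}e^{\mathrm{i}\theta}f(\theta,\omega,t)\,d\theta d\omega$. A bi-polar state of type $(c_1,c_2)$ is a measure of the form $\left(c_1\delta_{\varphi^*}(\theta)+c_2\delta_{\varphi^*+\pi}(\theta)\right)\otimes\delta_0(\omega)$ for some $\varphi^*\in\mathbb{T}$, where $c_1>c_2\ge0$ and $c_1+c_2=1$. *)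

theory Defs
  imports "HOL-Probability.Probability"
begin

quotient_type torus = real / "\<lambda>x y::real. \<exists>k::int. x - y = 2 * pi * of_int k"
  morphisms rep_torus to_torus
proof (rule equivpI)
  show "reflp (\<lambda>x y::real. \<exists>k::int. x - y = 2 * pi * of_int k)"
    by (rule reflpI) (rule exI[of _ 0], simp)
  show "symp (\<lambda>x y::real. \<exists>k::int. x - y = 2 * pi * of_int k)"
  proof (rule sympI, elim exE)
    fix x y :: real and k :: int
    assume "x - y = 2 * pi * of_int k"
    then show "\<exists>k::int. y - x = 2 * pi * of_int k"
      by (intro exI[of _ "- k"]) simp
  qed
  show "transp (\<lambda>x y::real. \<exists>k::int. x - y = 2 * pi * of_int k)"
  proof (rule transpI, elim exE)
    fix x y z :: real and k l :: int
    assume "x - y = 2 * pi * of_int k" "y - z = 2 * pi * of_int l"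
    then show "\<exists>k::int. x - z = 2 * pi * of_int k"
      by (intro exI[of _ "k + l"]) (simp add: distrib_left)
  qed
qed

instantiation torus :: ab_group_add
begin

lift_definition zero_torus :: torus is "0 :: real" .

lift_definition plus_torus :: "torus \<Rightarrow> torus \<Rightarrow> torus" is "\<lambda>x y::real. x + y"
proof (elim exE)
  fix x x' y y' :: real and k l :: int
  assume "x - x' = 2 * pi * of_int k" "y - y' = 2 * pi * of_int l"
  then show "\<exists>k::int. (x + y) - (x' + y') = 2 * pi * of_int k"
    by (intro exI[of _ "k + l"]) (simp add: distrib_left)
qed

lift_definition uminus_torus :: "torus \<Rightarrow> torus" is "\<lambda>x::real. - x"
proof (elim exE)
  fix x x' :: real and k :: int
  assume "x - x' = 2 * pi * of_int k"
  then show "\<exists>k::int. (- x) - (- x') = 2 * pi * of_int k"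
    by (intro exI[of _ "- k"]) simp
qed

definition minus_torus :: "torus \<Rightarrow> torus \<Rightarrow> torus" where
  "minus_torus a b = a + (- b)"

instance
proof
  fix a b c :: torus
  show "a + b + c = a + (b + c)"
    by transfer (rule exI[of _ 0], simp)
  show "a + b = b + a"
    by transfer (rule exI[of _ 0], simp)
  show "0 + a = a"
    by transfer (rule exI[of _ 0], simp)
  show "- a + a = 0"
    by transfer (rule exI[of _ 0], simp)
  show "a - b = a + (- b)"
    by (rule minus_torus_def)
qed

end

text \<open>The torus carries the quotient topology.\<close>

instantiation torus :: topological_space
begin

definition open_torus :: "torus set \<Rightarrow> bool" where
  "open_torus U \<longleftrightarrow> open (to_torus -` U)"

instance
proof
  show "open (UNIV :: torus set)"
    by (simp add: open_torus_def)
  show "open (S \<inter> T)" if "open S" "open T" for S T :: "torus set"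
    using that by (simp add: open_torus_def open_Int)
  show "open (\<Union>K)" if "\<forall>S\<in>K. open S" for K :: "torus set set"
    using that by (auto simp: open_torus_def vimage_Union intro!: open_UN)
qed

end

lemma to_torus_eq_iff: "to_torus x = to_torus y \<longleftrightarrow> (\<exists>k::int. x - y = 2 * pi * of_int k)"
  by (rule torus.abs_eq_iff)

lemma to_torus_surj: "\<exists>x. to_torus x = a"
  by (rule exI[of _ "rep_torus a"]) (rule Quotient3_abs_rep[OF Quotient3_torus])

lemma open_to_torus_image:
  assumes "open U"
  shows "open (to_torus ` U)"
proof -
  have "to_torus -` to_torus ` U = (\<Union>k::int. (+) (2 * pi * of_int k) ` U)"
  proof (intro set_eqI iffI)
    fix x
    assume "x \<in> to_torus -` to_torus ` U"
    then obtain y where "y \<in> U" "to_torus x = to_torus y"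
      by auto
    then obtain k :: int where "x = 2 * pi * of_int k + y"
      by (auto simp: to_torus_eq_iff algebra_simps)
    then show "x \<in> (\<Union>k::int. (+) (2 * pi * of_int k) ` U)"
      using \<open>y \<in> U\<close> by blast
  next
    fix x
    assume "x \<in> (\<Union>k::int. (+) (2 * pi * of_int k) ` U)"
    then obtain k :: int and y where y: "y \<in> U" "x = 2 * pi * of_int k + y"
      by blast
    then have "to_torus x = to_torus y"
      unfolding to_torus_eq_iff by (intro exI[of _ k]) simp
    then show "x \<in> to_torus -` to_torus ` U"
      using y by auto
  qed
  moreover have "open (\<Union>k::int. (+) (2 * pi * of_int k) ` U)"
    using assms by (intro open_UN ballI open_translation)
  ultimately show ?thesis
    by (simp add: open_torus_def)
qed

text \<open>Second countability makes the product of the Borel \<open>\<sigma>\<close>-algebras of the torus and of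
  the real line the Borel \<open>\<sigma>\<close>-algebra of the phase space.\<close>

instance torus :: second_countable_topology
proof
  obtain B :: "real set set" where B: "countable B" "topological_basis B"
    using ex_countable_basis by blast
  have "topological_basis ((`) to_torus ` B)"
  proof (rule topological_basisI)
    show "open V" if "V \<in> (`) to_torus ` B" for V
      using that B(2) by (auto intro: open_to_torus_image topological_basis_open)
    fix O' :: "torus set" and a
    assume O': "open O'" "a \<in> O'"
    obtain x where x: "to_torus x = a"
      using to_torus_surj by blast
    then obtain W where "W \<in> B" "x \<in> W" "W \<subseteq> to_torus -` O'"
      using O' B(2) by (metis open_torus_def topological_basisE vimageI)
    then show "\<exists>V\<in>(`) to_torus ` B. a \<in> V \<and> V \<subseteq> O'"
      using x by (intro bexI[of _ "to_torus ` W"]) auto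
  qed
  then show "\<exists>B::torus set set. countable B \<and> open = generate_topology B"
    using B(1) by (blast intro: topological_basis_imp_subbasis)
qed

lift_definition torus_sin :: "torus \<Rightarrow> real" is sin
proof (elim exE)
  fix x y :: real and k :: int
  assume "x - y = 2 * pi * of_int k"
  then have "x = y + 2 * pi * of_int k" by simp
  then show "sin x = sin y" by (simp only: sin_add sin_int_2pin cos_int_2pin mult_1_right mult_zero_right add_0_right)
qed

lift_definition torus_cis :: "torus \<Rightarrow> complex" is cis
proof (elim exE)
  fix x y :: real and k :: int
  assume "x - y = 2 * pi * of_int k"
  then have "x = y + 2 * pi * of_int k" by simp
  then show "cis x = cis y" by (simp only: cis.code cos_add sin_add sin_int_2pin cos_int_2pin) simp
qed

type_synonym phase_space = "torus \<times> real"

text \<open>The torus is compact, so finiteness of the second moment concerns the frequency only.\<close>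

definition P2 :: "phase_space measure set" where
  "P2 = {\<mu>. prob_space \<mu> \<and> sets \<mu> = sets borel \<and> integrable \<mu> (\<lambda>(\<theta>, \<omega>). \<omega>\<^sup>2)}"

definition weakly_continuous_on :: "real set \<Rightarrow> (real \<Rightarrow> phase_space measure) \<Rightarrow> bool" where
  "weakly_continuous_on I \<mu> \<longleftrightarrow>
    (\<forall>g::phase_space \<Rightarrow> real. continuous_on UNIV g \<longrightarrow> bounded (range g) \<longrightarrow>
      continuous_on I (\<lambda>t. \<integral>z. g z \<partial>\<mu> t))"

definition tends_weakly ::
    "(real \<Rightarrow> phase_space measure) \<Rightarrow> phase_space measure \<Rightarrow> real filter \<Rightarrow> bool" where
  "tends_weakly \<mu> \<nu> F \<longleftrightarrow>
    (\<forall>g::phase_space \<Rightarrow> real. continuous_on UNIV g \<longrightarrow> bounded (range g) \<longrightarrow>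
      ((\<lambda>t. \<integral>z. g z \<partial>\<mu> t) \<longlongrightarrow> (\<integral>z. g z \<partial>\<nu>)) F)"

definition kuramoto_force ::
    "real \<Rightarrow> real \<Rightarrow> real \<Rightarrow> phase_space measure \<Rightarrow> torus \<Rightarrow> real \<Rightarrow> real" where
  "kuramoto_force m \<gamma> \<kappa> \<mu> \<theta> \<omega> =
    1 / m * (- \<gamma> * \<omega> + \<kappa> * (\<integral>(\<theta>', \<omega>'). torus_sin (\<theta>' - \<theta>) \<partial>\<mu>))"

text \<open>\<open>\<phi>\<close> is a \<open>C\<^sup>1\<close> function with compact support in \<open>\<T> \<times> \<R> \<times> [0,T)\<close>, and \<open>\<phi>\<theta>\<close>, \<open>\<phi>\<omega>\<close>, \<open>\<phi>t\<close>
  are its partial derivatives. The support may meet \<open>t = 0\<close>, where the time derivative is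
  one-sided. Values at times outside \<open>[0,T)\<close> are irrelevant.\<close>

definition test_function ::
    "real \<Rightarrow> (torus \<times> real \<times> real \<Rightarrow> real) \<Rightarrow> (torus \<times> real \<times> real \<Rightarrow> real) \<Rightarrow>
      (torus \<times> real \<times> real \<Rightarrow> real) \<Rightarrow> (torus \<times> real \<times> real \<Rightarrow> real) \<Rightarrow> bool" where
  "test_function T \<phi> \<phi>\<theta> \<phi>\<omega> \<phi>t \<longleftrightarrow>
    (\<forall>t\<in>{0..<T}. \<forall>x \<omega>.
      ((\<lambda>y. \<phi> (to_torus y, \<omega>, t)) has_real_derivative \<phi>\<theta> (to_torus x, \<omega>, t)) (at x) \<and>
      ((\<lambda>y. \<phi> (to_torus x, y, t)) has_real_derivative \<phi>\<omega> (to_torus x, \<omega>, t)) (at \<omega>) \<and>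
      ((\<lambda>s. \<phi> (to_torus x, \<omega>, s)) has_real_derivative \<phi>t (to_torus x, \<omega>, t))
        (at t within {0..<T})) \<and>
    continuous_on (UNIV \<times> UNIV \<times> {0..<T}) \<phi> \<and>
    continuous_on (UNIV \<times> UNIV \<times> {0..<T}) \<phi>\<theta> \<and>
    continuous_on (UNIV \<times> UNIV \<times> {0..<T}) \<phi>\<omega> \<and>
    continuous_on (UNIV \<times> UNIV \<times> {0..<T}) \<phi>t \<and>
    (\<exists>K. compact K \<and> K \<subseteq> UNIV \<times> UNIV \<times> {0..<T} \<and>
      (\<forall>z \<in> (UNIV \<times> UNIV \<times> {0..<T}) - K. \<phi> z = 0))"

definition measure_valued_solution ::
    "real \<Rightarrow> real \<Rightarrow> real \<Rightarrow> phase_space measure \<Rightarrow> real \<Rightarrow> (real \<Rightarrow> phase_space measure) \<Rightarrow> bool"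
  where
  "measure_valued_solution m \<gamma> \<kappa> \<mu>0 T \<mu> \<longleftrightarrow>
    (\<forall>t\<in>{0..<T}. \<mu> t \<in> P2) \<and>
    weakly_continuous_on {0..<T} \<mu> \<and>
    \<mu> 0 = \<mu>0 \<and>
    (\<forall>\<phi> \<phi>\<theta> \<phi>\<omega> \<phi>t. test_function T \<phi> \<phi>\<theta> \<phi>\<omega> \<phi>t \<longrightarrow>
      (\<forall>t\<in>{0..<T}.
        (\<integral>(\<theta>, \<omega>). \<phi> (\<theta>, \<omega>, t) \<partial>\<mu> t) - (\<integral>(\<theta>, \<omega>). \<phi> (\<theta>, \<omega>, 0) \<partial>\<mu>0) =
        (LINT s:{0..t}|lborel.
          (\<integral>(\<theta>, \<omega>). \<phi>t (\<theta>, \<omega>, s) + \<omega> * \<phi>\<theta> (\<theta>, \<omega>, s)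
             + kuramoto_force m \<gamma> \<kappa> (\<mu> s) \<theta> \<omega> * \<phi>\<omega> (\<theta>, \<omega>, s) \<partial>\<mu> s))))"

definition global_measure_valued_solution ::
    "real \<Rightarrow> real \<Rightarrow> real \<Rightarrow> phase_space measure \<Rightarrow> (real \<Rightarrow> phase_space measure) \<Rightarrow> bool" where
  "global_measure_valued_solution m \<gamma> \<kappa> \<mu>0 \<mu> \<longleftrightarrow>
    (\<forall>T>0. measure_valued_solution m \<gamma> \<kappa> \<mu>0 T \<mu>)"

text \<open>Membership in \<open>L\<^sup>\<infinity>([0,\<infinity>); P2)\<close>: the second moments are essentially bounded in time.\<close>

definition Linf_P2 :: "(real \<Rightarrow> phase_space measure) \<Rightarrow> bool" where
  "Linf_P2 \<mu> \<longleftrightarrow> (\<forall>t\<ge>0. \<mu> t \<in> P2) \<and>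
    (\<exists>C. AE t in lborel. 0 \<le> t \<longrightarrow> (\<integral>(\<theta>, \<omega>). \<omega>\<^sup>2 \<partial>\<mu> t) \<le> C)"

definition order_parameter :: "phase_space measure \<Rightarrow> real" where
  "order_parameter \<mu> = cmod (\<integral>(\<theta>, \<omega>). torus_cis \<theta> \<partial>\<mu>)"

lemma order_parameter_polar:
  "R = order_parameter \<mu> \<longleftrightarrow>
    R \<ge> 0 \<and> (\<exists>\<phi>. complex_of_real R * exp (\<i> * complex_of_real \<phi>) = (\<integral>(\<theta>, \<omega>). torus_cis \<theta> \<partial>\<mu>))"
proof -
  have polar: "r = cmod z \<longleftrightarrow> r \<ge> 0 \<and> (\<exists>\<phi>. complex_of_real r * exp (\<i> * complex_of_real \<phi>) = z)"
    for r :: real and z :: complex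
  proof
    assume "r = cmod z"
    then show "r \<ge> 0 \<and> (\<exists>\<phi>. complex_of_real r * exp (\<i> * complex_of_real \<phi>) = z)"
      by (metis cis_conv_exp norm_ge_zero rcis_cmod_Arg rcis_def)
  next
    assume "r \<ge> 0 \<and> (\<exists>\<phi>. complex_of_real r * exp (\<i> * complex_of_real \<phi>) = z)"
    then show "r = cmod z"
      by (auto simp: norm_mult)
  qed
  show ?thesis
    unfolding order_parameter_def by (rule polar)
qed

definition two_diracs :: "real \<Rightarrow> torus \<Rightarrow> real \<Rightarrow> torus \<Rightarrow> torus measure" where
  "two_diracs c1 a c2 b = measure_of UNIV (sets borel)
    (\<lambda>A. ennreal c1 * emeasure (return borel a) A + ennreal c2 * emeasure (return borel b) A)"

lemma sets_two_diracs: "sets (two_diracs c1 a c2 b) = sets borel"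
  by (metis sets.sets_measure_of_eq space_borel two_diracs_def)

lemma emeasure_two_diracs:
  assumes "A \<in> sets borel"
  shows "emeasure (two_diracs c1 a c2 b) A =
    ennreal c1 * emeasure (return borel a) A + ennreal c2 * emeasure (return borel b) A"
  using two_diracs_def
proof (rule emeasure_measure_of)
  let ?f = "\<lambda>A. ennreal c1 * emeasure (return borel a) A + ennreal c2 * emeasure (return borel b) A"
  show "positive (sets (two_diracs c1 a c2 b)) ?f"
    by (simp add: positive_def)
  show "countably_additive (sets (two_diracs c1 a c2 b)) ?f"
  proof (rule countably_additiveI)
    fix A :: "nat \<Rightarrow> torus set"
    assume "range A \<subseteq> sets (two_diracs c1 a c2 b)" "disjoint_family A"
    then have "(\<Sum>i. emeasure (return borel x) (A i)) = emeasure (return borel x) (\<Union>i. A i)" for x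
      by (intro suminf_emeasure) (auto simp: sets_two_diracs)
    then show "(\<Sum>i. ?f (A i)) = ?f (\<Union>i. A i)"
      by (simp add: suminf_add[symmetric])
  qed
qed (use assms in \<open>auto simp: sets_two_diracs\<close>)

definition bipolar_state :: "real \<Rightarrow> real \<Rightarrow> phase_space measure \<Rightarrow> bool" where
  "bipolar_state c1 c2 \<nu> \<longleftrightarrow> c1 > c2 \<and> c2 \<ge> 0 \<and> c1 + c2 = 1 \<and>
    (\<exists>\<phi>. \<nu> = two_diracs c1 \<phi> c2 (\<phi> + to_torus pi) \<Otimes>\<^sub>M return borel 0)"

text \<open>In a phase-locked state every oscillator has frequency zero.\<close>

definition phase_locked :: "phase_space measure \<Rightarrow> bool" where
  "phase_locked \<mu> \<longleftrightarrow> (AE (\<theta>, \<omega>) in \<mu>. \<omega> = 0)"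

end

theory Submission
  imports Defs
begin

text \<open>The proof follows a handful of averages in time and never integrates a characteristic. Write
  \<open>z = R e\<^sup>i\<^sup>\<phi>\<close> for the complex order parameter, \<open>M = \<langle>\<omega>\<^sup>2\<rangle>\<close> and \<open>g(\<theta>) = R sin (\<phi> - \<theta>)\<close> for the mean
  field, so that the force is \<open>(\<kappa> g - \<gamma> \<omega>) / m\<close>. Truncating in \<open>\<omega>\<close> and passing to the limit under the
  second moment bound, the weak formulation gives an ordinary differential equation for every average
  of the form \<open>\<langle>a(\<theta>)\<rangle>\<close>, \<open>\<langle>a(\<theta>) \<omega>\<rangle>\<close> and for \<open>M\<close> (\<open>evolution_deriv\<close>).

  The energy \<open>M / 2 - \<kappa> R\<^sup>2 / (2 m)\<close> has derivative \<open>- \<gamma> M / m\<close>, and the hypothesis says that it is at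
  most zero initially; hence \<open>M \<le> \<kappa> R\<^sup>2 / m\<close> at all times. If \<open>R(0) = 0\<close>, then
  \<open>\<bar>(R\<^sup>2)'\<bar> \<le> M + R\<^sup>2 \<le> C R\<^sup>2\<close> forces \<open>R = 0\<close> and \<open>M = 0\<close> for ever: every oscillator rests, and so does
  the measure.

  If \<open>R(0) > 0\<close>, then friction makes the energy negative, so \<open>R\<close> converges to a positive limit, and
  \<open>M\<close> is integrable in time and tends to zero. The derivative of \<open>\<langle>\<omega> g\<rangle>\<close> contains \<open>\<kappa> \<langle>g\<^sup>2\<rangle> / m\<close> and
  otherwise only terms with bounded integral or a favourable sign, so \<open>\<langle>g\<^sup>2\<rangle>\<close> is integrable and tends to
  zero as well: the mass gathers at the two poles \<open>\<phi>\<close> and \<open>\<phi> + \<pi>\<close>.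

  What remains is the convergence of \<open>\<phi>\<close>. Mass may leave the unstable pole arbitrarily slowly, so
  there is no rate to rely on. Doubling the angle makes the two poles indistinguishable: since
  \<open>R\<^sup>2 e\<^sup>2\<^sup>i\<^sup>\<theta> = z\<^sup>2 + O(g)\<close>, the derivative \<open>2 i \<langle>\<omega> e\<^sup>2\<^sup>i\<^sup>\<theta>\<rangle>\<close> of \<open>\<langle>e\<^sup>2\<^sup>i\<^sup>\<theta>\<rangle>\<close> is bounded by a multiple of
  \<open>\<bar>\<langle>\<omega>\<rangle>\<bar> + M + \<langle>g\<^sup>2\<rangle>\<close>, and the momentum \<open>\<langle>\<omega>\<rangle>\<close> decays exponentially because the interaction is
  antisymmetric. So \<open>\<langle>e\<^sup>2\<^sup>i\<^sup>\<theta>\<rangle>\<close> converges, with it \<open>z\<^sup>2\<close>, and \<open>z\<close> too because it is continuous and stays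
  away from zero (\<open>phase_converges\<close>). Together with the concentration at the poles, the limit of \<open>z\<close>
  determines the weak limit (\<open>tends_to_bipolar\<close>).\<close>

section \<open>Calculus on the torus\<close>

lemma to_torus_range: "(\<And>x. P (to_torus x)) \<Longrightarrow> P \<theta>"
  by (metis to_torus_surj)

lemma continuous_to_torus: "continuous_on UNIV to_torus"
  by (simp add: continuous_on_open_vimage open_torus_def)

lemma continuous_on_torus_iff:
  fixes a :: "torus \<Rightarrow> 'b::topological_space"
  shows "continuous_on UNIV a \<longleftrightarrow> continuous_on UNIV (\<lambda>x. a (to_torus x))"
  by (simp add: continuous_on_open_vimage open_torus_def vimage_def)

lemma compact_torus: "compact (UNIV :: torus set)"
proof -
  have "UNIV = to_torus ` {0..2 * pi}"
  proof (intro set_eqI iffI UNIV_I)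
    fix \<theta> :: torus
    obtain x where x: "to_torus x = \<theta>"
      using to_torus_surj by blast
    define k where "k = \<lfloor>x / (2 * pi)\<rfloor>"
    have "of_int k \<le> x / (2 * pi)" "x / (2 * pi) < of_int k + 1"
      unfolding k_def by linarith+
    then have "x - 2 * pi * of_int k \<in> {0..2 * pi}"
      by (simp add: field_simps)
    moreover have "to_torus (x - 2 * pi * of_int k) = \<theta>"
      unfolding x[symmetric] to_torus_eq_iff by (intro exI[of _ "- k"]) simp
    ultimately show "\<theta> \<in> to_torus ` {0..2 * pi}"
      by blast
  qed
  then show ?thesis
    using compact_continuous_image[OF continuous_on_subset[OF continuous_to_torus subset_UNIV] compact_Icc]
    by metis
qed

definition torus_cos :: "torus \<Rightarrow> real" where
  "torus_cos \<theta> = Re (torus_cis \<theta>)"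

lemma torus_cos_to_torus [simp]: "torus_cos (to_torus x) = cos x"
  by (simp add: torus_cos_def torus_cis.abs_eq)

lemma torus_sin_to_torus [simp]: "torus_sin (to_torus x) = sin x"
  by (simp add: torus_sin.abs_eq)

lemma torus_cis_eq: "torus_cis \<theta> = Complex (torus_cos \<theta>) (torus_sin \<theta>)"
  by (rule to_torus_range[of _ \<theta>]) (simp add: torus_cis.abs_eq complex_eq_iff)

lemma torus_sin_cos_squared: "(torus_sin \<theta>)\<^sup>2 + (torus_cos \<theta>)\<^sup>2 = 1"
  by (rule to_torus_range[of _ \<theta>]) simp

lemma abs_torus_cos_le: "\<bar>torus_cos \<theta>\<bar> \<le> 1" and abs_torus_sin_le: "\<bar>torus_sin \<theta>\<bar> \<le> 1"
  by (rule to_torus_range[of _ \<theta>], simp)+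

lemma to_torus_diff: "to_torus x - to_torus y = to_torus (x - y)"
  by (simp add: minus_torus_def uminus_torus.abs_eq plus_torus.abs_eq)

lemma torus_sin_diff:
  "torus_sin (\<theta>' - \<theta>) = torus_sin \<theta>' * torus_cos \<theta> - torus_cos \<theta>' * torus_sin \<theta>"
  by (rule to_torus_range[of _ \<theta>], rule to_torus_range[of _ \<theta>']) (simp add: to_torus_diff sin_diff)

lemma torus_cos_diff:
  "torus_cos (\<theta>' - \<theta>) = torus_cos \<theta>' * torus_cos \<theta> + torus_sin \<theta>' * torus_sin \<theta>"
  by (rule to_torus_range[of _ \<theta>], rule to_torus_range[of _ \<theta>']) (simp add: to_torus_diff cos_diff)

lemma continuous_torus_cos: "continuous_on UNIV torus_cos"
  and continuous_torus_sin: "continuous_on UNIV torus_sin"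
  by (simp_all add: continuous_on_torus_iff continuous_intros)

text \<open>Derivatives of a function on the torus are those of its periodic lift.\<close>

definition torus_C1 :: "(torus \<Rightarrow> real) \<Rightarrow> (torus \<Rightarrow> real) \<Rightarrow> bool" where
  "torus_C1 a a' \<longleftrightarrow>
    (\<forall>x. ((\<lambda>y. a (to_torus y)) has_real_derivative a' (to_torus x)) (at x)) \<and>
    continuous_on UNIV a'"

lemma torus_C1_continuous: "torus_C1 a a' \<Longrightarrow> continuous_on UNIV a"
  unfolding continuous_on_torus_iff torus_C1_def
  by (meson DERIV_isCont continuous_at_imp_continuous_on)

lemma torus_continuous_bounded:
  fixes a :: "torus \<Rightarrow> real"
  assumes "continuous_on UNIV a"
  obtains A where "A \<ge> 0" "\<And>\<theta>. \<bar>a \<theta>\<bar> \<le> A"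
proof -
  have "bounded (range a)"
    using assms compact_continuous_image compact_imp_bounded compact_torus by blast
  then obtain A where "\<And>\<theta>. \<bar>a \<theta>\<bar> \<le> A"
    by (auto simp: bounded_iff)
  moreover from this have "A \<ge> 0"
    using abs_ge_zero order_trans by blast
  ultimately show thesis
    using that by blast
qed

lemma torus_C1_const: "torus_C1 (\<lambda>\<theta>. c) (\<lambda>\<theta>. 0)"
  by (auto simp: torus_C1_def)

lemma torus_C1_cos: "torus_C1 torus_cos (\<lambda>\<theta>. - torus_sin \<theta>)"
  by (auto simp: torus_C1_def intro!: derivative_eq_intros continuous_intros continuous_torus_sin)

lemma torus_C1_sin: "torus_C1 torus_sin torus_cos"
  by (auto simp: torus_C1_def intro!: derivative_eq_intros continuous_torus_cos)

lemma torus_C1_mult: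
  assumes "torus_C1 a a'" "torus_C1 b b'"
  shows "torus_C1 (\<lambda>\<theta>. a \<theta> * b \<theta>) (\<lambda>\<theta>. a' \<theta> * b \<theta> + b' \<theta> * a \<theta>)"
  using assms assms[THEN torus_C1_continuous]
  by (auto simp: torus_C1_def intro!: DERIV_mult continuous_intros)

lemma torus_C1_add:
  assumes "torus_C1 a a'" "torus_C1 b b'"
  shows "torus_C1 (\<lambda>\<theta>. a \<theta> + b \<theta>) (\<lambda>\<theta>. a' \<theta> + b' \<theta>)"
  using assms by (auto simp: torus_C1_def intro!: DERIV_add continuous_intros)

lemma torus_C1_compose:
  assumes "torus_C1 a a'" "\<And>u. (b has_real_derivative b' u) (at u)" "continuous_on UNIV b'"
  shows "torus_C1 (\<lambda>\<theta>. b (a \<theta>)) (\<lambda>\<theta>. b' (a \<theta>) * a' \<theta>)"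
proof -
  have "continuous_on UNIV (\<lambda>\<theta>. b' (a \<theta>))"
    by (rule continuous_on_compose2[OF assms(3) torus_C1_continuous[OF assms(1)]]) auto
  then show ?thesis
    using assms by (auto simp: torus_C1_def intro!: DERIV_chain2[of b] continuous_intros)
qed

section \<open>Cutoff functions\<close>

text \<open>The square makes the truncation at zero continuously differentiable, so that composing it with
  itself produces a \<open>C\<^sup>1\<close> step from one to zero.\<close>

definition pos_square :: "real \<Rightarrow> real" where
  "pos_square u = (max 0 u)\<^sup>2"

lemma pos_square_deriv: "(pos_square has_real_derivative 2 * max 0 u) (at u)"
proof -
  consider "u < 0" | "u = 0" | "u > 0" by linarith
  then show ?thesis
  proof cases
    case 1
    have "(pos_square has_real_derivative 0) (at u) \<longleftrightarrow> ((\<lambda>_. 0) has_real_derivative (0::real)) (at u)"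
      by (rule DERIV_cong_ev)
        (use 1 in \<open>auto simp: pos_square_def eventually_at_filter max_def
            intro!: eventually_nhds_in_open[THEN eventually_mono, of "{..<0}"]\<close>)
    then show ?thesis using 1 by simp
  next
    case 2
    have "((\<lambda>h. pos_square h / h) \<longlongrightarrow> 0) (at 0)"
    proof (rule Lim_null_comparison)
      show "((\<lambda>h::real. \<bar>h\<bar>) \<longlongrightarrow> 0) (at 0)"
        by (auto intro!: tendsto_eq_intros)
      show "\<forall>\<^sub>F h in at 0. norm (pos_square h / h) \<le> \<bar>h\<bar>"
        by (rule always_eventually) (auto simp: pos_square_def max_def power2_eq_square)
    qed
    then show ?thesis
      using 2 by (simp add: DERIV_def pos_square_def)
  next
    case 3
    have "(pos_square has_real_derivative 2 * u) (at u) \<longleftrightarrow> ((\<lambda>u. u\<^sup>2) has_real_derivative 2 * u) (at u)"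
      by (rule DERIV_cong_ev)
        (use 3 in \<open>auto simp: pos_square_def max_def
            intro!: eventually_nhds_in_open[THEN eventually_mono, of "{0<..}"]\<close>)
    then show ?thesis using 3
      by (auto intro!: derivative_eq_intros)
  qed
qed

definition cutoff :: "real \<Rightarrow> real" where
  "cutoff u = pos_square (1 - pos_square u)"

definition cutoff' :: "real \<Rightarrow> real" where
  "cutoff' u = - 4 * max 0 (1 - pos_square u) * max 0 u"

lemma cutoff_deriv: "(cutoff has_real_derivative cutoff' u) (at u)"
proof -
  have "((\<lambda>u. 1 - pos_square u) has_real_derivative - (2 * max 0 u)) (at u)"
    using DERIV_diff[OF DERIV_const pos_square_deriv] by simp
  from DERIV_chain2[OF pos_square_deriv this] show ?thesis
    by (simp add: cutoff_def[abs_def] cutoff'_def mult.assoc)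
qed

lemma continuous_cutoff': "continuous_on UNIV cutoff'"
  unfolding cutoff'_def[abs_def] pos_square_def[abs_def] by (intro continuous_intros)

lemma continuous_cutoff: "continuous_on UNIV cutoff"
  using cutoff_deriv by (meson DERIV_isCont continuous_at_imp_continuous_on)

lemma cutoff_bounds: "0 \<le> cutoff u" "cutoff u \<le> 1"
  unfolding cutoff_def pos_square_def by (auto simp: max_def intro: power_le_one)

lemma cutoff_left: "u \<le> 0 \<Longrightarrow> cutoff u = 1" "u \<le> 0 \<Longrightarrow> cutoff' u = 0"
  by (auto simp: cutoff_def cutoff'_def pos_square_def)

lemma cutoff_right:
  assumes "u \<ge> 1"
  shows "cutoff u = 0" "cutoff' u = 0"
proof -
  have "1 \<le> u\<^sup>2" using assms by simp
  then have "max 0 (1 - pos_square u) = 0"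
    using assms by (simp add: pos_square_def)
  then show "cutoff u = 0" "cutoff' u = 0"
    by (simp_all add: cutoff_def cutoff'_def pos_square_def[of "1 - pos_square u"])
qed

lemma abs_cutoff'_le: "\<bar>cutoff' u\<bar> \<le> 4"
proof (cases "0 \<le> u \<and> u \<le> 1")
  case True
  then have u: "0 \<le> 1 - u\<^sup>2" "1 - u\<^sup>2 \<le> 1"
    by (auto simp: power_le_one)
  then have "(1 - u\<^sup>2) * u \<le> 1 * 1"
    using True by (intro mult_mono) auto
  moreover have "cutoff' u = - 4 * ((1 - u\<^sup>2) * u)"
    using True u by (simp add: cutoff'_def pos_square_def max_def algebra_simps)
  moreover have "0 \<le> (1 - u\<^sup>2) * u"
    using True u by (intro mult_nonneg_nonneg) auto
  ultimately show ?thesis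
    by linarith
next
  case False
  then show ?thesis
    using cutoff_left(2)[of u] cutoff_right(2)[of u] by auto
qed

text \<open>The transition takes place for \<open>\<omega>\<^sup>2\<close> between \<open>n + 1\<close> and \<open>2 (n + 1)\<close>. Its length grows with \<open>n\<close>, so
  \<open>(1 + \<bar>\<omega>\<bar>) \<zeta>\<^sub>n'(\<omega>)\<close> stays bounded uniformly in \<open>n\<close>, and the friction, which is linear in \<open>\<omega>\<close>, does not
  spoil the truncation of quadratic moments.\<close>

definition frequency_cutoff :: "nat \<Rightarrow> real \<Rightarrow> real" where
  "frequency_cutoff n \<omega> = cutoff (\<omega>\<^sup>2 / (real n + 1) - 1)"

definition frequency_cutoff' :: "nat \<Rightarrow> real \<Rightarrow> real" where
  "frequency_cutoff' n \<omega> = cutoff' (\<omega>\<^sup>2 / (real n + 1) - 1) * (2 * \<omega> / (real n + 1))"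

lemma frequency_cutoff_deriv:
  "(frequency_cutoff n has_real_derivative frequency_cutoff' n \<omega>) (at \<omega>)"
proof -
  have "((\<lambda>\<omega>. \<omega>\<^sup>2 / (real n + 1) - 1) has_real_derivative 2 * \<omega> / (real n + 1)) (at \<omega>)"
    by (auto intro!: derivative_eq_intros)
  from DERIV_chain2[OF cutoff_deriv this] show ?thesis
    by (simp add: frequency_cutoff_def[abs_def] frequency_cutoff'_def)
qed

lemma continuous_frequency_cutoff: "continuous_on UNIV (frequency_cutoff n)"
  using frequency_cutoff_deriv by (meson DERIV_isCont continuous_at_imp_continuous_on)

lemma continuous_frequency_cutoff': "continuous_on UNIV (frequency_cutoff' n)"
  unfolding frequency_cutoff'_def[abs_def]
  by (intro continuous_intros continuous_on_compose2[OF continuous_cutoff']) auto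

lemma frequency_cutoff_bounds: "0 \<le> frequency_cutoff n \<omega>" "frequency_cutoff n \<omega> \<le> 1"
  by (simp_all add: frequency_cutoff_def cutoff_bounds)

lemma frequency_cutoff_vanishes:
  assumes "\<omega>\<^sup>2 \<ge> 2 * (real n + 1)"
  shows "frequency_cutoff n \<omega> = 0" "frequency_cutoff' n \<omega> = 0"
proof -
  have "\<omega>\<^sup>2 / (real n + 1) - 1 \<ge> 1" using assms by (simp add: field_simps)
  then show "frequency_cutoff n \<omega> = 0" "frequency_cutoff' n \<omega> = 0"
    by (simp_all add: frequency_cutoff_def frequency_cutoff'_def cutoff_right)
qed

lemma frequency_cutoff_eventually:
  "\<forall>\<^sub>F n in sequentially. frequency_cutoff n \<omega> = 1 \<and> frequency_cutoff' n \<omega> = 0"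
proof -
  have "\<forall>\<^sub>F n in sequentially. real n > \<omega>\<^sup>2"
    using filterlim_real_sequentially by (simp add: filterlim_at_top_dense)
  then show ?thesis
  proof eventually_elim
    case (elim n)
    then have "\<omega>\<^sup>2 / (real n + 1) - 1 \<le> 0" by (simp add: field_simps)
    then show ?case
      by (simp add: frequency_cutoff_def frequency_cutoff'_def cutoff_left)
  qed
qed

lemma frequency_cutoff'_bound: "(1 + \<bar>\<omega>\<bar>) * \<bar>frequency_cutoff' n \<omega>\<bar> \<le> 40"
proof (cases "\<omega>\<^sup>2 \<ge> 2 * (real n + 1)")
  case True
  then show ?thesis by (simp add: frequency_cutoff_vanishes)
next
  case False
  define N where "N = real n + 1"
  have N: "N \<ge> 1" "\<omega>\<^sup>2 < 2 * N" using False by (auto simp: N_def)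
  have "2 * \<bar>\<omega>\<bar> \<le> 1 + \<omega>\<^sup>2"
    using sum_squares_bound[of "\<bar>\<omega>\<bar>" 1] by simp
  then have "(1 + \<bar>\<omega>\<bar>) * (2 * \<bar>\<omega>\<bar>) \<le> 10 * N"
    using N by (simp add: algebra_simps power2_eq_square)
  then have "(1 + \<bar>\<omega>\<bar>) * (2 * \<bar>\<omega>\<bar> / N) \<le> 10"
    using N by (simp add: field_simps)
  moreover have "\<bar>cutoff' (\<omega>\<^sup>2 / N - 1)\<bar> \<le> 4"
    by (rule abs_cutoff'_le)
  ultimately have "\<bar>cutoff' (\<omega>\<^sup>2 / N - 1)\<bar> * ((1 + \<bar>\<omega>\<bar>) * (2 * \<bar>\<omega>\<bar> / N)) \<le> 4 * 10"
    using N by (intro mult_mono) auto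
  moreover have "(1 + \<bar>\<omega>\<bar>) * \<bar>frequency_cutoff' n \<omega>\<bar> =
      \<bar>cutoff' (\<omega>\<^sup>2 / N - 1)\<bar> * ((1 + \<bar>\<omega>\<bar>) * (2 * \<bar>\<omega>\<bar> / N))"
    using N by (simp add: frequency_cutoff'_def N_def[symmetric] abs_mult)
  ultimately show ?thesis
    by simp
qed

section \<open>Functions of time with integrable derivative\<close>

lemma increment_nonneg:
  fixes h h' :: "real \<Rightarrow> real"
  assumes deriv: "\<And>t. t \<ge> 0 \<Longrightarrow> (h has_real_derivative h' t) (at t within {0..})"
    and "0 \<le> a" "a \<le> b" and "\<And>t. a \<le> t \<Longrightarrow> t \<le> b \<Longrightarrow> h' t \<ge> 0"
  shows "h a \<le> h b"
proof -
  have "(h' has_integral (h b - h a)) {a..b}"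
  proof (rule fundamental_theorem_of_calculus[OF \<open>a \<le> b\<close>])
    fix t assume "t \<in> {a..b}"
    then have "(h has_real_derivative h' t) (at t within {a..b})"
      using assms by (intro has_field_derivative_subset[OF deriv]) auto
    then show "(h has_vector_derivative h' t) (at t within {a..b})"
      by (simp add: has_real_derivative_iff_has_vector_derivative)
  qed
  from has_integral_nonneg[OF this] show ?thesis
    using assms(4) by simp
qed

lemma increment_lower_bound:
  fixes h h' :: "real \<Rightarrow> real"
  assumes "\<And>t. t \<ge> 0 \<Longrightarrow> (h has_real_derivative h' t) (at t within {0..})"
    and "0 \<le> a" "a \<le> b" and "\<And>t. a \<le> t \<Longrightarrow> t \<le> b \<Longrightarrow> h' t \<ge> c"
  shows "c * (b - a) \<le> h b - h a"
proof -
  have "((\<lambda>t. h t - c * t) has_real_derivative h' t - c) (at t within {0..})" if "t \<ge> 0" for t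
    using assms(1)[OF that] by (auto intro!: derivative_eq_intros)
  from increment_nonneg[OF this assms(2,3)] show ?thesis
    using assms(4) by (simp add: algebra_simps)
qed

lemma nondecreasing_bounded_converges:
  fixes h :: "real \<Rightarrow> real"
  assumes mono: "\<And>s t. t0 \<le> s \<Longrightarrow> s \<le> t \<Longrightarrow> h s \<le> h t" and bound: "\<And>t. t \<ge> t0 \<Longrightarrow> h t \<le> B"
  shows "\<exists>l. (h \<longlongrightarrow> l) at_top"
proof
  let ?l = "SUP t\<in>{t0..}. h t"
  have bdd: "bdd_above (h ` {t0..})"
    using bound by (intro bdd_aboveI[of _ B]) auto
  show "(h \<longlongrightarrow> ?l) at_top"
  proof (rule increasing_tendsto)
    show "\<forall>\<^sub>F t in at_top. h t \<le> ?l"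
      using eventually_ge_at_top[of t0] by eventually_elim (auto intro: cSUP_upper bdd)
    fix y assume "y < ?l"
    then obtain s where s: "s \<ge> t0" "y < h s"
      using less_cSUP_iff[OF _ bdd, of y] by auto
    show "\<forall>\<^sub>F t in at_top. y < h t"
      using eventually_ge_at_top[of s] by eventually_elim (use s mono in \<open>auto intro: less_le_trans\<close>)
  qed
qed

text \<open>An \<open>H\<close> bounded above with \<open>\<bar>X'\<bar> \<le> H'\<close> expresses that \<open>X'\<close> is absolutely integrable: both \<open>H\<close> and \<open>H + X\<close> are
  nondecreasing.\<close>

lemma dominated_deriv_converges:
  fixes X X' H H' :: "real \<Rightarrow> real"
  assumes X: "\<And>t. t \<ge> 0 \<Longrightarrow> (X has_real_derivative X' t) (at t within {0..})"
    and H: "\<And>t. t \<ge> 0 \<Longrightarrow> (H has_real_derivative H' t) (at t within {0..})"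
    and "t0 \<ge> 0" and dom: "\<And>t. t \<ge> t0 \<Longrightarrow> \<bar>X' t\<bar> \<le> H' t"
    and bounds: "\<And>t. t \<ge> t0 \<Longrightarrow> H t \<le> B" "\<And>t. t \<ge> t0 \<Longrightarrow> X t \<le> A"
  shows "\<exists>l. (X \<longlongrightarrow> l) at_top"
proof -
  have sum: "((\<lambda>t. H t + X t) has_real_derivative H' t + X' t) (at t within {0..})" if "t \<ge> 0" for t
    by (intro DERIV_add H X that)
  have "\<exists>l. (H \<longlongrightarrow> l) at_top"
  proof (rule nondecreasing_bounded_converges[OF _ bounds(1)])
    fix s t assume "t0 \<le> s" "s \<le> t"
    then show "H s \<le> H t"
      using \<open>t0 \<ge> 0\<close> order_trans[OF abs_ge_zero dom] by (intro increment_nonneg[OF H]) auto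
  qed
  moreover have "\<exists>l. ((\<lambda>t. H t + X t) \<longlongrightarrow> l) at_top"
  proof (rule nondecreasing_bounded_converges[of t0 _ "B + A"])
    fix s t assume st: "t0 \<le> s" "s \<le> t"
    have "0 \<le> H' u + X' u" if "u \<ge> t0" for u
      using dom[OF that] by linarith
    then show "H s + X s \<le> H t + X t"
      using \<open>t0 \<ge> 0\<close> st by (intro increment_nonneg[OF sum]) auto
  qed (use bounds in \<open>auto intro: add_mono\<close>)
  ultimately obtain l l' where "(H \<longlongrightarrow> l) at_top" "((\<lambda>t. H t + X t) \<longlongrightarrow> l') at_top"
    by blast
  from tendsto_diff[OF this(2,1)] show ?thesis
    by auto
qed

text \<open>Barbalat's lemma: a nonnegative integrable function with bounded derivative tends to zero.
  Integrability is expressed by a function \<open>H\<close> that is bounded above and whose derivative dominates \<open>g\<close>.\<close>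

lemma barbalat:
  fixes g g' H H' :: "real \<Rightarrow> real"
  assumes g: "\<And>t. t \<ge> 0 \<Longrightarrow> (g has_real_derivative g' t) (at t within {0..})"
    and H: "\<And>t. t \<ge> 0 \<Longrightarrow> (H has_real_derivative H' t) (at t within {0..})"
    and nonneg: "\<And>t. t \<ge> 0 \<Longrightarrow> g t \<ge> 0" and dom: "\<And>t. t \<ge> 0 \<Longrightarrow> g t \<le> H' t"
    and bounds: "\<And>t. t \<ge> 0 \<Longrightarrow> \<bar>g' t\<bar> \<le> L" "\<And>t. t \<ge> 0 \<Longrightarrow> H t \<le> B"
  shows "(g \<longlongrightarrow> 0) at_top"
proof -
  have "H s \<le> H t" if "0 \<le> s" "s \<le> t" for s t
    using that order_trans[OF nonneg dom] by (intro increment_nonneg[OF H]) auto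
  then obtain l where l: "(H \<longlongrightarrow> l) at_top"
    using nondecreasing_bounded_converges[of 0 H B] bounds(2) by auto
  have "L \<ge> 0"
    using order_trans[OF abs_ge_zero bounds(1)[of 0]] by simp
  show ?thesis
  proof (rule tendstoI)
    fix \<epsilon> :: real assume \<epsilon>: "\<epsilon> > 0"
    \<comment> \<open>On a time interval of this length \<open>g\<close> drops by at most \<open>\<epsilon> / 2\<close>, so a large value of \<open>g\<close> would
        make \<open>H\<close> grow by a fixed amount.\<close>
    define \<delta> where "\<delta> = \<epsilon> / (2 * (L + 1))"
    have \<delta>: "\<delta> > 0" "L * \<delta> \<le> \<epsilon> / 2"
      using \<epsilon> \<open>L \<ge> 0\<close> by (auto simp: \<delta>_def field_simps)
    have "((\<lambda>t. H (t + \<delta>)) \<longlongrightarrow> l) at_top"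
      using filterlim_compose[OF l filterlim_tendsto_add_at_top[OF tendsto_const[of \<delta>] filterlim_ident]]
      by (simp add: add.commute)
    from tendsto_diff[OF this l] have "((\<lambda>t. H (t + \<delta>) - H t) \<longlongrightarrow> 0) at_top"
      by simp
    then have "\<forall>\<^sub>F t in at_top. H (t + \<delta>) - H t < \<delta> * (\<epsilon> / 2)"
      using \<delta> \<epsilon> by (intro order_tendstoD(2)) auto
    then show "\<forall>\<^sub>F t in at_top. dist (g t) 0 < \<epsilon>"
      using eventually_ge_at_top[of 0]
    proof eventually_elim
      case (elim t)
      have "g t - L * \<delta> \<le> H' s" if "t \<le> s" "s \<le> t + \<delta>" for s
      proof -
        have "- L * (s - t) \<le> g s - g t"
        proof (rule increment_lower_bound[OF g])
          show "- L \<le> g' u" if "t \<le> u" for u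
            using bounds(1)[of u] that elim by (simp add: abs_le_iff)
        qed (use elim that in auto)
        moreover have "L * (s - t) \<le> L * \<delta>"
          using that \<open>L \<ge> 0\<close> by (intro mult_left_mono) auto
        moreover have "g s \<le> H' s"
          using dom that elim by simp
        ultimately show ?thesis by simp
      qed
      then have "(g t - L * \<delta>) * (t + \<delta> - t) \<le> H (t + \<delta>) - H t"
        using elim \<delta> by (intro increment_lower_bound[OF H]) auto
      then have "\<delta> * (g t - L * \<delta>) < \<delta> * (\<epsilon> / 2)"
        using elim by (simp add: mult.commute)
      then have "g t - L * \<delta> < \<epsilon> / 2"
        using \<delta> by simp
      then show ?case
        using nonneg[of t] elim \<delta> by (simp add: dist_real_def)
    qed
  qed
qed

text \<open>The two square roots of the limit are a positive distance apart, so a continuous path cannot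
  switch between them.\<close>

lemma square_converges_imp_converges:
  fixes z :: "real \<Rightarrow> complex"
  assumes cont: "continuous_on {0..} z" and lim: "((\<lambda>t. (z t)\<^sup>2) \<longlongrightarrow> \<zeta>) at_top" and "\<zeta> \<noteq> 0"
  shows "\<exists>\<xi>. (z \<longlongrightarrow> \<xi>) at_top"
proof -
  define \<xi> where "\<xi> = csqrt \<zeta>"
  have \<xi>: "\<xi>\<^sup>2 = \<zeta>" "\<xi> \<noteq> 0"
    using \<open>\<zeta> \<noteq> 0\<close> by (auto simp: \<xi>_def)
  define w where "w t = z t / \<xi>" for t
  have "((\<lambda>t. (z t)\<^sup>2 / \<zeta>) \<longlongrightarrow> \<zeta> / \<zeta>) at_top"
    by (intro tendsto_divide lim tendsto_const \<open>\<zeta> \<noteq> 0\<close>)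
  then have w2: "((\<lambda>t. (w t)\<^sup>2) \<longlongrightarrow> 1) at_top"
    using \<open>\<zeta> \<noteq> 0\<close> by (simp add: w_def power_divide \<xi>)
  then have "\<forall>\<^sub>F t in at_top. dist ((w t)\<^sup>2) 1 < 1"
    by (rule tendstoD) simp
  then obtain t0 where t0: "\<And>t. t \<ge> t0 \<Longrightarrow> dist ((w t)\<^sup>2) 1 < 1"
    by (auto simp: eventually_at_top_linorder)
  define T where "T = max t0 0"
  \<comment> \<open>On the imaginary axis the square is nonpositive, at distance at least one from the limit one.\<close>
  have Re_nonzero: "Re (w t) \<noteq> 0" if "t \<in> {T..}" for t
  proof
    assume "Re (w t) = 0"
    then have "(w t)\<^sup>2 = - complex_of_real ((Im (w t))\<^sup>2)"
      by (simp add: complex_eq_iff power2_eq_square)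
    then have "dist ((w t)\<^sup>2) 1 = cmod (complex_of_real (- ((Im (w t))\<^sup>2 + 1)))"
      by (simp add: dist_norm)
    also have "\<dots> = (Im (w t))\<^sup>2 + 1"
      by (simp only: norm_of_real abs_minus_cancel) simp
    finally show False
      using t0[of t] that by (simp add: T_def)
  qed
  have cont_w: "continuous_on {T..} (\<lambda>t. Re (w t))"
    unfolding w_def using \<xi> by (intro continuous_intros continuous_on_subset[OF cont]) (auto simp: T_def)
  have same_sign: "sgn (Re (w t)) = sgn (Re (w T))" if "t \<ge> T" for t
  proof (rule ccontr)
    assume "sgn (Re (w t)) \<noteq> sgn (Re (w T))"
    then have "Re (w T) \<le> 0 \<and> 0 \<le> Re (w t) \<or> Re (w t) \<le> 0 \<and> 0 \<le> Re (w T)"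
      by (auto simp: sgn_if split: if_splits)
    moreover have c: "continuous_on {T..t} (\<lambda>t. Re (w t))"
      by (rule continuous_on_subset[OF cont_w]) auto
    ultimately have "\<exists>s. T \<le> s \<and> s \<le> t \<and> Re (w s) = 0"
      using IVT'[OF _ _ that c] IVT2'[OF _ _ that c] by blast
    then show False
      using Re_nonzero by auto
  qed
  define \<sigma> where "\<sigma> = complex_of_real (sgn (Re (w T)))"
  have \<sigma>: "\<sigma>\<^sup>2 = 1"
    using Re_nonzero[of T] by (auto simp: \<sigma>_def sgn_if)
  have "(w \<longlongrightarrow> \<sigma>) at_top"
  proof (rule tendsto_dist_iff[THEN iffD2], rule Lim_null_comparison)
    show "((\<lambda>t. dist ((w t)\<^sup>2) 1) \<longlongrightarrow> 0) at_top"
      using w2 by (simp add: tendsto_dist_iff[symmetric])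
    show "\<forall>\<^sub>F t in at_top. norm (dist (w t) \<sigma>) \<le> dist ((w t)\<^sup>2) 1"
      using eventually_ge_at_top[of T]
    proof eventually_elim
      case (elim t)
      have "1 \<le> Re (w t * \<sigma>) + 1"
        using same_sign[OF elim] by (auto simp: \<sigma>_def sgn_if split: if_splits)
      also have "\<dots> = Re ((w t + \<sigma>) * \<sigma>)"
        using \<sigma> by (simp add: algebra_simps power2_eq_square)
      also have "\<dots> \<le> cmod ((w t + \<sigma>) * \<sigma>)"
        by (rule complex_Re_le_cmod)
      also have "\<dots> = cmod (w t + \<sigma>)"
        using Re_nonzero[of T] by (auto simp: norm_mult \<sigma>_def sgn_if)
      finally have "dist (w t) \<sigma> * 1 \<le> dist (w t) \<sigma> * cmod (w t + \<sigma>)"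
        by (intro mult_left_mono) auto
      also have "\<dots> = cmod ((w t - \<sigma>) * (w t + \<sigma>))"
        by (simp add: dist_norm norm_mult)
      also have "(w t - \<sigma>) * (w t + \<sigma>) = (w t)\<^sup>2 - 1"
        using \<sigma> by (simp add: algebra_simps power2_eq_square)
      finally show ?case
        by (simp add: dist_norm)
    qed
  qed
  then have "((\<lambda>t. \<xi> * w t) \<longlongrightarrow> \<xi> * \<sigma>) at_top"
    by (rule tendsto_mult_left)
  then show ?thesis
    using \<xi> by (auto simp: w_def)
qed

section \<open>Measures on the torus and the two poles\<close>

lemma torus_eqI:
  assumes "torus_cos \<alpha> = torus_cos \<beta>" "torus_sin \<alpha> = torus_sin \<beta>"
  shows "\<alpha> = \<beta>"
proof -
  obtain x y where xy: "\<alpha> = to_torus x" "\<beta> = to_torus y"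
    using to_torus_surj by metis
  then have "sin x = sin y \<and> cos x = cos y"
    using assms by simp
  then obtain n :: int where "x = y + 2 * pi * n"
    using sin_cos_eq_iff by blast
  then show ?thesis
    unfolding xy to_torus_eq_iff by (intro exI[of _ n]) simp
qed

lemma torus_cos_diff_eq_1_imp:
  assumes "torus_cos (\<theta> - a) = 1"
  shows "\<theta> = a"
proof -
  have "torus_sin (\<theta> - a) = 0"
    using torus_sin_cos_squared[of "\<theta> - a"] assms by simp
  then have "\<theta> - a = to_torus 0"
    using assms by (intro torus_eqI) simp_all
  then show ?thesis
    by (simp add: zero_torus.abs_eq[symmetric])
qed

lemma torus_sin_diff_eq_0_imp:
  assumes "torus_sin (\<theta> - a) = 0"
  shows "\<theta> = a \<or> \<theta> = a + to_torus pi"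
proof -
  have "(torus_cos (\<theta> - a))\<^sup>2 = 1"
    using torus_sin_cos_squared[of "\<theta> - a"] assms by simp
  then consider "torus_cos (\<theta> - a) = 1" | "torus_cos (\<theta> - a) = - 1"
    by (auto simp: power2_eq_1_iff)
  then show ?thesis
  proof cases
    case 2
    then have "\<theta> - a = to_torus pi"
      using assms by (intro torus_eqI) simp_all
    then show ?thesis by (simp add: diff_eq_eq add.commute)
  qed (use torus_cos_diff_eq_1_imp in blast)
qed

lemma opposite_pole_neq: "a + to_torus pi \<noteq> a"
proof
  assume "a + to_torus pi = a"
  then have "to_torus pi = to_torus 0"
    by (simp add: zero_torus.abs_eq[symmetric])
  then have "cos pi = cos (0::real)"
    by (metis torus_cos_to_torus)
  then show False by simp
qed

lemma closed_torus_singleton: "closed {a :: torus}"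
proof -
  have "{a} = {\<theta>. torus_cos \<theta> = torus_cos a} \<inter> {\<theta>. torus_sin \<theta> = torus_sin a}"
    using torus_eqI by auto
  moreover have "closed {\<theta>. torus_cos \<theta> = torus_cos a}" "closed {\<theta>. torus_sin \<theta> = torus_sin a}"
    by (intro closed_Collect_eq continuous_torus_cos continuous_torus_sin continuous_on_const)+
  ultimately show ?thesis
    by (metis closed_Int)
qed

lemma torus_C1_cos_diff: "\<exists>a'. torus_C1 (\<lambda>\<theta>. torus_cos (\<theta> - a)) a'"
  unfolding torus_cos_diff
  using torus_C1_add[OF torus_C1_mult[OF torus_C1_cos torus_C1_const] torus_C1_mult[OF torus_C1_sin torus_C1_const]]
  by blast

lemma continuous_torus_cos_diff: "continuous_on UNIV (\<lambda>\<theta>. torus_cos (\<theta> - a))"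
  and continuous_torus_sin_diff: "continuous_on UNIV (\<lambda>\<theta>. torus_sin (\<theta> - a))"
  unfolding torus_cos_diff torus_sin_diff
  by (intro continuous_intros continuous_torus_cos continuous_torus_sin)+

text \<open>On the compact complement of \<open>U\<close>, the function \<open>cos (\<theta> - a)\<close> stays below some \<open>r < 1\<close>.\<close>

lemma torus_C1_support_base:
  assumes "open U" "a \<in> U"
  shows "\<exists>q q'. torus_C1 q q' \<and> (\<forall>\<theta>. 0 \<le> q \<theta>) \<and> 0 < q a \<and> {\<theta>. 0 < q \<theta>} \<subseteq> U"
proof (cases "U = UNIV")
  case True
  then show ?thesis
    by (intro exI[of _ "\<lambda>\<theta>. 1"] exI[of _ "\<lambda>\<theta>. 0"]) (simp add: torus_C1_const)
next
  case False
  have "compact (UNIV \<inter> - U)"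
    using assms(1) by (intro compact_Int_closed compact_torus) (simp add: closed_Compl)
  then have "compact (- U)" by simp
  then obtain \<theta>1 where \<theta>1: "\<theta>1 \<in> - U" "\<And>\<theta>. \<theta> \<in> - U \<Longrightarrow> torus_cos (\<theta> - a) \<le> torus_cos (\<theta>1 - a)"
    using continuous_attains_sup[of "- U" "\<lambda>\<theta>. torus_cos (\<theta> - a)"] False
      continuous_on_subset[OF continuous_torus_cos_diff subset_UNIV] by blast
  define r where "r = torus_cos (\<theta>1 - a)"
  have "r \<noteq> 1"
    using torus_cos_diff_eq_1_imp[of \<theta>1 a] \<theta>1(1) assms(2) by (auto simp: r_def)
  then have r: "r < 1"
    using abs_torus_cos_le[of "\<theta>1 - a"] by (simp add: r_def abs_le_iff)
  let ?q = "\<lambda>\<theta>. pos_square (torus_cos (\<theta> - a) - r)"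
  obtain c' where c': "torus_C1 (\<lambda>\<theta>. torus_cos (\<theta> - a)) c'"
    using torus_C1_cos_diff by blast
  have deriv: "((\<lambda>u. pos_square (u - r)) has_real_derivative 2 * max 0 (u - r) * 1) (at u)" for u
    by (rule DERIV_chain2[OF pos_square_deriv]) (auto intro!: derivative_eq_intros)
  have "continuous_on UNIV (\<lambda>u. 2 * max 0 (u - r) * 1 :: real)"
    by (intro continuous_intros)
  from torus_C1_compose[OF c' deriv this] have "\<exists>q'. torus_C1 ?q q'"
    by blast
  then obtain q' where "torus_C1 ?q q'"
    by (rule exE)
  moreover have "0 < ?q a"
    using r torus_cos_to_torus[of 0] by (simp add: pos_square_def zero_torus.abs_eq[symmetric])
  moreover have "{\<theta>. 0 < ?q \<theta>} \<subseteq> U"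
  proof
    fix \<theta> assume "\<theta> \<in> {\<theta>. 0 < ?q \<theta>}"
    then have "torus_cos (\<theta> - a) > r"
      by (auto simp: pos_square_def max_def split: if_splits)
    then show "\<theta> \<in> U"
      using \<theta>1(2)[of \<theta>] by (auto simp: r_def)
  qed
  moreover have "\<forall>\<theta>. 0 \<le> ?q \<theta>"
    by (simp add: pos_square_def)
  ultimately show ?thesis
    by (intro exI[of _ ?q] exI[of _ q'] conjI)
qed

definition torus_supports :: "torus set set" where
  "torus_supports = {S. \<exists>q q'. torus_C1 q q' \<and> (\<forall>\<theta>. 0 \<le> q \<theta>) \<and> S = {\<theta>. 0 < q \<theta>}}"

lemma torus_supportsI:
  "torus_C1 q q' \<Longrightarrow> (\<And>\<theta>. 0 \<le> q \<theta>) \<Longrightarrow> {\<theta>. 0 < q \<theta>} \<in> torus_supports"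
  unfolding torus_supports_def by blast

lemma torus_supportsE:
  assumes "S \<in> torus_supports"
  obtains q q' where "torus_C1 q q'" "\<And>\<theta>. 0 \<le> q \<theta>" "S = {\<theta>. 0 < q \<theta>}"
  using assms unfolding torus_supports_def by (elim CollectE exE conjE) simp

lemma open_torus_supports: "S \<in> torus_supports \<Longrightarrow> open S"
  by (elim torus_supportsE) (simp add: open_Collect_less torus_C1_continuous)

lemma borel_torus_eq: "sets (borel :: torus measure) = sigma_sets UNIV torus_supports"
proof -
  have "U \<in> sigma_sets UNIV torus_supports" if "open U" for U
  proof -
    have "\<exists>S\<in>torus_supports. a \<in> S \<and> S \<subseteq> U" if a: "a \<in> U" for a
    proof -
      obtain q q' where q: "torus_C1 q q'" "\<forall>\<theta>. 0 \<le> q \<theta>" "0 < q a" "{\<theta>. 0 < q \<theta>} \<subseteq> U"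
        using torus_C1_support_base[OF \<open>open U\<close> a] by (elim exE conjE)
      then have "{\<theta>. 0 < q \<theta>} \<in> torus_supports"
        by (intro torus_supportsI) auto
      then show ?thesis
        by (rule bexI[rotated]) (use q in simp)
    qed
    then have U: "U = \<Union>{S \<in> torus_supports. S \<subseteq> U}"
      by blast
    obtain F where F: "F \<subseteq> {S \<in> torus_supports. S \<subseteq> U}" "countable F"
        "\<Union>F = \<Union>{S \<in> torus_supports. S \<subseteq> U}"
      by (rule Lindelof[of "{S \<in> torus_supports. S \<subseteq> U}"]) (auto intro: open_torus_supports)
    have "\<Union>F \<in> sigma_sets UNIV torus_supports"
      using F(1,2) by (intro sigma_sets_UNION) (auto intro: sigma_sets.Basic)
    then show ?thesis
      using F(3) U by simp
  qed
  then have "sigma_sets UNIV {S. open S} = sigma_sets UNIV torus_supports"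
    using open_torus_supports by (intro sigma_sets_eqI) (auto intro: sigma_sets.Basic)
  then show ?thesis
    by (simp add: borel_def)
qed

text \<open>The indicator of \<open>{q > 0}\<close> is the limit of the \<open>C\<^sup>1\<close> functions \<open>1 - e\<^sup>-\<^sup>n\<^sup>q\<close>, and these sets form a generator
  stable under intersection.\<close>

lemma torus_measure_eqI:
  assumes "prob_space M" "prob_space N" and sets: "sets M = sets borel" "sets N = sets borel"
    and eq: "\<And>a a'. torus_C1 a a' \<Longrightarrow> (\<integral>\<theta>. a \<theta> \<partial>M) = (\<integral>\<theta>. a \<theta> \<partial>N)"
  shows "M = N"
proof -
  interpret M: prob_space M by fact
  interpret N: prob_space N by fact
  have limit: "(\<lambda>n. \<integral>\<theta>. 1 - exp (- real n * q \<theta>) \<partial>P) \<longlonglongrightarrow> measure P {\<theta>. 0 < q \<theta>}"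
    if "prob_space P" "sets P = sets borel" "torus_C1 q q'" "\<And>\<theta>. 0 \<le> q \<theta>" for P q q'
  proof -
    interpret prob_space P by fact
    have q: "q \<in> borel_measurable P"
      using torus_C1_continuous[OF that(3)] unfolding measurable_cong_sets[OF that(2) refl]
      by (rule borel_measurable_continuous_onI)
    have "(\<lambda>n. \<integral>\<theta>. 1 - exp (- real n * q \<theta>) \<partial>P) \<longlonglongrightarrow> (\<integral>\<theta>. indicator {\<theta>. 0 < q \<theta>} \<theta> \<partial>P)"
    proof (rule integral_dominated_convergence[where w = "\<lambda>_. 1"])
      show "AE \<theta> in P. (\<lambda>n. 1 - exp (- real n * q \<theta>)) \<longlonglongrightarrow> indicator {\<theta>. 0 < q \<theta>} \<theta>"
      proof (intro AE_I2)
        fix \<theta>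
        show "(\<lambda>n. 1 - exp (- real n * q \<theta>)) \<longlonglongrightarrow> indicator {\<theta>. 0 < q \<theta>} \<theta>"
        proof (cases "0 < q \<theta>")
          case True
          have "(\<lambda>n. exp (- q \<theta>) ^ n) \<longlonglongrightarrow> 0"
            using True by (intro LIMSEQ_realpow_zero) auto
          then have "(\<lambda>n. 1 - exp (- real n * q \<theta>)) \<longlonglongrightarrow> 1 - 0"
            by (intro tendsto_diff tendsto_const) (simp add: exp_of_nat_mult[symmetric])
          then show ?thesis using True by simp
        next
          case False
          then have "q \<theta> = 0" using that(4)[of \<theta>] by simp
          then show ?thesis by simp
        qed
      qed
      show "AE \<theta> in P. norm (1 - exp (- real n * q \<theta>)) \<le> 1" for n
        using that(4) by (auto simp: abs_le_iff)
    qed (use q that(2) in \<open>auto intro!: borel_measurable_indicator borel_open open_Collect_less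
        torus_C1_continuous[OF that(3)] continuous_on_const\<close>)
    moreover have "{\<theta>. 0 < q \<theta>} \<in> sets P"
      unfolding that(2) by (intro borel_open open_Collect_less torus_C1_continuous[OF that(3)] continuous_on_const)
    ultimately show ?thesis by simp
  qed
  show ?thesis
  proof (rule measure_eqI_generator_eq[of torus_supports UNIV _ _ "\<lambda>_. UNIV"])
    show "Int_stable torus_supports"
    proof (rule Int_stableI)
      fix S T assume "S \<in> torus_supports"
      then obtain p p' where p: "torus_C1 p p'" "\<And>\<theta>. 0 \<le> p \<theta>" "S = {\<theta>. 0 < p \<theta>}"
        by (rule torus_supportsE) (rule that)
      assume "T \<in> torus_supports"
      then obtain q q' where q: "torus_C1 q q'" "\<And>\<theta>. 0 \<le> q \<theta>" "T = {\<theta>. 0 < q \<theta>}"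
        by (rule torus_supportsE) (rule that)
      have "S \<inter> T = {\<theta>. 0 < p \<theta> * q \<theta>}"
        using p(2) q(2) by (auto simp: p(3) q(3) zero_less_mult_iff not_less[symmetric])
      then show "S \<inter> T \<in> torus_supports"
        using torus_supportsI[OF torus_C1_mult[OF p(1) q(1)]] p(2) q(2) by simp
    qed
    show "emeasure M S = emeasure N S" if "S \<in> torus_supports" for S
      using that
    proof (rule torus_supportsE)
      fix q q' assume q: "torus_C1 q q'" "\<And>\<theta>. 0 \<le> q \<theta>" "S = {\<theta>. 0 < q \<theta>}"
      have "(\<integral>\<theta>. 1 - exp (- real n * q \<theta>) \<partial>M) = (\<integral>\<theta>. 1 - exp (- real n * q \<theta>) \<partial>N)" for n
      proof (rule eq[OF torus_C1_compose[OF q(1)]])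
        show "((\<lambda>u. 1 - exp (- real n * u)) has_real_derivative real n * exp (- real n * u)) (at u)" for u
          by (auto intro!: derivative_eq_intros)
        show "continuous_on UNIV (\<lambda>u. real n * exp (- real n * u))"
          by (intro continuous_intros)
      qed
      then have "measure M S = measure N S"
        using limit[OF \<open>prob_space M\<close> sets(1) q(1,2)] limit[OF \<open>prob_space N\<close> sets(2) q(1,2)]
        by (simp add: q(3) LIMSEQ_unique)
      then show ?thesis
        by (simp add: M.emeasure_eq_measure N.emeasure_eq_measure)
    qed
    show "range (\<lambda>_. UNIV) \<subseteq> torus_supports"
      using torus_supportsI[OF torus_C1_const[of 1]] by auto
  qed (use borel_torus_eq sets in auto)
qed

lemma integral_two_diracs:
  fixes g :: "phase_space \<Rightarrow> real"
  assumes c: "c1 \<ge> 0" "c2 \<ge> 0" "c1 + c2 = 1" and "a \<noteq> b" and g: "continuous_on UNIV g"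
  defines "\<nu> \<equiv> two_diracs c1 a c2 b \<Otimes>\<^sub>M return borel (0::real)"
  shows "(\<integral>z. g z \<partial>\<nu>) = c1 * g (a, 0) + c2 * g (b, 0)"
proof -
  let ?D = "two_diracs c1 a c2 b"
  have space_D: "space ?D = UNIV"
    using sets_eq_imp_space_eq[OF sets_two_diracs] by simp
  have "emeasure ?D (space ?D) = 1"
    using c by (simp add: space_D emeasure_two_diracs ennreal_plus[symmetric] del: ennreal_plus)
  then interpret D: prob_space ?D
    by (rule prob_spaceI)
  interpret Z: prob_space "return borel (0::real)"
    by (rule prob_space_return) simp
  interpret DZ: pair_prob_space ?D "return borel (0::real)" ..
  have sets_\<nu>: "sets \<nu> = sets borel"
  proof -
    have "sets \<nu> = sets (borel \<Otimes>\<^sub>M borel :: phase_space measure)"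
      unfolding \<nu>_def by (intro sets_pair_measure_cong sets_two_diracs sets_return)
    then show ?thesis by (simp only: borel_prod)
  qed
  have point: "emeasure \<nu> {(x, 0)} = ennreal c1 * indicator {x} a + ennreal c2 * indicator {x} b" for x
  proof -
    have x: "{x} \<in> sets borel"
      by (rule borel_closed[OF closed_torus_singleton])
    have "emeasure \<nu> ({x} \<times> {0}) = emeasure ?D {x} * emeasure (return borel (0::real)) {0}"
      unfolding \<nu>_def by (rule Z.emeasure_pair_measure_Times) (simp_all add: sets_two_diracs x)
    then show ?thesis
      using x by (simp add: emeasure_two_diracs)
  qed
  have points: "{(a, 0)} \<in> sets \<nu>" "{(b, 0)} \<in> sets \<nu>"
    using borel_closed[OF closed_Times[OF closed_torus_singleton closed_singleton[of "0::real"]]]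
    by (simp_all add: sets_\<nu>)
  have "emeasure \<nu> {(a, 0)} = ennreal c1" "emeasure \<nu> {(b, 0)} = ennreal c2"
    using \<open>a \<noteq> b\<close> by (simp_all add: point)
  then have measure: "measure \<nu> {(a, 0)} = c1" "measure \<nu> {(b, 0)} = c2"
    using c by (simp_all add: measure_def)
  interpret \<nu>: prob_space \<nu>
    unfolding \<nu>_def by (rule DZ.prob_space_axioms)
  have "measure \<nu> ({(a, 0)} \<union> {(b, 0)}) = c1 + c2"
    using \<open>a \<noteq> b\<close> points by (subst \<nu>.finite_measure_Union) (auto simp: measure)
  then have AE: "AE z in \<nu>. z \<in> {(a, 0)} \<union> {(b, 0)}"
    using points c by (intro \<nu>.AE_prob_1) simp
  have "(\<integral>z. g z \<partial>\<nu>) = (\<integral>z. g (a, 0) * indicator {(a, 0)} z + g (b, 0) * indicator {(b, 0)} z \<partial>\<nu>)"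
  proof (rule integral_cong_AE)
    show "g \<in> borel_measurable \<nu>"
      unfolding measurable_cong_sets[OF sets_\<nu> refl] by (rule borel_measurable_continuous_onI[OF g])
    show "AE z in \<nu>. g z = g (a, 0) * indicator {(a, 0)} z + g (b, 0) * indicator {(b, 0)} z"
      using AE by eventually_elim (use \<open>a \<noteq> b\<close> in auto)
  qed (use points in measurable)
  also have "\<dots> = g (a, 0) * c1 + g (b, 0) * c2"
    using points by (subst Bochner_Integration.integral_add) (simp_all add: measure \<nu>.emeasure_eq_measure)
  finally show ?thesis
    by (simp add: mult.commute)
qed

text \<open>The function \<open>sin\<^sup>2 (\<theta> - a) + \<omega>\<^sup>2\<close> vanishes only at the two poles, so by compactness it is bounded
  below where \<open>h\<close> is not small.\<close>

lemma controlled_by_distance_to_poles: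
  fixes h :: "phase_space \<Rightarrow> real"
  assumes h: "continuous_on UNIV h" "\<And>z. \<bar>h z\<bar> \<le> B"
    and zero: "h (a, 0) = 0" "h (a + to_torus pi, 0) = 0" and "\<epsilon> > 0"
  shows "\<exists>C\<ge>0. \<forall>\<theta> \<omega>. \<bar>h (\<theta>, \<omega>)\<bar> \<le> \<epsilon> + C * ((torus_sin (\<theta> - a))\<^sup>2 + \<omega>\<^sup>2)"
proof -
  let ?d = "\<lambda>z::phase_space. (torus_sin (fst z - a))\<^sup>2 + (snd z)\<^sup>2"
  let ?K = "(UNIV \<times> {- 1..1}) \<inter> {z. \<epsilon> \<le> \<bar>h z\<bar>}"
  have B: "B \<ge> 0"
    using order_trans[OF abs_ge_zero h(2)] .
  have cont: "continuous_on UNIV ?d"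
    by (intro continuous_intros continuous_on_compose2[OF continuous_torus_sin_diff]) auto
  have "compact ?K"
    by (intro compact_Int_closed compact_Times compact_torus compact_Icc closed_Collect_le
        continuous_on_rabs h continuous_on_const)
  have "\<exists>\<delta>>0. \<forall>z\<in>?K. \<delta> \<le> ?d z"
  proof (cases "?K = {}")
    case True
    then show ?thesis by (auto intro: exI[of _ 1])
  next
    case False
    obtain z where z: "z \<in> ?K" "\<And>z'. z' \<in> ?K \<Longrightarrow> ?d z \<le> ?d z'"
      using continuous_attains_inf[OF \<open>compact ?K\<close> False continuous_on_subset[OF cont subset_UNIV]] by blast
    have "?d z \<noteq> 0"
    proof
      assume "?d z = 0"
      then have "torus_sin (fst z - a) = 0" "snd z = 0"
        by (auto simp: sum_power2_eq_zero_iff)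
      then have "h z = 0"
        using torus_sin_diff_eq_0_imp[of "fst z" a] zero by (cases z) auto
      then show False
        using z(1) \<open>\<epsilon> > 0\<close> by simp
    qed
    then have "?d z > 0"
      by (simp add: order_less_le)
    then show ?thesis
      using z(2) by blast
  qed
  then obtain \<delta> where \<delta>: "\<delta> > 0" "\<And>z. z \<in> ?K \<Longrightarrow> \<delta> \<le> ?d z"
    by blast
  define \<eta> where "\<eta> = min \<delta> 1"
  have \<eta>: "\<eta> > 0" "\<eta> \<le> \<delta>" "\<eta> \<le> 1"
    using \<delta> by (auto simp: \<eta>_def)
  have "\<bar>h (\<theta>, \<omega>)\<bar> \<le> \<epsilon> + B / \<eta> * ((torus_sin (\<theta> - a))\<^sup>2 + \<omega>\<^sup>2)" for \<theta> \<omega>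
  proof (cases "\<epsilon> \<le> \<bar>h (\<theta>, \<omega>)\<bar>")
    case True
    have "\<eta> \<le> (torus_sin (\<theta> - a))\<^sup>2 + \<omega>\<^sup>2"
    proof (cases "\<bar>\<omega>\<bar> \<le> 1")
      case \<omega>: True
      then have "(\<theta>, \<omega>) \<in> ?K"
        using True by (simp add: abs_le_iff minus_le_iff)
      then show ?thesis
        using \<delta>(2)[of "(\<theta>, \<omega>)"] \<eta>(2) by simp
    next
      case False
      then have "1 \<le> \<omega>\<^sup>2"
        using abs_square_le_1[of \<omega>] by linarith
      then show ?thesis
        using \<eta>(3) zero_le_power2[of "torus_sin (\<theta> - a)"] by linarith
    qed
    then have "B / \<eta> * \<eta> \<le> B / \<eta> * ((torus_sin (\<theta> - a))\<^sup>2 + \<omega>\<^sup>2)"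
      using B \<eta> by (intro mult_left_mono) auto
    then have "B \<le> B / \<eta> * ((torus_sin (\<theta> - a))\<^sup>2 + \<omega>\<^sup>2)"
      using \<eta>(1) by simp
    then show ?thesis
      using h(2)[of "(\<theta>, \<omega>)"] \<open>\<epsilon> > 0\<close> by linarith
  next
    case False
    moreover have "0 \<le> B / \<eta> * ((torus_sin (\<theta> - a))\<^sup>2 + \<omega>\<^sup>2)"
      using B \<eta> by (intro mult_nonneg_nonneg divide_nonneg_pos) auto
    ultimately show ?thesis by linarith
  qed
  then show ?thesis
    using B \<eta>(1) by (intro exI[of _ "B / \<eta>"]) auto
qed

section \<open>Moments of the solution\<close>

text \<open>The observables whose averages the second moment controls.\<close>

definition quadratic_growth :: "(torus \<Rightarrow> real \<Rightarrow> real) \<Rightarrow> bool" where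
  "quadratic_growth h \<longleftrightarrow> continuous_on UNIV (\<lambda>z. h (fst z) (snd z)) \<and>
    (\<exists>C. \<forall>\<theta> \<omega>. \<bar>h \<theta> \<omega>\<bar> \<le> C * (1 + \<omega>\<^sup>2))"

lemma quadratic_growthI:
  assumes "continuous_on UNIV (\<lambda>z. h (fst z) (snd z))" "\<And>\<theta> \<omega>. \<bar>h \<theta> \<omega>\<bar> \<le> C * (1 + \<omega>\<^sup>2)"
  shows "quadratic_growth h"
  using assms unfolding quadratic_growth_def by blast

lemma quadratic_growth_continuous:
  "quadratic_growth h \<Longrightarrow> continuous_on UNIV (\<lambda>z. h (fst z) (snd z))"
  unfolding quadratic_growth_def by blast

lemma quadratic_growth_add:
  assumes "quadratic_growth g" "quadratic_growth h"
  shows "quadratic_growth (\<lambda>\<theta> \<omega>. g \<theta> \<omega> + h \<theta> \<omega>)"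
proof -
  obtain C D where "\<And>\<theta> \<omega>. \<bar>g \<theta> \<omega>\<bar> \<le> C * (1 + \<omega>\<^sup>2)" "\<And>\<theta> \<omega>. \<bar>h \<theta> \<omega>\<bar> \<le> D * (1 + \<omega>\<^sup>2)"
    using assms unfolding quadratic_growth_def by blast
  then have "\<bar>g \<theta> \<omega> + h \<theta> \<omega>\<bar> \<le> (C + D) * (1 + \<omega>\<^sup>2)" for \<theta> \<omega>
    using abs_triangle_ineq[of "g \<theta> \<omega>" "h \<theta> \<omega>"] add_mono[of "\<bar>g \<theta> \<omega>\<bar>" _ "\<bar>h \<theta> \<omega>\<bar>"]
    unfolding distrib_right by (meson order_trans)
  then show ?thesis
    by (rule quadratic_growthI[OF continuous_on_add[OF assms[THEN quadratic_growth_continuous]]])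
qed

lemma quadratic_growth_product:
  assumes "continuous_on UNIV a" "continuous_on UNIV b" "\<And>\<omega>. \<bar>b \<omega>\<bar> \<le> C * (1 + \<omega>\<^sup>2)"
  shows "quadratic_growth (\<lambda>\<theta> \<omega>. a \<theta> * b \<omega>)"
proof -
  obtain A where A: "A \<ge> 0" "\<And>\<theta>. \<bar>a \<theta>\<bar> \<le> A"
    using torus_continuous_bounded[OF assms(1)] by blast
  then have "\<bar>a \<theta> * b \<omega>\<bar> \<le> (A * C) * (1 + \<omega>\<^sup>2)" for \<theta> \<omega>
    using mult_mono[OF A(2)[of \<theta>] assms(3)[of \<omega>]] by (simp add: abs_mult mult.assoc)
  moreover have "continuous_on UNIV (\<lambda>z. a (fst z) * b (snd z))"
    by (intro continuous_intros continuous_on_compose2[OF assms(1)] continuous_on_compose2[OF assms(2)])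
      auto
  ultimately show ?thesis
    unfolding quadratic_growth_def by blast
qed

lemma one_le_quadratic: "1 \<le> 1 + \<omega>\<^sup>2" and abs_le_quadratic: "\<bar>\<omega>\<bar> \<le> 1 + \<omega>\<^sup>2" for \<omega> :: real
  using sum_squares_bound[of "\<bar>\<omega>\<bar>" 1] zero_le_power2[of \<omega>] by (simp, simp)

lemma quadratic_growth_angle:
  "continuous_on UNIV a \<Longrightarrow> quadratic_growth (\<lambda>\<theta> \<omega>. a \<theta>)"
  using quadratic_growth_product[of a "\<lambda>_. 1" 1] by simp

lemma quadratic_growth_first:
  "continuous_on UNIV a \<Longrightarrow> quadratic_growth (\<lambda>\<theta> \<omega>. a \<theta> * \<omega>)"
  using quadratic_growth_product[of a "\<lambda>\<omega>. \<omega>" 1] by (simp add: abs_le_quadratic)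

lemma quadratic_growth_second:
  "continuous_on UNIV a \<Longrightarrow> quadratic_growth (\<lambda>\<theta> \<omega>. a \<theta> * \<omega>\<^sup>2)"
  using quadratic_growth_product[of a "\<lambda>\<omega>. \<omega>\<^sup>2" 1] by (simp add: continuous_intros)

lemma quadratic_growth_cmult:
  assumes "quadratic_growth h"
  shows "quadratic_growth (\<lambda>\<theta> \<omega>. c * h \<theta> \<omega>)"
proof -
  obtain C where C: "\<And>\<theta> \<omega>. \<bar>h \<theta> \<omega>\<bar> \<le> C * (1 + \<omega>\<^sup>2)"
    using assms unfolding quadratic_growth_def by blast
  then have "\<bar>c * h \<theta> \<omega>\<bar> \<le> (\<bar>c\<bar> * C) * (1 + \<omega>\<^sup>2)" for \<theta> \<omega>
    using mult_left_mono[OF C, of "\<bar>c\<bar>"] by (simp add: abs_mult mult.assoc)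
  then show ?thesis
    by (rule quadratic_growthI[OF continuous_on_mult_left[OF assms[THEN quadratic_growth_continuous]]])
qed

lemma quadratic_growth_compact:
  assumes "continuous_on UNIV a" "continuous_on UNIV b" "\<And>\<omega>. \<omega>\<^sup>2 \<ge> B \<Longrightarrow> b \<omega> = 0"
  shows "quadratic_growth (\<lambda>\<theta> \<omega>. a \<theta> * b \<omega>)"
proof -
  have "bounded (b ` {- sqrt \<bar>B\<bar>..sqrt \<bar>B\<bar>})"
    using assms(2) by (intro compact_imp_bounded compact_continuous_image)
      (auto intro: continuous_on_subset)
  then obtain D where D: "D > 0" "\<And>\<omega>. \<omega> \<in> {- sqrt \<bar>B\<bar>..sqrt \<bar>B\<bar>} \<Longrightarrow> \<bar>b \<omega>\<bar> \<le> D"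
    unfolding bounded_pos by auto
  have bD: "\<bar>b \<omega>\<bar> \<le> D" for \<omega>
  proof (cases "\<bar>\<omega>\<bar> \<le> sqrt \<bar>B\<bar>")
    case True
    then show ?thesis by (intro D(2)) (simp add: abs_le_iff)
  next
    case False
    then have "sqrt \<bar>B\<bar> ^ 2 \<le> \<bar>\<omega>\<bar>\<^sup>2" by (intro power_mono) auto
    then have "b \<omega> = 0" by (intro assms(3)) simp
    then show ?thesis using D(1) by simp
  qed
  have "\<bar>b \<omega>\<bar> \<le> D * (1 + \<omega>\<^sup>2)" for \<omega>
    using bD[of \<omega>] D(1) mult_left_mono[OF one_le_quadratic, of D \<omega>] by linarith
  then show "quadratic_growth (\<lambda>\<theta> \<omega>. a \<theta> * b \<omega>)"
    by (rule quadratic_growth_product[OF assms(1,2)])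
qed

locale kuramoto_flow =
  fixes m \<gamma> \<kappa> :: real and f :: "real \<Rightarrow> phase_space measure"
  assumes m: "m > 0" and \<gamma>: "\<gamma> > 0" and \<kappa>: "\<kappa> > 0"
    and Linf: "Linf_P2 f"
    and solution: "global_measure_valued_solution m \<gamma> \<kappa> (f 0) f"
begin

definition mean :: "(torus \<Rightarrow> real \<Rightarrow> real) \<Rightarrow> real \<Rightarrow> real" where
  "mean h t = (\<integral>z. h (fst z) (snd z) \<partial>f t)"

lemma
  assumes "t \<ge> 0"
  shows prob: "prob_space (f t)" and sets_f: "sets (f t) = sets borel"
    and integrable_square: "integrable (f t) (\<lambda>z. (snd z)\<^sup>2)"
  using Linf assms unfolding Linf_P2_def P2_def by (auto simp: case_prod_beta')

lemma integrable_growth: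
  assumes "quadratic_growth h" "t \<ge> 0"
  shows "integrable (f t) (\<lambda>z. h (fst z) (snd z))"
proof -
  interpret prob_space "f t" by (rule prob[OF assms(2)])
  obtain C where C: "\<And>\<theta> \<omega>. \<bar>h \<theta> \<omega>\<bar> \<le> C * (1 + \<omega>\<^sup>2)"
    using assms(1) unfolding quadratic_growth_def by blast
  show ?thesis
  proof (rule Bochner_Integration.integrable_bound)
    show "integrable (f t) (\<lambda>z. C * (1 + (snd z)\<^sup>2))"
      using integrable_square[OF assms(2)] by simp
    show "(\<lambda>z. h (fst z) (snd z)) \<in> borel_measurable (f t)"
      using assms(1) unfolding quadratic_growth_def measurable_cong_sets[OF sets_f[OF assms(2)] refl]
      by (blast intro: borel_measurable_continuous_onI)
    show "AE z in f t. norm (h (fst z) (snd z)) \<le> norm (C * (1 + (snd z)\<^sup>2))"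
      using C by (auto intro: order_trans[OF _ abs_ge_self])
  qed
qed

lemma mean_const: "t \<ge> 0 \<Longrightarrow> mean (\<lambda>\<theta> \<omega>. c) t = c"
  by (simp add: mean_def prob prob_space.prob_space)

lemma mean_add:
  assumes "quadratic_growth g" "quadratic_growth h" "t \<ge> 0"
  shows "mean (\<lambda>\<theta> \<omega>. g \<theta> \<omega> + h \<theta> \<omega>) t = mean g t + mean h t"
  using assms by (simp add: mean_def integrable_growth)

lemma mean_cmult: "mean (\<lambda>\<theta> \<omega>. c * h \<theta> \<omega>) t = c * mean h t"
  by (simp add: mean_def)

lemma mean_mono:
  assumes "quadratic_growth g" "quadratic_growth h" "t \<ge> 0" "\<And>\<theta> \<omega>. g \<theta> \<omega> \<le> h \<theta> \<omega>"
  shows "mean g t \<le> mean h t"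
  unfolding mean_def using assms by (intro integral_mono integrable_growth) auto

lemma abs_mean_le:
  assumes "quadratic_growth g" "quadratic_growth h" "t \<ge> 0" "\<And>\<theta> \<omega>. \<bar>g \<theta> \<omega>\<bar> \<le> h \<theta> \<omega>"
  shows "\<bar>mean g t\<bar> \<le> mean h t"
proof -
  have "mean g t \<le> mean h t"
    using assms by (intro mean_mono) (auto simp: abs_le_iff)
  moreover have "mean (\<lambda>\<theta> \<omega>. - 1 * g \<theta> \<omega>) t \<le> mean h t"
    using assms by (intro mean_mono quadratic_growth_cmult) (auto simp: abs_le_iff minus_le_iff)
  ultimately show ?thesis
    unfolding mean_cmult by linarith
qed

lemma mean_dominated_convergence:
  assumes "\<And>n. quadratic_growth (g n)" "quadratic_growth h" "t \<ge> 0"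
    and "\<And>n \<theta> \<omega>. \<bar>g n \<theta> \<omega>\<bar> \<le> C * (1 + \<omega>\<^sup>2)"
    and "\<And>\<theta> \<omega>. (\<lambda>n. g n \<theta> \<omega>) \<longlonglongrightarrow> h \<theta> \<omega>"
  shows "(\<lambda>n. mean (g n) t) \<longlonglongrightarrow> mean h t"
  unfolding mean_def
proof (rule integral_dominated_convergence)
  interpret prob_space "f t" by (rule prob[OF assms(3)])
  show "integrable (f t) (\<lambda>z. C * (1 + (snd z)\<^sup>2))"
    using integrable_square[OF assms(3)] by simp
qed (use assms integrable_growth[THEN borel_measurable_integrable] in auto)

definition energy :: "real \<Rightarrow> real" where
  "energy = mean (\<lambda>\<theta> \<omega>. \<omega>\<^sup>2)"

lemma quadratic_growth_energy: "quadratic_growth (\<lambda>\<theta> \<omega>. \<omega>\<^sup>2)"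
  using quadratic_growth_second[of "\<lambda>_. 1"] by simp

lemma energy_nonneg: "energy t \<ge> 0"
  by (simp add: energy_def mean_def)

lemma abs_mean_le_energy:
  assumes "quadratic_growth h" "t \<ge> 0" "\<And>\<theta> \<omega>. \<bar>h \<theta> \<omega>\<bar> \<le> C * (1 + \<omega>\<^sup>2)"
  shows "\<bar>mean h t\<bar> \<le> C * (1 + energy t)"
proof -
  have growth: "quadratic_growth (\<lambda>\<theta> \<omega>. 1 + \<omega>\<^sup>2)"
    by (intro quadratic_growth_add quadratic_growth_energy quadratic_growth_angle continuous_intros)
  have "\<bar>mean h t\<bar> \<le> mean (\<lambda>\<theta> \<omega>. C * (1 + \<omega>\<^sup>2)) t"
    using assms growth by (intro abs_mean_le quadratic_growth_cmult)
  also have "\<dots> = C * (1 + energy t)"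
    using assms(2) unfolding mean_cmult energy_def
    by (subst mean_add) (auto simp: mean_const quadratic_growth_energy
        intro: quadratic_growth_angle continuous_intros)
  finally show ?thesis .
qed

text \<open>The solution property only speaks about bounded time intervals \<open>[0,T)\<close>; continuity is local, so it
  holds on the whole half-line.\<close>

lemma weakly_continuous:
  assumes "continuous_on UNIV (\<lambda>z. h (fst z) (snd z))" "bounded (range (\<lambda>z. h (fst z) (snd z)))"
  shows "continuous_on {0..} (mean h)"
  unfolding continuous_on_eq_continuous_within
proof
  fix t :: real assume "t \<in> {0..}"
  then have t: "t \<ge> 0" by simp
  have "weakly_continuous_on {0..<t + 1} f"
    using solution t
    unfolding global_measure_valued_solution_def measure_valued_solution_def by simp
  then have "continuous_on {0..<t + 1} (mean h)"
    using assms unfolding weakly_continuous_on_def mean_def[abs_def] by blast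
  then have "continuous (at t within {0..<t + 1}) (mean h)"
    using t by (simp add: continuous_on_eq_continuous_within)
  moreover have "at t within {0..<t + 1} = at t within {0..}"
    by (rule at_within_nhd[of _ "{..<t + 1}"]) auto
  ultimately show "continuous (at t within {0..}) (mean h)"
    by simp
qed

definition mean_cos :: "real \<Rightarrow> real" where "mean_cos = mean (\<lambda>\<theta> \<omega>. torus_cos \<theta>)"
definition mean_sin :: "real \<Rightarrow> real" where "mean_sin = mean (\<lambda>\<theta> \<omega>. torus_sin \<theta>)"

text \<open>In terms of the order parameter \<open>R\<close> and the average phase \<open>\<phi>\<close> this is \<open>R sin (\<phi> - \<theta>)\<close>, the imaginary
  part of \<open>R e\<^sup>i\<^sup>\<phi> e\<^sup>-\<^sup>i\<^sup>\<theta>\<close>.\<close>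

definition field :: "real \<Rightarrow> torus \<Rightarrow> real" where
  "field t \<theta> = mean_sin t * torus_cos \<theta> - mean_cos t * torus_sin \<theta>"

lemma kuramoto_force_field:
  assumes "t \<ge> 0"
  shows "kuramoto_force m \<gamma> \<kappa> (f t) \<theta> \<omega> = (\<kappa> * field t \<theta> - \<gamma> * \<omega>) / m"
proof -
  have "(\<integral>(\<theta>', \<omega>'). torus_sin (\<theta>' - \<theta>) \<partial>f t) =
      mean (\<lambda>\<theta>' \<omega>. torus_cos \<theta> * torus_sin \<theta>' + (- torus_sin \<theta>) * torus_cos \<theta>') t"
    unfolding mean_def by (intro Bochner_Integration.integral_cong)
      (auto simp: torus_sin_diff algebra_simps)
  also have "\<dots> = torus_cos \<theta> * mean_sin t + (- torus_sin \<theta>) * mean_cos t"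
    using assms unfolding mean_sin_def mean_cos_def
    by (subst mean_add) (auto simp only: mean_cmult intro!: quadratic_growth_cmult
       quadratic_growth_angle continuous_torus_cos continuous_torus_sin continuous_on_mult_left)
  also have "\<dots> = field t \<theta>"
    by (simp add: field_def)
  finally show ?thesis
    unfolding kuramoto_force_def by (simp add: divide_inverse mult.commute)
qed

lemma continuous_field: "continuous_on UNIV (field t)"
  unfolding field_def[abs_def]
  by (intro continuous_intros continuous_torus_cos continuous_torus_sin)

lemma abs_mean_angle_le:
  assumes "continuous_on UNIV a" "t \<ge> 0" "\<And>\<theta>. \<bar>a \<theta>\<bar> \<le> A"
  shows "\<bar>mean (\<lambda>\<theta> \<omega>. a \<theta>) t\<bar> \<le> A"
proof -
  have "\<bar>mean (\<lambda>\<theta> \<omega>. a \<theta>) t\<bar> \<le> mean (\<lambda>\<theta> \<omega>. A) t"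
    using assms by (intro abs_mean_le quadratic_growth_angle) (auto intro: continuous_intros)
  then show ?thesis using assms(2) by (simp add: mean_const)
qed

lemma abs_mean_cos_le: "t \<ge> 0 \<Longrightarrow> \<bar>mean_cos t\<bar> \<le> 1"
  unfolding mean_cos_def
  by (intro abs_mean_angle_le continuous_torus_cos) (auto simp: abs_torus_cos_le)

lemma abs_mean_sin_le: "t \<ge> 0 \<Longrightarrow> \<bar>mean_sin t\<bar> \<le> 1"
  unfolding mean_sin_def
  by (intro abs_mean_angle_le continuous_torus_sin) (auto simp: abs_torus_sin_le)

lemma abs_field_le:
  assumes "t \<ge> 0"
  shows "\<bar>field t \<theta>\<bar> \<le> 2"
proof -
  have "\<bar>mean_sin t * torus_cos \<theta>\<bar> \<le> 1 * 1" "\<bar>mean_cos t * torus_sin \<theta>\<bar> \<le> 1 * 1"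
    unfolding abs_mult using assms
    by (intro mult_mono abs_mean_cos_le abs_mean_sin_le abs_torus_cos_le abs_torus_sin_le; simp)+
  then show ?thesis
    unfolding field_def by linarith
qed

section \<open>Evolution of the moments\<close>

text \<open>The transport operator at time \<open>t\<close>, applied to \<open>a(\<theta>) b(\<omega>)\<close>.\<close>

definition drift ::
    "(torus \<Rightarrow> real) \<Rightarrow> (torus \<Rightarrow> real) \<Rightarrow> (real \<Rightarrow> real) \<Rightarrow> (real \<Rightarrow> real) \<Rightarrow> real \<Rightarrow> torus \<Rightarrow> real \<Rightarrow> real"
  where "drift a a' b b' t \<theta> \<omega> =
    a' \<theta> * (\<omega> * b \<omega>) + a \<theta> * ((\<kappa> * field t \<theta> - \<gamma> * \<omega>) / m * b' \<omega>)"

lemma continuous_mean_cos: "continuous_on {0..} mean_cos"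
  and continuous_mean_sin: "continuous_on {0..} mean_sin"
  unfolding mean_cos_def mean_sin_def
  using quadratic_growth_angle[OF continuous_torus_cos] quadratic_growth_angle[OF continuous_torus_sin]
  by (intro weakly_continuous boundedI[of _ 1];
    auto simp: abs_torus_cos_le abs_torus_sin_le quadratic_growth_def)+

text \<open>The force depends on the solution only through \<open>\<langle>cos \<theta>\<rangle>\<close> and \<open>\<langle>sin \<theta>\<rangle>\<close>, so the average of the drift is a
  polynomial in averages of observables that do not depend on time.\<close>

lemma mean_drift:
  assumes growth: "quadratic_growth (\<lambda>\<theta> \<omega>. a' \<theta> * (\<omega> * b \<omega>))"
    "quadratic_growth (\<lambda>\<theta> \<omega>. (torus_cos \<theta> * a \<theta>) * b' \<omega>)"
    "quadratic_growth (\<lambda>\<theta> \<omega>. (torus_sin \<theta> * a \<theta>) * b' \<omega>)"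
    "quadratic_growth (\<lambda>\<theta> \<omega>. a \<theta> * (\<omega> * b' \<omega>))"
    and "t \<ge> 0"
  shows "mean (drift a a' b b' t) t = mean (\<lambda>\<theta> \<omega>. a' \<theta> * (\<omega> * b \<omega>)) t +
      (\<kappa> / m * mean_sin t * mean (\<lambda>\<theta> \<omega>. (torus_cos \<theta> * a \<theta>) * b' \<omega>) t +
      ((- \<kappa> / m) * mean_cos t * mean (\<lambda>\<theta> \<omega>. (torus_sin \<theta> * a \<theta>) * b' \<omega>) t +
      (- \<gamma> / m) * mean (\<lambda>\<theta> \<omega>. a \<theta> * (\<omega> * b' \<omega>)) t))"
proof -
  have "drift a a' b b' t = (\<lambda>\<theta> \<omega>. a' \<theta> * (\<omega> * b \<omega>) +
      (\<kappa> / m * mean_sin t * ((torus_cos \<theta> * a \<theta>) * b' \<omega>) +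
      ((- \<kappa> / m) * mean_cos t * ((torus_sin \<theta> * a \<theta>) * b' \<omega>) +
      (- \<gamma> / m) * (a \<theta> * (\<omega> * b' \<omega>)))))"
    using m by (intro ext) (simp add: drift_def field_def field_simps)
  then show ?thesis
    using assms by (simp only: mean_add mean_cmult quadratic_growth_add quadratic_growth_cmult)
qed

text \<open>Asking continuity only of factors that vanish where \<open>b\<close> and \<open>b'\<close> do makes the statement apply to
  truncated functions, for which weak continuity suffices, as well as to untruncated ones.\<close>

lemma continuous_mean_drift:
  assumes growth: "quadratic_growth (\<lambda>\<theta> \<omega>. a' \<theta> * (\<omega> * b \<omega>))"
    "quadratic_growth (\<lambda>\<theta> \<omega>. (torus_cos \<theta> * a \<theta>) * b' \<omega>)"
    "quadratic_growth (\<lambda>\<theta> \<omega>. (torus_sin \<theta> * a \<theta>) * b' \<omega>)"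
    "quadratic_growth (\<lambda>\<theta> \<omega>. a \<theta> * (\<omega> * b' \<omega>))"
    and cont: "\<And>p q. quadratic_growth (\<lambda>\<theta> \<omega>. p \<theta> * q \<omega>) \<Longrightarrow>
        (\<And>\<omega>. b \<omega> = 0 \<Longrightarrow> b' \<omega> = 0 \<Longrightarrow> q \<omega> = 0) \<Longrightarrow>
        continuous_on {0..} (mean (\<lambda>\<theta> \<omega>. p \<theta> * q \<omega>))"
  shows "continuous_on {0..} (\<lambda>s. mean (drift a a' b b' s) s)"
proof -
  have "continuous_on {0..} (\<lambda>t. mean (\<lambda>\<theta> \<omega>. a' \<theta> * (\<omega> * b \<omega>)) t +
      (\<kappa> / m * mean_sin t * mean (\<lambda>\<theta> \<omega>. (torus_cos \<theta> * a \<theta>) * b' \<omega>) t +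
      ((- \<kappa> / m) * mean_cos t * mean (\<lambda>\<theta> \<omega>. (torus_sin \<theta> * a \<theta>) * b' \<omega>) t +
      (- \<gamma> / m) * mean (\<lambda>\<theta> \<omega>. a \<theta> * (\<omega> * b' \<omega>)) t)))"
    using growth by (intro continuous_on_add continuous_on_mult continuous_on_const cont
        continuous_mean_cos continuous_mean_sin) auto
  then show ?thesis
    by (rule continuous_on_eq) (simp add: mean_drift[OF growth])
qed

lemma continuous_mean_drift_compact:
  assumes a: "torus_C1 a a'" and b: "continuous_on UNIV b" "continuous_on UNIV b'"
    and supp: "\<And>\<omega>. \<omega>\<^sup>2 \<ge> B \<Longrightarrow> b \<omega> = 0 \<and> b' \<omega> = 0"
  shows "continuous_on {0..} (\<lambda>s. mean (drift a a' b b' s) s)"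
proof -
  have cont: "continuous_on UNIV a" "continuous_on UNIV a'"
    using a torus_C1_continuous by (auto simp: torus_C1_def)
  have cont': "continuous_on UNIV (\<lambda>\<theta>. torus_cos \<theta> * a \<theta>)" "continuous_on UNIV (\<lambda>\<theta>. torus_sin \<theta> * a \<theta>)"
    "continuous_on UNIV (\<lambda>\<omega>. \<omega> * b \<omega>)" "continuous_on UNIV (\<lambda>\<omega>. \<omega> * b' \<omega>)"
    by (intro continuous_intros continuous_torus_cos continuous_torus_sin cont b)+
  show ?thesis
  proof (rule continuous_mean_drift)
    show "quadratic_growth (\<lambda>\<theta> \<omega>. a' \<theta> * (\<omega> * b \<omega>))"
      by (rule quadratic_growth_compact[OF cont(2) cont'(3), of B]) (simp add: supp)
    show "quadratic_growth (\<lambda>\<theta> \<omega>. (torus_cos \<theta> * a \<theta>) * b' \<omega>)"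
      by (rule quadratic_growth_compact[OF cont'(1) b(2), of B]) (simp add: supp)
    show "quadratic_growth (\<lambda>\<theta> \<omega>. (torus_sin \<theta> * a \<theta>) * b' \<omega>)"
      by (rule quadratic_growth_compact[OF cont'(2) b(2), of B]) (simp add: supp)
    show "quadratic_growth (\<lambda>\<theta> \<omega>. a \<theta> * (\<omega> * b' \<omega>))"
      by (rule quadratic_growth_compact[OF cont(1) cont'(4), of B]) (simp add: supp)
    show "continuous_on {0..} (mean (\<lambda>\<theta> \<omega>. p \<theta> * q \<omega>))"
      if pq: "quadratic_growth (\<lambda>\<theta> \<omega>. p \<theta> * q \<omega>)" "\<And>\<omega>. b \<omega> = 0 \<Longrightarrow> b' \<omega> = 0 \<Longrightarrow> q \<omega> = 0" for p q
    proof (rule weakly_continuous)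
      obtain C where C: "\<And>\<theta> \<omega>. \<bar>p \<theta> * q \<omega>\<bar> \<le> C * (1 + \<omega>\<^sup>2)"
        using pq(1) by (auto simp: quadratic_growth_def)
      have "\<bar>p \<theta> * q \<omega>\<bar> \<le> \<bar>C\<bar> * (1 + \<bar>B\<bar>)" for \<theta> \<omega>
      proof (cases "\<omega>\<^sup>2 \<ge> B")
        case True
        then show ?thesis using supp pq(2) by simp
      next
        case False
        have "\<bar>p \<theta> * q \<omega>\<bar> \<le> \<bar>C\<bar> * (1 + \<omega>\<^sup>2)"
          using mult_right_mono[OF abs_ge_self, of "1 + \<omega>\<^sup>2" C] C[of \<theta> \<omega>] by simp
        also have "\<dots> \<le> \<bar>C\<bar> * (1 + \<bar>B\<bar>)"
          using False by (intro mult_left_mono) auto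
        finally show ?thesis .
      qed
      then show "bounded (range (\<lambda>z. p (fst z) * q (snd z)))"
        by (intro boundedI) auto
      show "continuous_on UNIV (\<lambda>z. p (fst z) * q (snd z))"
        using pq(1) by (simp add: quadratic_growth_def)
    qed
  qed
qed

text \<open>Multiplying by a cutoff in time that is still one on \<open>[0,t]\<close> turns a function of the phase
  alone into an admissible test function.\<close>

lemma test_function_product:
  assumes a: "torus_C1 a a'" and b: "\<And>\<omega>. (b has_real_derivative b' \<omega>) (at \<omega>)" "continuous_on UNIV b'"
    and supp: "\<And>\<omega>. \<omega>\<^sup>2 \<ge> B \<Longrightarrow> b \<omega> = 0" and t: "t \<ge> 0"
  shows "test_function (t + 2) (\<lambda>(\<theta>, \<omega>, s). a \<theta> * b \<omega> * cutoff (s - t))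
    (\<lambda>(\<theta>, \<omega>, s). a' \<theta> * b \<omega> * cutoff (s - t)) (\<lambda>(\<theta>, \<omega>, s). a \<theta> * b' \<omega> * cutoff (s - t))
    (\<lambda>(\<theta>, \<omega>, s). a \<theta> * b \<omega> * cutoff' (s - t))"
proof -
  have cont: "continuous_on UNIV a" "continuous_on UNIV a'" "continuous_on UNIV b"
    using a torus_C1_continuous[OF a] DERIV_continuous_on[OF b(1)] by (auto simp: torus_C1_def)
  have product: "continuous_on S (\<lambda>(\<theta>, \<omega>, s). p \<theta> * q \<omega> * r (s - t))"
    if "continuous_on UNIV p" "continuous_on UNIV q" "continuous_on UNIV r"
    for S and p :: "torus \<Rightarrow> real" and q r :: "real \<Rightarrow> real"
    unfolding case_prod_beta'
    by (intro continuous_on_mult continuous_on_compose2[OF that(1)] continuous_on_compose2[OF that(2)]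
        continuous_on_compose2[OF that(3)] continuous_intros) auto
  have deriv: "((\<lambda>s. cutoff (s - t)) has_real_derivative cutoff' (s - t)) (at s within S)" for s S
  proof -
    have "((\<lambda>s. s - t) has_real_derivative 1) (at s within S)"
      by (auto intro!: derivative_eq_intros)
    from DERIV_chain2[OF cutoff_deriv this] show ?thesis by simp
  qed
  have vanish: "b \<omega> = 0 \<or> cutoff (s - t) = 0"
    if "\<bar>\<omega>\<bar> > sqrt \<bar>B\<bar> \<or> s > t + 1" for \<omega> s
  proof (cases "s \<le> t + 1")
    case True
    then have "sqrt \<bar>B\<bar> ^ 2 \<le> \<bar>\<omega>\<bar>\<^sup>2" using that by (intro power_mono) auto
    then show ?thesis using supp[of \<omega>] by simp
  qed (simp add: cutoff_right)
  let ?K = "UNIV \<times> {- sqrt \<bar>B\<bar>..sqrt \<bar>B\<bar>} \<times> {0..t + 1} :: (torus \<times> real \<times> real) set"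
  have "compact ?K"
    by (intro compact_Times compact_torus compact_Icc)
  moreover have "?K \<subseteq> UNIV \<times> UNIV \<times> {0..<t + 2}"
    by auto
  moreover have "\<forall>z \<in> (UNIV \<times> UNIV \<times> {0..<t + 2}) - ?K.
      (case z of (\<theta>, \<omega>, s) \<Rightarrow> a \<theta> * b \<omega> * cutoff (s - t)) = 0"
  proof
    fix z :: "torus \<times> real \<times> real"
    assume z: "z \<in> UNIV \<times> UNIV \<times> {0..<t + 2} - ?K"
    obtain \<theta> \<omega> s where z_eq: "z = (\<theta>, \<omega>, s)"
      by (cases z)
    have "\<bar>\<omega>\<bar> > sqrt \<bar>B\<bar> \<or> s > t + 1"
    proof (rule ccontr)
      assume "\<not> (\<bar>\<omega>\<bar> > sqrt \<bar>B\<bar> \<or> s > t + 1)"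
      then have "z \<in> ?K" using z by (simp add: z_eq not_less abs_le_iff minus_le_iff)
      then show False using z by simp
    qed
    then show "(case z of (\<theta>, \<omega>, s) \<Rightarrow> a \<theta> * b \<omega> * cutoff (s - t)) = 0"
      using vanish[of \<omega> s] by (auto simp: z_eq)
  qed
  ultimately have "\<exists>K. compact K \<and> K \<subseteq> UNIV \<times> UNIV \<times> {0..<t + 2} \<and>
      (\<forall>z \<in> (UNIV \<times> UNIV \<times> {0..<t + 2}) - K.
        (case z of (\<theta>, \<omega>, s) \<Rightarrow> a \<theta> * b \<omega> * cutoff (s - t)) = 0)"
    by blast
  moreover have "((\<lambda>y. a (to_torus y) * b \<omega> * cutoff (s - t)) has_real_derivative
      a' (to_torus x) * b \<omega> * cutoff (s - t)) (at x)" for x \<omega> s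
    using a by (intro DERIV_cmult_right) (simp add: torus_C1_def)
  moreover have "((\<lambda>y. a (to_torus x) * b y * cutoff (s - t)) has_real_derivative
      a (to_torus x) * b' \<omega> * cutoff (s - t)) (at \<omega>)" for x \<omega> s
    by (intro DERIV_cmult_right DERIV_cmult b)
  moreover have "((\<lambda>s. a (to_torus x) * b \<omega> * cutoff (s - t)) has_real_derivative
      a (to_torus x) * b \<omega> * cutoff' (s - t)) (at s within S)" for x \<omega> s S
    by (intro DERIV_cmult deriv)
  ultimately show ?thesis
    unfolding test_function_def
    using product cont b(2) continuous_cutoff continuous_cutoff' by simp
qed

lemma evolution_compact:
  assumes a: "torus_C1 a a'" and b: "\<And>\<omega>. (b has_real_derivative b' \<omega>) (at \<omega>)" "continuous_on UNIV b'"
    and supp: "\<And>\<omega>. \<omega>\<^sup>2 \<ge> B \<Longrightarrow> b \<omega> = 0" and t: "t \<ge> 0"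
  shows "mean (\<lambda>\<theta> \<omega>. a \<theta> * b \<omega>) t - mean (\<lambda>\<theta> \<omega>. a \<theta> * b \<omega>) 0 =
    (LINT s:{0..t}|lborel. mean (drift a a' b b' s) s)"
proof -
  let ?\<phi> = "\<lambda>(\<theta>, \<omega>, s). a \<theta> * b \<omega> * cutoff (s - t)"
  let ?\<phi>\<theta> = "\<lambda>(\<theta>, \<omega>, s). a' \<theta> * b \<omega> * cutoff (s - t)"
  let ?\<phi>\<omega> = "\<lambda>(\<theta>, \<omega>, s). a \<theta> * b' \<omega> * cutoff (s - t)"
  let ?\<phi>t = "\<lambda>(\<theta>, \<omega>, s). a \<theta> * b \<omega> * cutoff' (s - t)"
  have sol: "measure_valued_solution m \<gamma> \<kappa> (f 0) (t + 2) f"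
    using solution t unfolding global_measure_valued_solution_def by simp
  have "(\<integral>(\<theta>, \<omega>). ?\<phi> (\<theta>, \<omega>, t) \<partial>f t) - (\<integral>(\<theta>, \<omega>). ?\<phi> (\<theta>, \<omega>, 0) \<partial>f 0) =
      (LINT s:{0..t}|lborel. (\<integral>(\<theta>, \<omega>). ?\<phi>t (\<theta>, \<omega>, s) + \<omega> * ?\<phi>\<theta> (\<theta>, \<omega>, s)
        + kuramoto_force m \<gamma> \<kappa> (f s) \<theta> \<omega> * ?\<phi>\<omega> (\<theta>, \<omega>, s) \<partial>f s))"
    by (rule sol[unfolded measure_valued_solution_def, THEN conjunct2, THEN conjunct2, THEN conjunct2,
          rule_format, OF test_function_product[OF a b supp t]]) (use t in auto)
  also have "\<dots> = (LINT s:{0..t}|lborel. mean (drift a a' b b' s) s)"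
  proof (rule set_lebesgue_integral_cong)
    show "\<forall>s. s \<in> {0..t} \<longrightarrow> (\<integral>(\<theta>, \<omega>). ?\<phi>t (\<theta>, \<omega>, s) + \<omega> * ?\<phi>\<theta> (\<theta>, \<omega>, s)
        + kuramoto_force m \<gamma> \<kappa> (f s) \<theta> \<omega> * ?\<phi>\<omega> (\<theta>, \<omega>, s) \<partial>f s) = mean (drift a a' b b' s) s"
      by (intro allI impI, unfold mean_def, rule Bochner_Integration.integral_cong)
        (auto simp: drift_def kuramoto_force_field cutoff_left)
  qed simp
  finally show ?thesis
    using t by (simp add: mean_def cutoff_left case_prod_beta')
qed

text \<open>The truncations \<open>b \<zeta>\<^sub>n\<close> are admissible, and their drifts are dominated by a fixed multiple of \<open>1 + \<omega>\<^sup>2\<close>.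
  Dominated convergence is applied twice: in phase space at each time, where the second moment is
  finite, and then in time, where it is essentially bounded. The limit is measurable in time as a limit
  of continuous functions.\<close>

lemma
  assumes a: "torus_C1 a a'" and b: "\<And>\<omega>. (b has_real_derivative b' \<omega>) (at \<omega>)" "continuous_on UNIV b'"
    and growth: "\<And>\<omega>. \<bar>b \<omega>\<bar> \<le> C * (1 + \<omega>\<^sup>2)" "\<And>\<omega>. \<bar>b' \<omega>\<bar> \<le> C * (1 + \<omega>\<^sup>2)"
      "\<And>\<omega>. \<bar>\<omega> * b' \<omega>\<bar> \<le> C * (1 + \<omega>\<^sup>2)" "\<And>\<theta> \<omega>. \<bar>a' \<theta> * (\<omega> * b \<omega>)\<bar> \<le> C * (1 + \<omega>\<^sup>2)"
    and t: "t \<ge> 0"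
  shows evolution_integrable: "set_integrable lborel {0..t} (\<lambda>s. mean (drift a a' b b' s) s)"
    and evolution_integral: "mean (\<lambda>\<theta> \<omega>. a \<theta> * b \<omega>) t - mean (\<lambda>\<theta> \<omega>. a \<theta> * b \<omega>) 0 =
      (LINT s:{0..t}|lborel. mean (drift a a' b b' s) s)"
proof -
  have cont: "continuous_on UNIV a" "continuous_on UNIV a'" "continuous_on UNIV b"
    using a torus_C1_continuous[OF a] DERIV_continuous_on[OF b(1)] by (auto simp: torus_C1_def)
  obtain A where A: "A \<ge> 0" "\<And>\<theta>. \<bar>a \<theta>\<bar> \<le> A"
    using torus_continuous_bounded[OF cont(1)] by blast
  have C: "C \<ge> 0"
    using order_trans[OF abs_ge_zero growth(1)[of 0]] by simp
  define L where "L = (\<gamma> + 2 * \<kappa>) / m"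
  have L: "L \<ge> 0" unfolding L_def using m \<gamma> \<kappa> by simp
  define D where "D = C + L * A * (42 * C)"
  define bn where "bn n \<omega> = b \<omega> * frequency_cutoff n \<omega>" for n \<omega>
  define bn' where "bn' n \<omega> = b' \<omega> * frequency_cutoff n \<omega> + frequency_cutoff' n \<omega> * b \<omega>" for n \<omega>
  have bn: "(bn n has_real_derivative bn' n \<omega>) (at \<omega>)" for n \<omega>
    unfolding bn_def[abs_def] bn'_def by (intro DERIV_mult b frequency_cutoff_deriv)
  have cont_bn: "continuous_on UNIV (bn n)" "continuous_on UNIV (bn' n)" for n
    unfolding bn_def[abs_def] bn'_def[abs_def]
    by (intro continuous_intros cont b continuous_frequency_cutoff continuous_frequency_cutoff')+
  have supp: "bn n \<omega> = 0 \<and> bn' n \<omega> = 0" if "\<omega>\<^sup>2 \<ge> 2 * (real n + 1)" for n \<omega>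
    using frequency_cutoff_vanishes[OF that] by (simp add: bn_def bn'_def)
  have cont_drift: "continuous_on UNIV (\<lambda>z. drift a a' q q' s (fst z) (snd z))"
    if "continuous_on UNIV q" "continuous_on UNIV q'" for q q' s
    unfolding drift_def using m
    by (intro continuous_intros continuous_on_compose2[OF cont(1)] continuous_on_compose2[OF cont(2)]
        continuous_on_compose2[OF that(1)] continuous_on_compose2[OF that(2)]
        continuous_on_compose2[OF continuous_field]) auto
  \<comment> \<open>The friction grows linearly in \<open>\<omega>\<close>, so \<open>(1 + \<bar>\<omega>\<bar>) b'\<close> is what has to be controlled.\<close>
  have drift_le: "\<bar>drift a a' q q' s \<theta> \<omega>\<bar> \<le> D * (1 + \<omega>\<^sup>2)"
    if "s \<ge> 0" "\<bar>a' \<theta> * (\<omega> * q \<omega>)\<bar> \<le> C * (1 + \<omega>\<^sup>2)" "(1 + \<bar>\<omega>\<bar>) * \<bar>q' \<omega>\<bar> \<le> 42 * C * (1 + \<omega>\<^sup>2)"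
    for q q' s \<theta> \<omega>
  proof -
    have "\<bar>\<kappa> * field s \<theta> - \<gamma> * \<omega>\<bar> \<le> \<kappa> * 2 + \<gamma> * \<bar>\<omega>\<bar>"
      using mult_left_mono[OF abs_field_le[OF that(1), of \<theta>], of \<kappa>] \<gamma> \<kappa>
      by (intro order_trans[OF abs_triangle_ineq4]) (simp add: abs_mult)
    also have "\<dots> \<le> (\<gamma> + 2 * \<kappa>) * (1 + \<bar>\<omega>\<bar>)"
      using \<gamma> \<kappa> by (simp add: algebra_simps)
    finally have force: "\<bar>(\<kappa> * field s \<theta> - \<gamma> * \<omega>) / m\<bar> \<le> L * (1 + \<bar>\<omega>\<bar>)"
      using m by (simp add: L_def divide_right_mono)
    have "\<bar>(\<kappa> * field s \<theta> - \<gamma> * \<omega>) / m * q' \<omega>\<bar> \<le> (L * (1 + \<bar>\<omega>\<bar>)) * \<bar>q' \<omega>\<bar>"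
      unfolding abs_mult[of _ "q' \<omega>"] by (intro mult_right_mono force) simp
    also have "\<dots> = L * ((1 + \<bar>\<omega>\<bar>) * \<bar>q' \<omega>\<bar>)"
      by (simp add: mult.assoc)
    also have "\<dots> \<le> L * (42 * C * (1 + \<omega>\<^sup>2))"
      by (intro mult_left_mono that L)
    finally have "\<bar>a \<theta>\<bar> * \<bar>(\<kappa> * field s \<theta> - \<gamma> * \<omega>) / m * q' \<omega>\<bar> \<le> A * (L * (42 * C * (1 + \<omega>\<^sup>2)))"
      using A by (intro mult_mono) simp_all
    then have "\<bar>drift a a' q q' s \<theta> \<omega>\<bar> \<le> C * (1 + \<omega>\<^sup>2) + A * (L * (42 * C * (1 + \<omega>\<^sup>2)))"
      unfolding drift_def abs_mult[of "a \<theta>", symmetric]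
      using that(2) by (intro order_trans[OF abs_triangle_ineq add_mono])
    also have "\<dots> = D * (1 + \<omega>\<^sup>2)"
      by (simp add: D_def algebra_simps)
    finally show ?thesis .
  qed
  have drift_b: "\<bar>drift a a' b b' s \<theta> \<omega>\<bar> \<le> D * (1 + \<omega>\<^sup>2)" if "s \<ge> 0" for s \<theta> \<omega>
  proof (rule drift_le[OF that growth(4)])
    have "(1 + \<bar>\<omega>\<bar>) * \<bar>b' \<omega>\<bar> = \<bar>b' \<omega>\<bar> + \<bar>\<omega> * b' \<omega>\<bar>"
      by (simp add: algebra_simps abs_mult)
    also have "\<dots> \<le> 2 * (C * (1 + \<omega>\<^sup>2))"
      using growth(2)[of \<omega>] growth(3)[of \<omega>] by linarith
    also have "\<dots> \<le> 42 * C * (1 + \<omega>\<^sup>2)"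
      using C by simp
    finally show "(1 + \<bar>\<omega>\<bar>) * \<bar>b' \<omega>\<bar> \<le> 42 * C * (1 + \<omega>\<^sup>2)" .
  qed
  have drift_bn: "\<bar>drift a a' (bn n) (bn' n) s \<theta> \<omega>\<bar> \<le> D * (1 + \<omega>\<^sup>2)" if "s \<ge> 0" for n s \<theta> \<omega>
  proof (rule drift_le[OF that])
    have le: "\<bar>x * frequency_cutoff n \<omega>\<bar> \<le> \<bar>x\<bar>" for x
      using mult_left_mono[OF frequency_cutoff_bounds(2), of "\<bar>x\<bar>" n \<omega>] frequency_cutoff_bounds(1)[of n \<omega>]
      by (simp add: abs_mult)
    show "\<bar>a' \<theta> * (\<omega> * bn n \<omega>)\<bar> \<le> C * (1 + \<omega>\<^sup>2)"
      using le[of "a' \<theta> * (\<omega> * b \<omega>)"] growth(4)[of \<theta> \<omega>] by (simp add: bn_def mult.assoc)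
    have "(1 + \<bar>\<omega>\<bar>) * \<bar>bn' n \<omega>\<bar> \<le> (1 + \<bar>\<omega>\<bar>) * (\<bar>b' \<omega>\<bar> + \<bar>frequency_cutoff' n \<omega>\<bar> * \<bar>b \<omega>\<bar>)"
      unfolding bn'_def using le[of "b' \<omega>"]
      by (intro mult_left_mono order_trans[OF abs_triangle_ineq] add_mono) (simp_all add: abs_mult)
    also have "\<dots> = \<bar>b' \<omega>\<bar> + \<bar>\<omega> * b' \<omega>\<bar> + ((1 + \<bar>\<omega>\<bar>) * \<bar>frequency_cutoff' n \<omega>\<bar>) * \<bar>b \<omega>\<bar>"
      by (simp add: algebra_simps abs_mult)
    also have "\<dots> \<le> C * (1 + \<omega>\<^sup>2) + C * (1 + \<omega>\<^sup>2) + 40 * (C * (1 + \<omega>\<^sup>2))"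
      by (intro add_mono growth mult_mono frequency_cutoff'_bound) auto
    finally show "(1 + \<bar>\<omega>\<bar>) * \<bar>bn' n \<omega>\<bar> \<le> 42 * C * (1 + \<omega>\<^sup>2)"
      by simp
  qed
  have growth_b: "quadratic_growth (drift a a' b b' s)" if "s \<ge> 0" for s
    using cont_drift[OF cont(3) b(2)] drift_b[OF that] by (rule quadratic_growthI)
  have growth_bn: "quadratic_growth (drift a a' (bn n) (bn' n) s)" if "s \<ge> 0" for n s
    using cont_drift[OF cont_bn] drift_bn[OF that] by (rule quadratic_growthI)
  have pointwise: "(\<lambda>n. drift a a' (bn n) (bn' n) s \<theta> \<omega>) \<longlonglongrightarrow> drift a a' b b' s \<theta> \<omega>"
    "(\<lambda>n. a \<theta> * bn n \<omega>) \<longlonglongrightarrow> a \<theta> * b \<omega>" for s \<theta> \<omega>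
    by (rule tendsto_eventually, use frequency_cutoff_eventually[of \<omega>] in eventually_elim,
        simp add: drift_def bn_def bn'_def)+
  have lim: "(\<lambda>n. mean (drift a a' (bn n) (bn' n) s) s) \<longlonglongrightarrow> mean (drift a a' b b' s) s" if "s \<ge> 0" for s
    using growth_b growth_bn drift_bn that pointwise(1)
    by (intro mean_dominated_convergence[where C = D]) auto
  have lim_mean: "(\<lambda>n. mean (\<lambda>\<theta> \<omega>. a \<theta> * bn n \<omega>) s) \<longlonglongrightarrow> mean (\<lambda>\<theta> \<omega>. a \<theta> * b \<omega>) s" if "s \<ge> 0" for s
  proof (rule mean_dominated_convergence[where C = "A * C"])
    show "quadratic_growth (\<lambda>\<theta> \<omega>. a \<theta> * b \<omega>)"
      by (rule quadratic_growth_product[OF cont(1,3) growth(1)])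
    have bn_le: "\<bar>bn n \<omega>\<bar> \<le> C * (1 + \<omega>\<^sup>2)" for n \<omega>
      using mult_mono[OF growth(1)[of \<omega>] frequency_cutoff_bounds(2)[of n \<omega>]]
        frequency_cutoff_bounds(1)[of n \<omega>] C by (simp add: bn_def abs_mult)
    then show "quadratic_growth (\<lambda>\<theta> \<omega>. a \<theta> * bn n \<omega>)" for n
      by (rule quadratic_growth_product[OF cont(1) cont_bn(1)])
    show "\<bar>a \<theta> * bn n \<omega>\<bar> \<le> A * C * (1 + \<omega>\<^sup>2)" for n \<theta> \<omega>
      using mult_mono[OF A(2)[of \<theta>] bn_le[of n \<omega>]] A(1) by (simp add: abs_mult mult.assoc)
  qed (use that pointwise in auto)
  obtain E where "AE s in lborel. 0 \<le> s \<longrightarrow> (\<integral>(\<theta>, \<omega>). \<omega>\<^sup>2 \<partial>f s) \<le> E"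
    using Linf unfolding Linf_P2_def by blast
  then have E: "AE s in lborel. 0 \<le> s \<longrightarrow> energy s \<le> E"
    by (simp add: energy_def mean_def case_prod_beta')
  let ?I = "\<lambda>s. indicator {0..t} s *\<^sub>R mean (drift a a' b b' s) s"
  let ?In = "\<lambda>n s. indicator {0..t} s *\<^sub>R mean (drift a a' (bn n) (bn' n) s) s"
  have meas_n: "?In n \<in> borel_measurable lborel" for n
  proof -
    have "continuous_on {0..t} (\<lambda>s. mean (drift a a' (bn n) (bn' n) s) s)"
      using continuous_mean_drift_compact[OF a cont_bn supp]
      by (rule continuous_on_subset) auto
    then show ?thesis
      by (subst measurable_lborel2) (rule borel_measurable_continuous_on_indicator, simp_all)
  qed
  have lim_I: "(\<lambda>n. ?In n s) \<longlonglongrightarrow> ?I s" for s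
    by (cases "s \<in> {0..t}") (auto intro: lim)
  have lim_AE: "AE s in lborel. (\<lambda>n. ?In n s) \<longlonglongrightarrow> ?I s"
    by (intro AE_I2 lim_I)
  have meas: "?I \<in> borel_measurable lborel"
    by (rule borel_measurable_LIMSEQ_metric[OF meas_n lim_I])
  have bound: "AE s in lborel. norm (?In n s) \<le> indicator {0..t} s * (D * (1 + E))" for n
    using E
  proof eventually_elim
    case (elim s)
    show ?case
    proof (cases "s \<in> {0..t}")
      case True
      then have s: "s \<ge> 0" by simp
      have "\<bar>mean (drift a a' (bn n) (bn' n) s) s\<bar> \<le> D * (1 + energy s)"
        by (rule abs_mean_le_energy[OF growth_bn[OF s] s drift_bn[OF s]])
      also have "\<dots> \<le> D * (1 + E)"
        using elim s C L A by (intro mult_left_mono) (auto simp: D_def)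
      finally show ?thesis using True by simp
    qed simp
  qed
  have int: "integrable lborel (\<lambda>s. indicator {0..t} s * (D * (1 + E)) :: real)"
    using t by (intro integrable_mult_left) simp_all
  show "set_integrable lborel {0..t} (\<lambda>s. mean (drift a a' b b' s) s)"
    unfolding set_integrable_def
    by (rule integrable_dominated_convergence[OF meas meas_n int lim_AE bound])
  have "(\<lambda>n. LINT s:{0..t}|lborel. mean (drift a a' (bn n) (bn' n) s) s) \<longlonglongrightarrow>
      (LINT s:{0..t}|lborel. mean (drift a a' b b' s) s)"
    unfolding set_lebesgue_integral_def
    by (rule integral_dominated_convergence[OF meas meas_n int lim_AE bound])
  moreover have "(LINT s:{0..t}|lborel. mean (drift a a' (bn n) (bn' n) s) s) =
      mean (\<lambda>\<theta> \<omega>. a \<theta> * bn n \<omega>) t - mean (\<lambda>\<theta> \<omega>. a \<theta> * bn n \<omega>) 0" for n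
    using evolution_compact[OF a bn cont_bn(2) _ t, of "2 * (real n + 1)" n] supp by simp
  ultimately have "(\<lambda>n. mean (\<lambda>\<theta> \<omega>. a \<theta> * bn n \<omega>) t - mean (\<lambda>\<theta> \<omega>. a \<theta> * bn n \<omega>) 0) \<longlonglongrightarrow>
      (LINT s:{0..t}|lborel. mean (drift a a' b b' s) s)"
    by simp
  moreover have "(\<lambda>n. mean (\<lambda>\<theta> \<omega>. a \<theta> * bn n \<omega>) t - mean (\<lambda>\<theta> \<omega>. a \<theta> * bn n \<omega>) 0) \<longlonglongrightarrow>
      mean (\<lambda>\<theta> \<omega>. a \<theta> * b \<omega>) t - mean (\<lambda>\<theta> \<omega>. a \<theta> * b \<omega>) 0"
    using t by (intro tendsto_diff lim_mean) auto
  ultimately show "mean (\<lambda>\<theta> \<omega>. a \<theta> * b \<omega>) t - mean (\<lambda>\<theta> \<omega>. a \<theta> * b \<omega>) 0 =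
      (LINT s:{0..t}|lborel. mean (drift a a' b b' s) s)"
    by (rule LIMSEQ_unique[symmetric])
qed

lemma continuous_of_set_integral:
  fixes h :: "real \<Rightarrow> real"
  assumes "\<And>t. t \<ge> 0 \<Longrightarrow> set_integrable lborel {0..t} h"
    and "\<And>t. t \<ge> 0 \<Longrightarrow> g t - g 0 = (LINT s:{0..t}|lborel. h s)"
  shows "continuous_on {0..} g"
  unfolding continuous_on_eq_continuous_within
proof
  fix t :: real assume "t \<in> {0..}"
  then have t: "t \<ge> 0" by simp
  have "h integrable_on {0..t + 1}"
    using set_borel_integral_eq_integral(1)[OF assms(1)] t by simp
  then have "continuous_on {0..t + 1} (\<lambda>s. g 0 + integral {0..s} h)"
    by (intro continuous_intros indefinite_integral_continuous_1)
  then have "continuous_on {0..t + 1} g"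
    by (rule continuous_on_eq) (use assms set_borel_integral_eq_integral(2)[OF assms(1)] in force)
  then have "continuous (at t within {0..t + 1}) g"
    using t by (simp add: continuous_on_eq_continuous_within)
  moreover have "at t within {0..t + 1} = at t within {0..}"
    by (rule at_within_nhd[of _ "{..<t + 1}"]) auto
  ultimately show "continuous (at t within {0..}) g"
    by simp
qed

text \<open>The second moment is an absolutely continuous function of time by its own evolution equation, the
  weak continuity of the solution being too weak for an unbounded observable.\<close>

lemma continuous_energy: "continuous_on {0..} energy"
proof -
  have deriv: "((\<lambda>\<omega>. \<omega>\<^sup>2) has_real_derivative 2 * \<omega>) (at \<omega>)" for \<omega> :: real
    by (auto intro!: derivative_eq_intros)
  have *: "\<bar>2 * \<omega>\<bar> \<le> 2 * (1 + \<omega>\<^sup>2)" "\<bar>\<omega> * (2 * \<omega>)\<bar> \<le> 2 * (1 + \<omega>\<^sup>2)" for \<omega> :: real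
    using abs_le_quadratic[of \<omega>] by (auto simp: abs_mult power2_eq_square)
  have cont: "continuous_on UNIV (\<lambda>\<omega>::real. 2 * \<omega>)"
    by (intro continuous_intros)
  have square: "\<bar>\<omega>\<^sup>2\<bar> \<le> 2 * (1 + \<omega>\<^sup>2)" "\<bar>0 * (\<omega> * \<omega>\<^sup>2)\<bar> \<le> 2 * (1 + \<omega>\<^sup>2)" for \<omega> :: real
    by auto
  have int: "set_integrable lborel {0..t}
      (\<lambda>s. mean (drift (\<lambda>\<theta>. 1) (\<lambda>\<theta>. 0) (\<lambda>\<omega>. \<omega>\<^sup>2) (\<lambda>\<omega>. 2 * \<omega>) s) s)" if "t \<ge> 0" for t
    by (rule evolution_integrable[OF torus_C1_const[of 1] deriv cont square(1) * square(2) that])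
  have "mean (\<lambda>\<theta> \<omega>. 1 * \<omega>\<^sup>2) t - mean (\<lambda>\<theta> \<omega>. 1 * \<omega>\<^sup>2) 0 = (LINT s:{0..t}|lborel.
      mean (drift (\<lambda>\<theta>. 1) (\<lambda>\<theta>. 0) (\<lambda>\<omega>. \<omega>\<^sup>2) (\<lambda>\<omega>. 2 * \<omega>) s) s)" if "t \<ge> 0" for t
    by (rule evolution_integral[OF torus_C1_const[of 1] deriv cont square(1) * square(2) that])
  from continuous_of_set_integral[OF int this] show ?thesis
    unfolding energy_def by simp
qed

text \<open>Weak continuity only concerns bounded observables. As the second moment is continuous in time,
  no mass escapes to infinite frequency at quadratic order, and the truncations converge locally
  uniformly in time.\<close>

lemma continuous_mean:
  assumes h: "quadratic_growth h"
  shows "continuous_on {0..} (mean h)"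
proof -
  obtain C where C: "\<And>\<theta> \<omega>. \<bar>h \<theta> \<omega>\<bar> \<le> C * (1 + \<omega>\<^sup>2)"
    using h unfolding quadratic_growth_def by blast
  have "C \<ge> 0" using order_trans[OF abs_ge_zero C[of undefined 0]] by simp
  have growth_1: "quadratic_growth (\<lambda>\<theta> \<omega>. 1 + \<omega>\<^sup>2)"
    by (intro quadratic_growth_add quadratic_growth_energy quadratic_growth_angle continuous_intros)
  define trunc where "trunc g n \<theta> \<omega> = frequency_cutoff n \<omega> * g \<theta> \<omega>" for g :: "torus \<Rightarrow> real \<Rightarrow> real" and n \<theta> \<omega>
  have trunc: "quadratic_growth (trunc g n)" "continuous_on {0..} (mean (trunc g n))"
    if g: "quadratic_growth g" for g n
  proof -
    obtain D where D: "\<And>\<theta> \<omega>. \<bar>g \<theta> \<omega>\<bar> \<le> D * (1 + \<omega>\<^sup>2)"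
      using g unfolding quadratic_growth_def by blast
    have D0: "D \<ge> 0" using order_trans[OF abs_ge_zero D[of undefined 0]] by simp
    have cont: "continuous_on UNIV (\<lambda>z. trunc g n (fst z) (snd z))"
      unfolding trunc_def
      by (intro continuous_intros quadratic_growth_continuous[OF g]
          continuous_on_compose2[OF continuous_frequency_cutoff]) auto
    have le: "\<bar>trunc g n \<theta> \<omega>\<bar> \<le> D * (1 + \<omega>\<^sup>2)" for \<theta> \<omega>
      using mult_mono[OF frequency_cutoff_bounds(2)[of n \<omega>] D[of \<theta> \<omega>]] frequency_cutoff_bounds(1)[of n \<omega>]
      by (simp add: trunc_def abs_mult)
    show "quadratic_growth (trunc g n)"
      by (rule quadratic_growthI[OF cont le])
    have "\<bar>trunc g n \<theta> \<omega>\<bar> \<le> D * (1 + 2 * (real n + 1))" for \<theta> \<omega>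
    proof (cases "\<omega>\<^sup>2 \<ge> 2 * (real n + 1)")
      case True
      then show ?thesis using D0 by (simp add: trunc_def frequency_cutoff_vanishes)
    next
      case False
      then show ?thesis
        by (intro order_trans[OF le] mult_left_mono D0) auto
    qed
    then show "continuous_on {0..} (mean (trunc g n))"
      by (intro weakly_continuous cont boundedI) auto
  qed
  define tail where "tail n t = 1 + energy t - mean (trunc (\<lambda>\<theta> \<omega>. 1 + \<omega>\<^sup>2) n) t" for n t
  have tail_cont: "continuous_on {0..} (tail n)" for n
    unfolding tail_def[abs_def] by (intro continuous_intros continuous_energy trunc growth_1)
  have one_energy: "mean (\<lambda>\<theta> \<omega>. 1 + \<omega>\<^sup>2) t = 1 + energy t" if "t \<ge> 0" for t
    using that unfolding energy_def
    by (subst mean_add) (auto simp: mean_const quadratic_growth_energy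
        intro: quadratic_growth_angle continuous_intros)
  have trunc_lim: "(\<lambda>n. tail n t) \<longlonglongrightarrow> 0" if t: "t \<ge> 0" for t
  proof -
    have "(\<lambda>n. mean (trunc (\<lambda>\<theta> \<omega>. 1 + \<omega>\<^sup>2) n) t) \<longlonglongrightarrow> mean (\<lambda>\<theta> \<omega>. 1 + \<omega>\<^sup>2) t"
    proof (rule mean_dominated_convergence[where C = 1])
      show "\<bar>trunc (\<lambda>\<theta> \<omega>. 1 + \<omega>\<^sup>2) n \<theta> \<omega>\<bar> \<le> 1 * (1 + \<omega>\<^sup>2)" for n \<theta> \<omega>
        unfolding trunc_def abs_mult using frequency_cutoff_bounds[of n \<omega>]
        by (intro mult_mono) auto
      show "(\<lambda>n. trunc (\<lambda>\<theta> \<omega>. 1 + \<omega>\<^sup>2) n \<theta> \<omega>) \<longlonglongrightarrow> 1 + \<omega>\<^sup>2" for \<theta> \<omega>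
        by (rule tendsto_eventually, use frequency_cutoff_eventually[of \<omega>] in eventually_elim)
          (simp add: trunc_def)
    qed (use t growth_1 trunc in auto)
    from tendsto_diff[OF tendsto_const[of "1 + energy t"] this] show ?thesis
      using t by (simp add: tail_def one_energy)
  qed
  have close: "\<bar>mean h t - mean (trunc h n) t\<bar> \<le> C * tail n t" if t: "t \<ge> 0" for n t
  proof -
    have g: "quadratic_growth (\<lambda>\<theta> \<omega>. h \<theta> \<omega> + (- 1) * trunc h n \<theta> \<omega>)"
      by (intro quadratic_growth_add quadratic_growth_cmult trunc h)
    have g': "quadratic_growth (\<lambda>\<theta> \<omega>. 1 + \<omega>\<^sup>2 + (- 1) * trunc (\<lambda>\<theta> \<omega>. 1 + \<omega>\<^sup>2) n \<theta> \<omega>)"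
      by (intro quadratic_growth_add[OF growth_1] quadratic_growth_cmult trunc growth_1)
    have "\<bar>mean (\<lambda>\<theta> \<omega>. h \<theta> \<omega> + (- 1) * trunc h n \<theta> \<omega>) t\<bar> \<le>
        mean (\<lambda>\<theta> \<omega>. C * (1 + \<omega>\<^sup>2 + (- 1) * trunc (\<lambda>\<theta> \<omega>. 1 + \<omega>\<^sup>2) n \<theta> \<omega>)) t"
    proof (rule abs_mean_le[OF g quadratic_growth_cmult[OF g'] t])
      fix \<theta> \<omega>
      have "\<bar>h \<theta> \<omega> + (- 1) * trunc h n \<theta> \<omega>\<bar> = (1 - frequency_cutoff n \<omega>) * \<bar>h \<theta> \<omega>\<bar>"
        using frequency_cutoff_bounds[of n \<omega>] abs_mult[of "1 - frequency_cutoff n \<omega>" "h \<theta> \<omega>"]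
        by (simp add: trunc_def algebra_simps)
      also have "\<dots> \<le> (1 - frequency_cutoff n \<omega>) * (C * (1 + \<omega>\<^sup>2))"
        using frequency_cutoff_bounds[of n \<omega>] by (intro mult_left_mono C) simp
      finally show "\<bar>h \<theta> \<omega> + (- 1) * trunc h n \<theta> \<omega>\<bar> \<le>
          C * (1 + \<omega>\<^sup>2 + (- 1) * trunc (\<lambda>\<theta> \<omega>. 1 + \<omega>\<^sup>2) n \<theta> \<omega>)"
        by (simp add: trunc_def algebra_simps)
    qed
    then show ?thesis
      using t h trunc growth_1
      by (simp only: mean_cmult mean_add quadratic_growth_cmult one_energy tail_def) simp
  qed
  show ?thesis
    unfolding continuous_on
  proof (intro ballI tendstoI)
    fix t \<epsilon> :: real
    assume "t \<in> {0..}" and \<epsilon>: "\<epsilon> > 0"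
    then have t: "t \<ge> 0" by simp
    have "(\<lambda>n. C * tail n t) \<longlonglongrightarrow> C * 0"
      by (intro tendsto_mult_left trunc_lim t)
    then have "\<forall>\<^sub>F n in sequentially. C * tail n t < \<epsilon> / 3"
      using \<epsilon> by (intro order_tendstoD(2)[of _ 0]) auto
    then obtain n where n: "C * tail n t < \<epsilon> / 3"
      by (auto simp: eventually_sequentially)
    have "((\<lambda>s. C * tail n s) \<longlongrightarrow> C * tail n t) (at t within {0..})"
      "(mean (trunc h n) \<longlongrightarrow> mean (trunc h n) t) (at t within {0..})"
      using tail_cont trunc(2)[OF h] t by (auto simp: continuous_on intro!: tendsto_mult_left)
    then have "\<forall>\<^sub>F s in at t within {0..}. C * tail n s < \<epsilon> / 3"
      "\<forall>\<^sub>F s in at t within {0..}. dist (mean (trunc h n) s) (mean (trunc h n) t) < \<epsilon> / 3"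
      using n \<epsilon> order_tendstoD(2)[of _ _ _ "\<epsilon> / 3"] tendstoD[of _ _ _ "\<epsilon> / 3"] by simp_all
    moreover have "\<forall>\<^sub>F s in at t within {0..}. s \<ge> 0"
      by (auto simp: eventually_at_filter)
    ultimately show "\<forall>\<^sub>F s in at t within {0..}. dist (mean h s) (mean h t) < \<epsilon>"
    proof eventually_elim
      case (elim s)
      then show ?case
        using close[OF t, of n] close[of s n] n unfolding dist_real_def by linarith
    qed
  qed
qed

text \<open>Once all averages of quadratic growth are continuous in time, the integral form of the evolution
  equation can be differentiated.\<close>

lemma evolution_deriv:
  assumes a: "torus_C1 a a'" and b: "\<And>\<omega>. (b has_real_derivative b' \<omega>) (at \<omega>)" "continuous_on UNIV b'"
    and growth: "\<And>\<omega>. \<bar>b \<omega>\<bar> \<le> C * (1 + \<omega>\<^sup>2)" "\<And>\<omega>. \<bar>b' \<omega>\<bar> \<le> C * (1 + \<omega>\<^sup>2)"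
      "\<And>\<omega>. \<bar>\<omega> * b' \<omega>\<bar> \<le> C * (1 + \<omega>\<^sup>2)" "\<And>\<theta> \<omega>. \<bar>a' \<theta> * (\<omega> * b \<omega>)\<bar> \<le> C * (1 + \<omega>\<^sup>2)"
    and t: "t \<ge> 0"
  shows "(mean (\<lambda>\<theta> \<omega>. a \<theta> * b \<omega>) has_real_derivative
      mean (\<lambda>\<theta> \<omega>. a' \<theta> * (\<omega> * b \<omega>)) t +
      (\<kappa> / m * mean_sin t * mean (\<lambda>\<theta> \<omega>. (torus_cos \<theta> * a \<theta>) * b' \<omega>) t +
      ((- \<kappa> / m) * mean_cos t * mean (\<lambda>\<theta> \<omega>. (torus_sin \<theta> * a \<theta>) * b' \<omega>) t +
      (- \<gamma> / m) * mean (\<lambda>\<theta> \<omega>. a \<theta> * (\<omega> * b' \<omega>)) t))) (at t within {0..})"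
    (is "(_ has_real_derivative ?d) _")
proof -
  have cont: "continuous_on UNIV a" "continuous_on UNIV a'" "continuous_on UNIV b"
    using a torus_C1_continuous[OF a] DERIV_continuous_on[OF b(1)] by (auto simp: torus_C1_def)
  have cont': "continuous_on UNIV (\<lambda>\<theta>. torus_cos \<theta> * a \<theta>)" "continuous_on UNIV (\<lambda>\<theta>. torus_sin \<theta> * a \<theta>)"
    "continuous_on UNIV (\<lambda>\<omega>. \<omega> * b' \<omega>)" "continuous_on UNIV (\<lambda>\<omega>. \<omega> * b \<omega>)"
    by (intro continuous_intros continuous_torus_cos continuous_torus_sin cont b)+
  have g: "quadratic_growth (\<lambda>\<theta> \<omega>. a' \<theta> * (\<omega> * b \<omega>))"
  proof (rule quadratic_growthI[OF _ growth(4)])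
    show "continuous_on UNIV (\<lambda>z. a' (fst z) * (snd z * b (snd z)))"
      by (intro continuous_intros continuous_on_compose2[OF cont(2)] continuous_on_compose2[OF cont(3)])
        auto
  qed
  note g' = quadratic_growth_product[OF cont'(1) b(2) growth(2)]
    quadratic_growth_product[OF cont'(2) b(2) growth(2)]
    quadratic_growth_product[OF cont(1) cont'(3) growth(3)]
  let ?h = "\<lambda>s. mean (drift a a' b b' s) s"
  have h: "continuous_on {0..} ?h"
    by (rule continuous_mean_drift[OF g g']) (rule continuous_mean)
  have "((\<lambda>s. integral {0..s} ?h) has_real_derivative ?h t) (at t within {0..t + 1})"
    using t by (intro integral_has_real_derivative continuous_on_subset[OF h]) auto
  then have "((\<lambda>s. mean (\<lambda>\<theta> \<omega>. a \<theta> * b \<omega>) 0 + integral {0..s} ?h) has_real_derivative ?h t)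
      (at t within {0..t + 1})"
    using DERIV_add[OF DERIV_const] by fastforce
  then have "(mean (\<lambda>\<theta> \<omega>. a \<theta> * b \<omega>) has_real_derivative ?h t) (at t within {0..t + 1})"
  proof (rule has_field_derivative_transform_within[of _ _ _ _ 1])
    fix s assume "s \<in> {0..t + 1}"
    then show "mean (\<lambda>\<theta> \<omega>. a \<theta> * b \<omega>) 0 + integral {0..s} ?h = mean (\<lambda>\<theta> \<omega>. a \<theta> * b \<omega>) s"
      using evolution_integral[OF a b growth, of s]
        set_borel_integral_eq_integral(2)[OF evolution_integrable[OF a b growth, of s]] by simp
  qed (use t in auto)
  moreover have "at t within {0..t + 1} = at t within {0..}"
    by (rule at_within_nhd[of _ "{..<t + 1}"]) auto
  ultimately show ?thesis
    using mean_drift[OF g g' t] by simp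
qed

lemma angle_moment_deriv:
  assumes a: "torus_C1 a a'" and t: "t \<ge> 0"
  shows "(mean (\<lambda>\<theta> \<omega>. a \<theta>) has_real_derivative mean (\<lambda>\<theta> \<omega>. a' \<theta> * \<omega>) t) (at t within {0..})"
proof -
  obtain A where A: "A \<ge> 0" "\<And>\<theta>. \<bar>a' \<theta>\<bar> \<le> A"
    using torus_continuous_bounded a unfolding torus_C1_def by blast
  have *: "\<bar>a' \<theta> * (\<omega> * 1)\<bar> \<le> (1 + A) * (1 + \<omega>\<^sup>2)" for \<theta> \<omega>
  proof -
    have "\<bar>a' \<theta> * (\<omega> * 1)\<bar> = \<bar>a' \<theta>\<bar> * \<bar>\<omega>\<bar>"
      by (simp add: abs_mult)
    also have "\<dots> \<le> (1 + A) * (1 + \<omega>\<^sup>2)"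
      using A(1) A(2)[of \<theta>] abs_le_quadratic[of \<omega>] by (intro mult_mono) auto
    finally show ?thesis .
  qed
  have **: "1 \<le> (1 + A) * (1 + \<omega>\<^sup>2)" for \<omega>
    using mult_mono[of 1 "1 + A" 1 "1 + \<omega>\<^sup>2"] A(1) by simp
  have "(mean (\<lambda>\<theta> \<omega>. a \<theta> * 1) has_real_derivative mean (\<lambda>\<theta> \<omega>. a' \<theta> * (\<omega> * 1)) t +
      (\<kappa> / m * mean_sin t * mean (\<lambda>\<theta> \<omega>. (torus_cos \<theta> * a \<theta>) * 0) t +
      ((- \<kappa> / m) * mean_cos t * mean (\<lambda>\<theta> \<omega>. (torus_sin \<theta> * a \<theta>) * 0) t +
      (- \<gamma> / m) * mean (\<lambda>\<theta> \<omega>. a \<theta> * (\<omega> * 0)) t))) (at t within {0..})"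
    by (rule evolution_deriv[OF a _ _ _ _ _ * t])
      (use ** A(1) in \<open>auto intro!: mult_nonneg_nonneg\<close>)
  then show ?thesis
    using t by (simp add: mean_const)
qed

lemma first_moment_deriv:
  assumes a: "torus_C1 a a'" and t: "t \<ge> 0"
  shows "(mean (\<lambda>\<theta> \<omega>. a \<theta> * \<omega>) has_real_derivative mean (\<lambda>\<theta> \<omega>. a' \<theta> * \<omega>\<^sup>2) t +
      \<kappa> / m * (mean_sin t * mean (\<lambda>\<theta> \<omega>. torus_cos \<theta> * a \<theta>) t
        - mean_cos t * mean (\<lambda>\<theta> \<omega>. torus_sin \<theta> * a \<theta>) t)
      - \<gamma> / m * mean (\<lambda>\<theta> \<omega>. a \<theta> * \<omega>) t) (at t within {0..})"
proof -
  obtain A where A: "A \<ge> 0" "\<And>\<theta>. \<bar>a' \<theta>\<bar> \<le> A"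
    using torus_continuous_bounded a unfolding torus_C1_def by blast
  have *: "\<bar>a' \<theta> * (\<omega> * \<omega>)\<bar> \<le> (1 + A) * (1 + \<omega>\<^sup>2)" for \<theta> \<omega>
  proof -
    have "\<bar>a' \<theta> * (\<omega> * \<omega>)\<bar> = \<bar>a' \<theta>\<bar> * \<omega>\<^sup>2"
      by (simp add: abs_mult power2_eq_square)
    also have "\<dots> \<le> (1 + A) * (1 + \<omega>\<^sup>2)"
      using A(1) A(2)[of \<theta>] by (intro mult_mono) auto
    finally show ?thesis .
  qed
  have **: "1 + \<omega>\<^sup>2 \<le> (1 + A) * (1 + \<omega>\<^sup>2)" for \<omega>
    using A(1) by (simp add: algebra_simps)
  have "(mean (\<lambda>\<theta> \<omega>. a \<theta> * \<omega>) has_real_derivative mean (\<lambda>\<theta> \<omega>. a' \<theta> * (\<omega> * \<omega>)) t +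
      (\<kappa> / m * mean_sin t * mean (\<lambda>\<theta> \<omega>. (torus_cos \<theta> * a \<theta>) * 1) t +
      ((- \<kappa> / m) * mean_cos t * mean (\<lambda>\<theta> \<omega>. (torus_sin \<theta> * a \<theta>) * 1) t +
      (- \<gamma> / m) * mean (\<lambda>\<theta> \<omega>. a \<theta> * (\<omega> * 1)) t))) (at t within {0..})"
    by (rule evolution_deriv[OF a _ _ _ _ _ * t])
      (use order_trans[OF abs_le_quadratic **] order_trans[OF one_le_quadratic **] in auto)
  then show ?thesis
    by (simp add: power2_eq_square algebra_simps)
qed

definition first_cos :: "real \<Rightarrow> real" where "first_cos = mean (\<lambda>\<theta> \<omega>. torus_cos \<theta> * \<omega>)"
definition first_sin :: "real \<Rightarrow> real" where "first_sin = mean (\<lambda>\<theta> \<omega>. torus_sin \<theta> * \<omega>)"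

lemma energy_deriv:
  assumes t: "t \<ge> 0"
  shows "(energy has_real_derivative
      2 * \<kappa> / m * (mean_sin t * first_cos t - mean_cos t * first_sin t) - 2 * \<gamma> / m * energy t)
    (at t within {0..})"
proof -
  have deriv: "((\<lambda>\<omega>. \<omega>\<^sup>2) has_real_derivative 2 * \<omega>) (at \<omega>)" for \<omega> :: real
    by (auto intro!: derivative_eq_intros)
  have *: "\<bar>2 * \<omega>\<bar> \<le> 2 * (1 + \<omega>\<^sup>2)" "\<bar>\<omega> * (2 * \<omega>)\<bar> \<le> 2 * (1 + \<omega>\<^sup>2)" for \<omega> :: real
    using abs_le_quadratic[of \<omega>] by (auto simp: abs_mult power2_eq_square)
  have cont: "continuous_on UNIV (\<lambda>\<omega>::real. 2 * \<omega>)"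
    by (intro continuous_intros)
  have square: "\<bar>\<omega>\<^sup>2\<bar> \<le> 2 * (1 + \<omega>\<^sup>2)" "\<bar>0 * (\<omega> * \<omega>\<^sup>2)\<bar> \<le> 2 * (1 + \<omega>\<^sup>2)" for \<omega> :: real
    by auto
  have "(mean (\<lambda>\<theta> \<omega>. 1 * \<omega>\<^sup>2) has_real_derivative mean (\<lambda>\<theta> \<omega>. 0 * (\<omega> * \<omega>\<^sup>2)) t +
      (\<kappa> / m * mean_sin t * mean (\<lambda>\<theta> \<omega>. (torus_cos \<theta> * 1) * (2 * \<omega>)) t +
      ((- \<kappa> / m) * mean_cos t * mean (\<lambda>\<theta> \<omega>. (torus_sin \<theta> * 1) * (2 * \<omega>)) t +
      (- \<gamma> / m) * mean (\<lambda>\<theta> \<omega>. 1 * (\<omega> * (2 * \<omega>))) t))) (at t within {0..})"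
    by (rule evolution_deriv[OF torus_C1_const deriv cont square(1) * square(2) t])
  moreover have "mean (\<lambda>\<theta> \<omega>. torus_cos \<theta> * (2 * \<omega>)) t = 2 * first_cos t"
    "mean (\<lambda>\<theta> \<omega>. torus_sin \<theta> * (2 * \<omega>)) t = 2 * first_sin t"
    "mean (\<lambda>\<theta> \<omega>. \<omega> * (2 * \<omega>)) t = 2 * energy t"
    unfolding first_cos_def first_sin_def energy_def mean_cmult[symmetric]
    by (simp_all add: mult_ac power2_eq_square)
  ultimately show ?thesis
    using t by (simp add: mean_const energy_def algebra_simps)
qed

section \<open>The energy method\<close>

definition order_square :: "real \<Rightarrow> real" where
  "order_square t = (mean_cos t)\<^sup>2 + (mean_sin t)\<^sup>2"

definition momentum :: "real \<Rightarrow> real" where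
  "momentum = mean (\<lambda>\<theta> \<omega>. \<omega>)"

definition mean_cos_cos :: "real \<Rightarrow> real" where
  "mean_cos_cos = mean (\<lambda>\<theta> \<omega>. torus_cos \<theta> * torus_cos \<theta>)"

definition mean_sin_cos :: "real \<Rightarrow> real" where
  "mean_sin_cos = mean (\<lambda>\<theta> \<omega>. torus_sin \<theta> * torus_cos \<theta>)"

definition mean_sin_sin :: "real \<Rightarrow> real" where
  "mean_sin_sin = mean (\<lambda>\<theta> \<omega>. torus_sin \<theta> * torus_sin \<theta>)"

text \<open>The power that the mean field exchanges with the oscillators.\<close>

definition field_power :: "real \<Rightarrow> real" where
  "field_power t = mean_sin t * first_cos t - mean_cos t * first_sin t"

text \<open>When the order parameter is positive, this vanishes exactly if almost every phase agrees with the
  average phase or is opposite to it.\<close>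

definition misalignment :: "real \<Rightarrow> real" where
  "misalignment t = mean (\<lambda>\<theta> \<omega>. (field t \<theta>)\<^sup>2) t"

lemmas torus_continuous = continuous_torus_cos continuous_torus_sin continuous_field

lemma mean_cos_deriv:
  assumes "t \<ge> 0"
  shows "(mean_cos has_real_derivative - first_sin t) (at t within {0..})"
  using angle_moment_deriv[OF torus_C1_cos assms] mean_cmult[of "- 1" "\<lambda>\<theta> \<omega>. torus_sin \<theta> * \<omega>" t]
  by (simp add: mean_cos_def first_sin_def)

lemma mean_sin_deriv:
  assumes "t \<ge> 0"
  shows "(mean_sin has_real_derivative first_cos t) (at t within {0..})"
  using angle_moment_deriv[OF torus_C1_sin assms] by (simp add: mean_sin_def first_cos_def)

lemma order_square_deriv:
  assumes "t \<ge> 0"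
  shows "(order_square has_real_derivative 2 * field_power t) (at t within {0..})"
  unfolding order_square_def[abs_def] field_power_def
  by (rule derivative_eq_intros mean_cos_deriv[OF assms] mean_sin_deriv[OF assms] refl)+
    (simp add: algebra_simps)

text \<open>The mean field averages to zero because the interaction is antisymmetric, so only friction acts on
  the momentum.\<close>

lemma momentum_deriv:
  assumes "t \<ge> 0"
  shows "(momentum has_real_derivative - \<gamma> / m * momentum t) (at t within {0..})"
  using first_moment_deriv[OF torus_C1_const[of 1] assms] assms
  by (simp add: momentum_def mean_const mean_cos_def[symmetric] mean_sin_def[symmetric])

lemma jensen:
  assumes "quadratic_growth h" "quadratic_growth (\<lambda>\<theta> \<omega>. (h \<theta> \<omega>)\<^sup>2)" "t \<ge> 0"
  shows "(mean h t)\<^sup>2 \<le> mean (\<lambda>\<theta> \<omega>. (h \<theta> \<omega>)\<^sup>2) t"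
proof -
  interpret prob_space "f t" by (rule prob[OF assms(3)])
  have "0 \<le> variance (\<lambda>z. h (fst z) (snd z))"
    by (rule variance_positive)
  then show ?thesis
    using variance_eq[OF assms(1,2)[THEN integrable_growth[OF _ assms(3)]]]
    by (simp add: mean_def)
qed

text \<open>The squares of the mean field and of \<open>R cos (\<phi> - \<theta>)\<close> add up to \<open>R\<^sup>2\<close>.\<close>

lemma field_square_le: "(field t \<theta>)\<^sup>2 \<le> order_square t"
proof -
  have "(field t \<theta>)\<^sup>2 + (mean_cos t * torus_cos \<theta> + mean_sin t * torus_sin \<theta>)\<^sup>2 =
      order_square t * ((torus_sin \<theta>)\<^sup>2 + (torus_cos \<theta>)\<^sup>2)"
    by (simp add: field_def order_square_def power2_eq_square algebra_simps)
  also have "\<dots> = order_square t"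
    by (simp add: torus_sin_cos_squared)
  finally show ?thesis
    using zero_le_power2[of "mean_cos t * torus_cos \<theta> + mean_sin t * torus_sin \<theta>"] by linarith
qed

lemma field_power_eq_mean:
  assumes "t \<ge> 0"
  shows "field_power t = mean (\<lambda>\<theta> \<omega>. field t \<theta> * \<omega>) t"
proof -
  have "mean (\<lambda>\<theta> \<omega>. field t \<theta> * \<omega>) t =
      mean (\<lambda>\<theta> \<omega>. mean_sin t * (torus_cos \<theta> * \<omega>) + (- mean_cos t) * (torus_sin \<theta> * \<omega>)) t"
    by (simp add: field_def algebra_simps)
  also have "\<dots> = mean_sin t * first_cos t + (- mean_cos t) * first_sin t"
    using assms unfolding first_cos_def first_sin_def
    by (subst mean_add) (simp_all only: mean_cmult quadratic_growth_cmult quadratic_growth_first torus_continuous)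
  finally show ?thesis
    by (simp add: field_power_def)
qed

lemma misalignment_eq:
  assumes "t \<ge> 0"
  shows "misalignment t = (mean_sin t)\<^sup>2 * mean_cos_cos t
    + (- 2 * mean_sin t * mean_cos t * mean_sin_cos t + (mean_cos t)\<^sup>2 * mean_sin_sin t)"
proof -
  have "misalignment t = mean (\<lambda>\<theta> \<omega>. (mean_sin t)\<^sup>2 * (torus_cos \<theta> * torus_cos \<theta>)
    + (- 2 * mean_sin t * mean_cos t * (torus_sin \<theta> * torus_cos \<theta>)
      + (mean_cos t)\<^sup>2 * (torus_sin \<theta> * torus_sin \<theta>))) t"
    by (simp add: misalignment_def field_def power2_eq_square algebra_simps)
  then show ?thesis
    using assms unfolding mean_cos_cos_def mean_sin_cos_def mean_sin_sin_def
    by (simp only: mean_cmult mean_add quadratic_growth_add quadratic_growth_cmult quadratic_growth_angle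
        torus_continuous continuous_on_mult)
qed

lemma misalignment_nonneg: "misalignment t \<ge> 0"
  by (simp add: misalignment_def mean_def)

text \<open>The contribution \<open>\<langle>\<omega> cos \<theta>\<rangle>\<^sup>2 + \<langle>\<omega> sin \<theta>\<rangle>\<^sup>2\<close> of the moving order parameter is nonnegative and is dropped;
  the centrifugal terms \<open>\<langle>\<omega>\<^sup>2 cos \<theta>\<rangle>\<close> and \<open>\<langle>\<omega>\<^sup>2 sin \<theta>\<rangle>\<close> are bounded by the kinetic energy.\<close>

lemma field_power_deriv:
  assumes t: "t \<ge> 0"
  shows "\<exists>d. (field_power has_real_derivative d) (at t within {0..}) \<and>
    \<kappa> / m * misalignment t \<le> d + \<gamma> / m * field_power t + 2 * energy t"
proof -
  define sc where "sc = mean (\<lambda>\<theta> \<omega>. torus_cos \<theta> * \<omega>\<^sup>2) t"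
  define ss where "ss = mean (\<lambda>\<theta> \<omega>. torus_sin \<theta> * \<omega>\<^sup>2) t"
  have second: "\<bar>mean (\<lambda>\<theta> \<omega>. a \<theta> * \<omega>\<^sup>2) t\<bar> \<le> energy t"
    if "continuous_on UNIV a" "\<And>\<theta>. \<bar>a \<theta>\<bar> \<le> 1" for a
    unfolding energy_def using t that mult_right_mono[OF that(2)]
    by (intro abs_mean_le quadratic_growth_second quadratic_growth_energy) (auto simp: abs_mult)
  have "\<bar>sc\<bar> \<le> energy t" "\<bar>ss\<bar> \<le> energy t"
    unfolding sc_def ss_def
    by (intro second torus_continuous; simp add: abs_torus_cos_le abs_torus_sin_le)+
  then have "\<bar>mean_cos t\<bar> * \<bar>sc\<bar> \<le> 1 * energy t" "\<bar>mean_sin t\<bar> * \<bar>ss\<bar> \<le> 1 * energy t"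
    using t by (intro mult_mono abs_mean_cos_le abs_mean_sin_le; simp)+
  then have err: "mean_sin t * ss + mean_cos t * sc \<le> 2 * energy t"
    using abs_ge_self[of "mean_cos t * sc"] abs_ge_self[of "mean_sin t * ss"] by (simp add: abs_mult)
  define dc where "dc = - ss + \<kappa> / m * (mean_sin t * mean_cos_cos t - mean_cos t * mean_sin_cos t)
    - \<gamma> / m * first_cos t"
  define ds where "ds = sc + \<kappa> / m * (mean_sin t * mean_sin_cos t - mean_cos t * mean_sin_sin t)
    - \<gamma> / m * first_sin t"
  have "(first_cos has_real_derivative dc) (at t within {0..})"
    using first_moment_deriv[OF torus_C1_cos t] mean_cmult[of "- 1" "\<lambda>\<theta> \<omega>. torus_sin \<theta> * \<omega>\<^sup>2" t]
    by (simp add: first_cos_def dc_def ss_def mean_cos_cos_def mean_sin_cos_def)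
  moreover have "(first_sin has_real_derivative ds) (at t within {0..})"
    using first_moment_deriv[OF torus_C1_sin t]
    by (simp add: first_sin_def ds_def sc_def mean_sin_sin_def mean_sin_cos_def mult.commute)
  ultimately have "(field_power has_real_derivative
      first_cos t * first_cos t + dc * mean_sin t - (- first_sin t * first_sin t + ds * mean_cos t))
      (at t within {0..})"
    unfolding field_power_def[abs_def]
    by (intro DERIV_diff DERIV_mult mean_cos_deriv mean_sin_deriv t)
  moreover have "first_cos t * first_cos t + dc * mean_sin t - (- first_sin t * first_sin t + ds * mean_cos t)
      = (first_cos t)\<^sup>2 + (first_sin t)\<^sup>2 - (mean_sin t * ss + mean_cos t * sc)
        + \<kappa> / m * misalignment t - \<gamma> / m * field_power t"
    unfolding dc_def ds_def misalignment_eq[OF t] field_power_def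
    by (simp add: power2_eq_square algebra_simps)
  ultimately show ?thesis
    using err zero_le_power2[of "first_cos t"] zero_le_power2[of "first_sin t"]
    by (intro exI conjI) (assumption, linarith)
qed

text \<open>Kinetic plus interaction energy, normalized so that the incoherent state at rest has energy zero.\<close>

definition total_energy :: "real \<Rightarrow> real" where
  "total_energy t = energy t / 2 - \<kappa> / (2 * m) * order_square t"

lemma total_energy_deriv:
  assumes "t \<ge> 0"
  shows "(total_energy has_real_derivative - \<gamma> / m * energy t) (at t within {0..})"
proof -
  have "(total_energy has_real_derivative
      (2 * \<kappa> / m * field_power t - 2 * \<gamma> / m * energy t) / 2 - \<kappa> / (2 * m) * (2 * field_power t)) (at t within {0..})"
    unfolding total_energy_def[abs_def] field_power_def
    by (intro DERIV_diff DERIV_cdivide DERIV_cmult energy_deriv order_square_deriv[unfolded field_power_def] assms)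
  then show ?thesis
    by (simp add: field_simps)
qed

lemma total_energy_decreasing:
  assumes "0 \<le> s" "s \<le> t"
  shows "total_energy t \<le> total_energy s"
proof -
  have "((\<lambda>t. - total_energy t) has_real_derivative - (- \<gamma> / m * energy t)) (at t within {0..})"
    if "t \<ge> 0" for t
    by (intro DERIV_minus total_energy_deriv that)
  from increment_nonneg[OF this assms] show ?thesis
    using m \<gamma> energy_nonneg by simp
qed

lemma order_square_nonneg: "order_square t \<ge> 0"
  by (simp add: order_square_def)

lemma order_square_le:
  assumes t: "t \<ge> 0"
  shows "order_square t \<le> 1"
proof -
  have growth: "quadratic_growth (\<lambda>\<theta> \<omega>. torus_cos \<theta>)" "quadratic_growth (\<lambda>\<theta> \<omega>. (torus_cos \<theta>)\<^sup>2)"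
    "quadratic_growth (\<lambda>\<theta> \<omega>. torus_sin \<theta>)" "quadratic_growth (\<lambda>\<theta> \<omega>. (torus_sin \<theta>)\<^sup>2)"
    by (intro quadratic_growth_angle continuous_on_power torus_continuous)+
  have "order_square t \<le> mean (\<lambda>\<theta> \<omega>. (torus_cos \<theta>)\<^sup>2) t + mean (\<lambda>\<theta> \<omega>. (torus_sin \<theta>)\<^sup>2) t"
    unfolding order_square_def mean_cos_def mean_sin_def by (intro add_mono jensen growth t)
  also have "\<dots> = mean (\<lambda>\<theta> \<omega>. (torus_sin \<theta>)\<^sup>2 + (torus_cos \<theta>)\<^sup>2) t"
    using growth t by (simp only: mean_add)
  also have "\<dots> = 1"
    using t by (simp add: torus_sin_cos_squared mean_const)
  finally show ?thesis .
qed

lemma neg_total_energy_le: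
  assumes "t \<ge> 0"
  shows "- total_energy t \<le> \<kappa> / (2 * m)"
  using mult_left_mono[OF order_square_le[OF assms], of "\<kappa> / (2 * m)"] m \<kappa> energy_nonneg[of t]
  unfolding total_energy_def by simp

lemma neg_total_energy_deriv:
  assumes "t \<ge> 0"
  shows "((\<lambda>t. - (m / \<gamma>) * total_energy t) has_real_derivative energy t) (at t within {0..})"
  using DERIV_cmult[OF total_energy_deriv[OF assms], of "- (m / \<gamma>)"] m \<gamma> by simp

lemma abs_field_power_le:
  assumes "t \<ge> 0"
  shows "2 * \<bar>field_power t\<bar> \<le> energy t + order_square t"
proof -
  have growth: "quadratic_growth (\<lambda>\<theta> \<omega>. 1/2 * (\<omega>\<^sup>2 + order_square t))"
    by (intro quadratic_growth_cmult quadratic_growth_add quadratic_growth_energy quadratic_growth_angle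
        continuous_on_const)
  have "\<bar>mean (\<lambda>\<theta> \<omega>. field t \<theta> * \<omega>) t\<bar> \<le> mean (\<lambda>\<theta> \<omega>. 1/2 * (\<omega>\<^sup>2 + order_square t)) t"
  proof (rule abs_mean_le[OF quadratic_growth_first[OF continuous_field] growth assms])
    fix \<theta> \<omega>
    have "2 * \<bar>field t \<theta>\<bar> * \<bar>\<omega>\<bar> \<le> \<bar>field t \<theta>\<bar>\<^sup>2 + \<bar>\<omega>\<bar>\<^sup>2"
      by (rule sum_squares_bound)
    then show "\<bar>field t \<theta> * \<omega>\<bar> \<le> 1/2 * (\<omega>\<^sup>2 + order_square t)"
      using field_square_le[of t \<theta>] by (simp add: abs_mult)
  qed
  also have "\<dots> = 1/2 * (energy t + order_square t)"
    using assms unfolding mean_cmult energy_def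
    by (subst mean_add) (auto simp: mean_const intro!: quadratic_growth_energy quadratic_growth_angle
        continuous_intros)
  finally show ?thesis
    by (simp add: field_power_eq_mean[OF assms])
qed

end

text \<open>Friction keeps the total energy at most zero, which bounds the kinetic energy by the order parameter
  at each time; the energy lost to friction bounds its integral over all times.\<close>

locale low_energy_flow = kuramoto_flow +
  assumes low_energy: "total_energy 0 \<le> 0"
begin

lemma energy_le_order:
  assumes "t \<ge> 0"
  shows "energy t \<le> \<kappa> / m * order_square t"
proof -
  have "energy t / 2 \<le> \<kappa> / (2 * m) * order_square t"
    using total_energy_decreasing[OF order_refl assms] low_energy by (simp add: total_energy_def)
  then have "energy t \<le> 2 * (\<kappa> / (2 * m) * order_square t)"
    by linarith
  then show ?thesis by simp
qed

lemma energy_bounded: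
  assumes "t \<ge> 0"
  shows "energy t \<le> \<kappa> / m"
proof -
  have "\<kappa> / m * order_square t \<le> \<kappa> / m * 1"
    using m \<kappa> by (intro mult_left_mono order_square_le assms) simp
  from order_trans[OF energy_le_order[OF assms] this] show ?thesis
    by simp
qed

text \<open>Gronwall's argument: as the kinetic energy is at most a multiple of the squared order parameter, the
  latter cannot leave zero.\<close>

lemma order_zero_stays_zero:
  assumes "order_square 0 = 0" "t \<ge> 0"
  shows "order_square t = 0" "energy t = 0"
proof -
  define C where "C = \<kappa> / m + 1"
  have deriv: "((\<lambda>t. - (exp (- C * t) * order_square t)) has_real_derivative
      exp (- C * t) * (C * order_square t - 2 * field_power t)) (at t within {0..})" if "t \<ge> 0" for t
    by (rule derivative_eq_intros order_square_deriv[OF that] refl)+ (simp add: algebra_simps)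
  have "- (exp (- C * 0) * order_square 0) \<le> - (exp (- C * t) * order_square t)"
  proof (rule increment_nonneg[OF deriv order_refl assms(2)])
    fix s assume s: "0 \<le> (s::real)"
    have "2 * field_power s \<le> C * order_square s"
      using abs_field_power_le[OF s] energy_le_order[OF s] by (simp add: C_def algebra_simps abs_le_iff)
    then show "0 \<le> exp (- C * s) * (C * order_square s - 2 * field_power s)"
      by simp
  qed
  then have "exp (- C * t) * order_square t \<le> 0"
    using assms by simp
  then show "order_square t = 0"
    using order_square_nonneg[of t] by (simp add: mult_le_0_iff)
  then show "energy t = 0"
    using energy_le_order[OF assms(2)] energy_nonneg[of t] by simp
qed

lemma abs_first_moment_le:
  assumes "continuous_on UNIV a"
  shows "\<exists>L. \<forall>t\<ge>0. \<bar>mean (\<lambda>\<theta> \<omega>. a \<theta> * \<omega>) t\<bar> \<le> L"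
proof -
  obtain A where A: "A \<ge> 0" "\<And>\<theta>. \<bar>a \<theta>\<bar> \<le> A"
    using torus_continuous_bounded[OF assms] by blast
  have "\<bar>mean (\<lambda>\<theta> \<omega>. a \<theta> * \<omega>) t\<bar> \<le> A * (1 + \<kappa> / m)" if t: "t \<ge> 0" for t
  proof -
    have "\<bar>mean (\<lambda>\<theta> \<omega>. a \<theta> * \<omega>) t\<bar> \<le> A * (1 + energy t)"
    proof (rule abs_mean_le_energy[OF quadratic_growth_first[OF assms] t])
      show "\<bar>a \<theta> * \<omega>\<bar> \<le> A * (1 + \<omega>\<^sup>2)" for \<theta> \<omega>
        unfolding abs_mult using A abs_le_quadratic by (intro mult_mono) auto
    qed
    also have "\<dots> \<le> A * (1 + \<kappa> / m)"
      using energy_bounded[OF t] A by (intro mult_left_mono) auto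
    finally show ?thesis .
  qed
  then show ?thesis by blast
qed

lemma energy_tendsto_0: "(energy \<longlongrightarrow> 0) at_top"
proof (rule barbalat[OF energy_deriv neg_total_energy_deriv energy_nonneg])
  show "- (m / \<gamma>) * total_energy t \<le> m / \<gamma> * (\<kappa> / (2 * m))" if "t \<ge> 0" for t
    using mult_left_mono[OF neg_total_energy_le[OF that], of "m / \<gamma>"] m \<gamma> by simp
  show "\<bar>2 * \<kappa> / m * (mean_sin t * first_cos t - mean_cos t * first_sin t) - 2 * \<gamma> / m * energy t\<bar>
      \<le> \<kappa> / m * (\<kappa> / m + 1) + 2 * \<gamma> / m * (\<kappa> / m)" if t: "t \<ge> 0" for t
  proof -
    have "2 * \<bar>field_power t\<bar> \<le> \<kappa> / m + 1"
      using abs_field_power_le[OF t] energy_bounded[OF t] order_square_le[OF t] by simp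
    from mult_left_mono[OF this, of "\<kappa> / m"]
    have "\<bar>2 * \<kappa> / m * field_power t\<bar> \<le> \<kappa> / m * (\<kappa> / m + 1)"
      using m \<kappa> by (simp add: abs_mult mult.left_commute mult.assoc)
    moreover have "\<bar>2 * \<gamma> / m * energy t\<bar> \<le> 2 * \<gamma> / m * (\<kappa> / m)"
      using mult_left_mono[OF energy_bounded[OF t], of "2 * \<gamma> / m"] m \<gamma> energy_nonneg[of t]
      by (simp add: abs_mult)
    ultimately show ?thesis
      unfolding field_power_def by linarith
  qed
qed auto

lemma total_energy_converges: "\<exists>l. (total_energy \<longlongrightarrow> l) at_top"
proof -
  have "\<exists>l. ((\<lambda>t. - total_energy t) \<longlongrightarrow> l) at_top"
    using total_energy_decreasing neg_total_energy_le
    by (intro nondecreasing_bounded_converges[of 0 _ "\<kappa> / (2 * m)"]) auto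
  then show ?thesis
    using tendsto_minus_cancel_left by blast
qed

text \<open>If the total energy starts at zero while the order parameter is positive, then the kinetic
  energy is positive and friction makes the total energy negative at once. A negative total
  energy keeps the order parameter away from zero.\<close>

lemma order_square_converges:
  assumes "order_square 0 > 0"
  shows "\<exists>r>0. (order_square \<longlongrightarrow> r) at_top"
proof -
  obtain l where l: "(total_energy \<longlongrightarrow> l) at_top"
    using total_energy_converges by blast
  have "\<exists>t\<ge>0. total_energy t < 0"
  proof (cases "total_energy 0 < 0")
    case False
    then have zero: "total_energy 0 = 0"
      using low_energy by simp
    have "energy 0 = \<kappa> / m * order_square 0"
      using zero m by (simp add: total_energy_def field_simps)
    then have "energy 0 > 0"
      using assms m \<kappa> by simp
    then have neg: "- \<gamma> / m * energy 0 < 0"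
      using m \<gamma> by (simp add: divide_neg_pos mult_neg_pos)
    obtain d where d: "d > 0" "\<And>h. 0 < h \<Longrightarrow> 0 + h \<in> {0..} \<Longrightarrow> h < d \<Longrightarrow> total_energy (0 + h) < total_energy 0"
      using has_real_derivative_neg_dec_right[OF total_energy_deriv neg] by auto
    then have "total_energy (0 + d / 2) < total_energy 0"
      by (intro d) auto
    then show ?thesis
      using zero d by (intro exI[of _ "d / 2"]) auto
  qed auto
  then obtain T where T: "T \<ge> 0" "total_energy T < 0"
    by blast
  have "l \<le> total_energy T"
  proof (rule tendsto_upperbound[OF l])
    show "\<forall>\<^sub>F t in at_top. total_energy t \<le> total_energy T"
      using eventually_ge_at_top[of T]
      by eventually_elim (use T total_energy_decreasing in auto)
  qed simp
  then have "l < 0"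
    using T by simp
  have "((\<lambda>t. 2 * m / \<kappa> * (energy t / 2 - total_energy t)) \<longlongrightarrow> 2 * m / \<kappa> * (0 / 2 - l)) at_top"
    by (intro tendsto_intros energy_tendsto_0 l) simp
  moreover have "2 * m / \<kappa> * (energy t / 2 - total_energy t) = order_square t" for t
    using m \<kappa> by (simp add: total_energy_def)
  ultimately have "(order_square \<longlongrightarrow> 2 * m / \<kappa> * (- l)) at_top"
    by simp
  moreover have "2 * m / \<kappa> * (- l) > 0"
    using m \<kappa> \<open>l < 0\<close> by (intro mult_pos_pos divide_pos_pos) auto
  ultimately show ?thesis
    by blast
qed

end

text \<open>A class of functions closed under sums and products, which gives the bounded derivative that
  Barbalat's lemma asks of the misalignment, a polynomial in averages.\<close>

definition tame :: "(real \<Rightarrow> real) \<Rightarrow> bool" where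
  "tame h \<longleftrightarrow> (\<exists>h' B. \<forall>t\<ge>0. (h has_real_derivative h' t) (at t within {0..}) \<and>
    \<bar>h t\<bar> \<le> B \<and> \<bar>h' t\<bar> \<le> B)"

lemma tameI:
  assumes "\<And>t. t \<ge> 0 \<Longrightarrow> (h has_real_derivative h' t) (at t within {0..})"
    and "\<And>t. t \<ge> 0 \<Longrightarrow> \<bar>h t\<bar> \<le> B" and "\<And>t. t \<ge> 0 \<Longrightarrow> \<bar>h' t\<bar> \<le> C"
  shows "tame h"
  unfolding tame_def
proof (intro exI allI impI conjI)
  fix t :: real assume t: "t \<ge> 0"
  show "(h has_real_derivative h' t) (at t within {0..})"
    by (rule assms(1)[OF t])
  show "\<bar>h t\<bar> \<le> max B C" "\<bar>h' t\<bar> \<le> max B C"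
    using assms(2,3)[OF t] by auto
qed

lemma tame_const: "tame (\<lambda>t. c)"
  by (rule tameI[where h' = "\<lambda>t. 0" and B = "\<bar>c\<bar>" and C = 0]) auto

lemma tameE:
  assumes "tame h"
  obtains h' B where "\<And>t. t \<ge> 0 \<Longrightarrow> (h has_real_derivative h' t) (at t within {0..})"
    "\<And>t. t \<ge> 0 \<Longrightarrow> \<bar>h t\<bar> \<le> B" "\<And>t. t \<ge> 0 \<Longrightarrow> \<bar>h' t\<bar> \<le> B"
proof -
  obtain h' B where "\<forall>t\<ge>0. (h has_real_derivative h' t) (at t within {0..}) \<and> \<bar>h t\<bar> \<le> B \<and> \<bar>h' t\<bar> \<le> B"
    using assms unfolding tame_def by (elim exE) (rule that)
  then show thesis
    by (intro that[of h' B]) simp_all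
qed

lemma tame_add:
  assumes "tame g" "tame h"
  shows "tame (\<lambda>t. g t + h t)"
proof -
  from assms(1) obtain g' B where g: "\<And>t. t \<ge> 0 \<Longrightarrow> (g has_real_derivative g' t) (at t within {0..})"
    "\<And>t. t \<ge> 0 \<Longrightarrow> \<bar>g t\<bar> \<le> B" "\<And>t. t \<ge> 0 \<Longrightarrow> \<bar>g' t\<bar> \<le> B"
    by (rule tameE) (rule that)
  from assms(2) obtain h' C where h: "\<And>t. t \<ge> 0 \<Longrightarrow> (h has_real_derivative h' t) (at t within {0..})"
    "\<And>t. t \<ge> 0 \<Longrightarrow> \<bar>h t\<bar> \<le> C" "\<And>t. t \<ge> 0 \<Longrightarrow> \<bar>h' t\<bar> \<le> C"
    by (rule tameE) (rule that)
  show ?thesis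
    by (rule tameI[OF DERIV_add[OF g(1) h(1)]])
      (auto intro: order_trans[OF abs_triangle_ineq add_mono[OF g(2) h(2)]]
        order_trans[OF abs_triangle_ineq add_mono[OF g(3) h(3)]])
qed

lemma tame_mult:
  assumes "tame g" "tame h"
  shows "tame (\<lambda>t. g t * h t)"
proof -
  from assms(1) obtain g' B where g: "\<And>t. t \<ge> 0 \<Longrightarrow> (g has_real_derivative g' t) (at t within {0..})"
    "\<And>t. t \<ge> 0 \<Longrightarrow> \<bar>g t\<bar> \<le> B" "\<And>t. t \<ge> 0 \<Longrightarrow> \<bar>g' t\<bar> \<le> B"
    by (rule tameE) (rule that)
  from assms(2) obtain h' C where h: "\<And>t. t \<ge> 0 \<Longrightarrow> (h has_real_derivative h' t) (at t within {0..})"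
    "\<And>t. t \<ge> 0 \<Longrightarrow> \<bar>h t\<bar> \<le> C" "\<And>t. t \<ge> 0 \<Longrightarrow> \<bar>h' t\<bar> \<le> C"
    by (rule tameE) (rule that)
  have "B \<ge> 0" "C \<ge> 0"
    using g(2)[of 0] h(2)[of 0] by auto
  then have prod: "\<bar>x * y\<bar> \<le> B * C" if "\<bar>x\<bar> \<le> B" "\<bar>y\<bar> \<le> C" for x y
    unfolding abs_mult using that by (intro mult_mono) auto
  show ?thesis
  proof (rule tameI[OF DERIV_mult[OF g(1) h(1)]])
    fix t :: real assume t: "t \<ge> 0"
    show "\<bar>g t * h t\<bar> \<le> B * C"
      by (intro prod g h t)
    have "\<bar>g' t * h t\<bar> \<le> B * C" "\<bar>g t * h' t\<bar> \<le> B * C"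
      by (intro prod g h t)+
    then show "\<bar>g' t * h t + h' t * g t\<bar> \<le> 2 * (B * C)"
      using abs_triangle_ineq[of "g' t * h t" "h' t * g t"] by (simp add: mult.commute)
  qed
qed

context low_energy_flow
begin

section \<open>Convergence of the phase\<close>

lemma tame_angle_moment:
  assumes "torus_C1 a a'"
  shows "tame (mean (\<lambda>\<theta> \<omega>. a \<theta>))"
proof -
  obtain A where A: "A \<ge> 0" "\<And>\<theta>. \<bar>a \<theta>\<bar> \<le> A"
    by (rule torus_continuous_bounded[OF torus_C1_continuous[OF assms]]) (rule that)
  obtain L where L: "\<And>t. t \<ge> 0 \<Longrightarrow> \<bar>mean (\<lambda>\<theta> \<omega>. a' \<theta> * \<omega>) t\<bar> \<le> L"
    using abs_first_moment_le assms unfolding torus_C1_def by blast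
  show ?thesis
    by (rule tameI[OF angle_moment_deriv[OF assms]
        abs_mean_angle_le[OF torus_C1_continuous[OF assms] _ A(2)] L])
qed

lemma tame_moments: "tame mean_cos" "tame mean_sin" "tame mean_cos_cos" "tame mean_sin_cos" "tame mean_sin_sin"
  unfolding mean_cos_def mean_sin_def mean_cos_cos_def mean_sin_cos_def mean_sin_sin_def
  by (rule tame_angle_moment torus_C1_mult torus_C1_cos torus_C1_sin)+

text \<open>The misalignment is bounded by the derivative of the exchanged power plus a multiple of that power,
  which is itself a derivative, and a multiple of the kinetic energy, whose integral friction bounds.\<close>

lemma misalignment_integrable:
  "\<exists>H H' B. \<forall>t\<ge>0. (H has_real_derivative H' t) (at t within {0..}) \<and> misalignment t \<le> H' t \<and> H t \<le> B"
proof -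
  have "\<forall>t\<in>{0..}. \<exists>d. (field_power has_real_derivative d) (at t within {0..}) \<and>
      \<kappa> / m * misalignment t \<le> d + \<gamma> / m * field_power t + 2 * energy t"
    using field_power_deriv by simp
  from bchoice[OF this] obtain d where d: "\<And>t. t \<ge> 0 \<Longrightarrow> (field_power has_real_derivative d t) (at t within {0..})"
      "\<And>t. t \<ge> 0 \<Longrightarrow> \<kappa> / m * misalignment t \<le> d t + \<gamma> / m * field_power t + 2 * energy t"
    by auto
  define H where "H t = m / \<kappa> * (field_power t + \<gamma> / (2 * m) * order_square t
    + 2 * (- (m / \<gamma>) * total_energy t))" for t
  define H' where "H' t = m / \<kappa> * (d t + \<gamma> / (2 * m) * (2 * field_power t) + 2 * energy t)" for t
  have "(H has_real_derivative H' t) (at t within {0..})" if "t \<ge> 0" for t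
    unfolding H_def[abs_def] H'_def
    by (intro DERIV_cmult DERIV_add d order_square_deriv neg_total_energy_deriv that)
  moreover have "misalignment t \<le> H' t" if "t \<ge> 0" for t
  proof -
    have "m / \<kappa> * (\<kappa> / m * misalignment t) \<le> H' t"
      unfolding H'_def using d(2)[OF that] m \<kappa> by (intro mult_left_mono) auto
    then show ?thesis using m \<kappa> by simp
  qed
  moreover have "H t \<le> m / \<kappa> * ((\<kappa> / m + 1) + \<gamma> / (2 * m) * 1 + 2 * (m / \<gamma> * (\<kappa> / (2 * m))))" if t: "t \<ge> 0" for t
  proof -
    have "field_power t \<le> \<kappa> / m + 1"
      using abs_field_power_le[OF t] energy_bounded[OF t] order_square_le[OF t] by linarith
    moreover have "\<gamma> / (2 * m) * order_square t \<le> \<gamma> / (2 * m) * 1"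
      using m \<gamma> by (intro mult_left_mono order_square_le t) simp
    moreover have "m / \<gamma> * (- total_energy t) \<le> m / \<gamma> * (\<kappa> / (2 * m))"
      using m \<gamma> by (intro mult_left_mono neg_total_energy_le t) simp
    ultimately show ?thesis
      unfolding H_def using m \<kappa> by (intro mult_left_mono) auto
  qed
  ultimately show ?thesis by blast
qed

lemma misalignment_tendsto_0: "(misalignment \<longlongrightarrow> 0) at_top"
proof -
  define P where "P t = (mean_sin t * mean_sin t) * mean_cos_cos t
    + ((- 2) * (mean_sin t * mean_cos t) * mean_sin_cos t + (mean_cos t * mean_cos t) * mean_sin_sin t)" for t
  have P: "P t = misalignment t" if "t \<ge> 0" for t
    using misalignment_eq[OF that] by (simp add: P_def power2_eq_square)
  have "tame P"
    unfolding P_def[abs_def] by (intro tame_add tame_mult tame_const tame_moments)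
  then obtain P' L where P': "\<And>t. t \<ge> 0 \<Longrightarrow> (P has_real_derivative P' t) (at t within {0..})"
    "\<And>t. t \<ge> 0 \<Longrightarrow> \<bar>P' t\<bar> \<le> L"
    unfolding tame_def by blast
  obtain H H' B where H: "\<And>t. t \<ge> 0 \<Longrightarrow> (H has_real_derivative H' t) (at t within {0..})"
    "\<And>t. t \<ge> 0 \<Longrightarrow> misalignment t \<le> H' t" "\<And>t. t \<ge> 0 \<Longrightarrow> H t \<le> B"
    using misalignment_integrable by blast
  have "(P \<longlongrightarrow> 0) at_top"
    by (rule barbalat[OF P'(1) H(1) _ _ P'(2) H(3)]) (use H(2) misalignment_nonneg P in auto)
  moreover have "\<forall>\<^sub>F t in at_top. P t = misalignment t"
    using eventually_ge_at_top[of 0] by eventually_elim (rule P)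
  ultimately show ?thesis
    by (rule Lim_transform_eventually)
qed

lemma momentum_eq:
  assumes "t \<ge> 0"
  shows "momentum t = momentum 0 * exp (- (\<gamma> / m) * t)"
proof -
  let ?h = "\<lambda>t. momentum t * exp (\<gamma> / m * t)"
  have deriv: "(?h has_real_derivative 0) (at t within {0..})" if "t \<ge> 0" for t
    by (rule derivative_eq_intros momentum_deriv[OF that] refl)+ (simp add: algebra_simps)
  have "?h 0 \<le> ?h t" "- ?h 0 \<le> - ?h t"
    using increment_nonneg[OF deriv order_refl assms] increment_nonneg[OF DERIV_minus[OF deriv] order_refl assms]
    by simp_all
  then have "momentum 0 = momentum t * exp (\<gamma> / m * t)"
    by simp
  then show ?thesis
    by (simp add: mult.assoc exp_add[symmetric])
qed

text \<open>At both poles \<open>cos\<^sup>2 \<theta>\<close>, \<open>sin \<theta> cos \<theta>\<close> and \<open>cos 2\<theta>\<close> take the values that they have at the average phase,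
  so they differ from those values by a multiple of the mean field, which vanishes there to first
  order. Such quantities do not see how the mass is divided between the poles.\<close>

lemma order_square_cos_cos:
  "order_square t * (torus_cos \<theta> * torus_cos \<theta>) =
    (mean_cos t)\<^sup>2 + field t \<theta> * (mean_sin t * torus_cos \<theta> + mean_cos t * torus_sin \<theta>)"
proof -
  have "order_square t * (torus_cos \<theta> * torus_cos \<theta>) =
      (mean_cos t)\<^sup>2 * ((torus_sin \<theta>)\<^sup>2 + (torus_cos \<theta>)\<^sup>2)
      + field t \<theta> * (mean_sin t * torus_cos \<theta> + mean_cos t * torus_sin \<theta>)"
    by (simp add: field_def order_square_def power2_eq_square algebra_simps)
  then show ?thesis by (simp add: torus_sin_cos_squared)
qed

lemma order_square_sin_cos:
  "order_square t * (torus_sin \<theta> * torus_cos \<theta>) =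
    mean_sin t * mean_cos t + field t \<theta> * (mean_sin t * torus_sin \<theta> - mean_cos t * torus_cos \<theta>)"
proof -
  have "order_square t * (torus_sin \<theta> * torus_cos \<theta>) =
      mean_sin t * mean_cos t * ((torus_sin \<theta>)\<^sup>2 + (torus_cos \<theta>)\<^sup>2)
      + field t \<theta> * (mean_sin t * torus_sin \<theta> - mean_cos t * torus_cos \<theta>)"
    by (simp add: field_def order_square_def power2_eq_square algebra_simps)
  then show ?thesis by (simp add: torus_sin_cos_squared)
qed

lemma order_square_cos_double:
  "order_square t * (torus_cos \<theta> * torus_cos \<theta> + - torus_sin \<theta> * torus_sin \<theta>) =
    ((mean_cos t)\<^sup>2 - (mean_sin t)\<^sup>2)
      + field t \<theta> * (2 * (mean_sin t * torus_cos \<theta> + mean_cos t * torus_sin \<theta>))"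
proof -
  have "order_square t * (torus_cos \<theta> * torus_cos \<theta> + - torus_sin \<theta> * torus_sin \<theta>) =
      ((mean_cos t)\<^sup>2 - (mean_sin t)\<^sup>2) * ((torus_sin \<theta>)\<^sup>2 + (torus_cos \<theta>)\<^sup>2)
      + field t \<theta> * (2 * (mean_sin t * torus_cos \<theta> + mean_cos t * torus_sin \<theta>))"
    by (simp add: field_def order_square_def power2_eq_square algebra_simps)
  then show ?thesis by (simp add: torus_sin_cos_squared)
qed

lemma abs_moment_combination_le:
  assumes "t \<ge> 0" "\<bar>u\<bar> \<le> 1" "\<bar>v\<bar> \<le> 1"
  shows "\<bar>mean_sin t * u + mean_cos t * v\<bar> \<le> 2" "\<bar>mean_sin t * u - mean_cos t * v\<bar> \<le> 2"
proof -
  have "\<bar>mean_sin t * u\<bar> \<le> 1 * 1" "\<bar>mean_cos t * v\<bar> \<le> 1 * 1"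
    unfolding abs_mult using assms by (intro mult_mono abs_mean_cos_le abs_mean_sin_le; simp)+
  then show "\<bar>mean_sin t * u + mean_cos t * v\<bar> \<le> 2" "\<bar>mean_sin t * u - mean_cos t * v\<bar> \<le> 2"
    by linarith+
qed

text \<open>Here \<open>a\<close> is the derivative of a second harmonic. The constant part \<open>k\<close> meets only the momentum, and
  the error \<open>g q\<close> is small exactly where the mass gathers: \<open>\<bar>\<langle>g q \<omega>\<rangle>\<bar>\<close> is bounded by the two integrable quantities
  \<open>\<langle>g\<^sup>2\<rangle>\<close> and \<open>\<langle>\<omega>\<^sup>2\<rangle>\<close>.\<close>

lemma order_square_flux_le:
  assumes t: "t \<ge> 0" and a: "continuous_on UNIV a" and q: "continuous_on UNIV q" "\<And>\<theta>. \<bar>q \<theta>\<bar> \<le> 4"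
    and eq: "\<And>\<theta>. order_square t * a \<theta> = k + field t \<theta> * q \<theta>" and k: "\<bar>k\<bar> \<le> 2"
  shows "\<bar>order_square t * mean (\<lambda>\<theta> \<omega>. a \<theta> * \<omega>) t\<bar> \<le> 2 * (\<bar>momentum t\<bar> + misalignment t + energy t)"
proof -
  have growth: "quadratic_growth (\<lambda>\<theta> \<omega>. (field t \<theta> * q \<theta>) * \<omega>)" "quadratic_growth (\<lambda>\<theta> \<omega>. \<omega>)"
    using quadratic_growth_first[OF continuous_on_mult[OF continuous_field q(1)]]
      quadratic_growth_first[of "\<lambda>_. 1"] by simp_all
  have growth': "quadratic_growth (\<lambda>\<theta> \<omega>. (field t \<theta>)\<^sup>2)" "quadratic_growth (\<lambda>\<theta> \<omega>. \<omega>\<^sup>2)"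
    by (intro quadratic_growth_angle continuous_on_power continuous_field quadratic_growth_energy)+
  have "order_square t * mean (\<lambda>\<theta> \<omega>. a \<theta> * \<omega>) t = mean (\<lambda>\<theta> \<omega>. k * \<omega> + (field t \<theta> * q \<theta>) * \<omega>) t"
    unfolding mean_cmult[symmetric] mult.assoc[symmetric] eq by (simp add: algebra_simps)
  also have "\<dots> = k * momentum t + mean (\<lambda>\<theta> \<omega>. (field t \<theta> * q \<theta>) * \<omega>) t"
    using t growth by (simp only: mean_add mean_cmult quadratic_growth_cmult momentum_def)
  finally have "\<bar>order_square t * mean (\<lambda>\<theta> \<omega>. a \<theta> * \<omega>) t\<bar> \<le>
      \<bar>k * momentum t\<bar> + \<bar>mean (\<lambda>\<theta> \<omega>. (field t \<theta> * q \<theta>) * \<omega>) t\<bar>"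
    by simp
  moreover have "\<bar>k * momentum t\<bar> \<le> 2 * \<bar>momentum t\<bar>"
    unfolding abs_mult by (intro mult_right_mono k) simp
  moreover have "\<bar>mean (\<lambda>\<theta> \<omega>. (field t \<theta> * q \<theta>) * \<omega>) t\<bar> \<le>
      mean (\<lambda>\<theta> \<omega>. 2 * ((field t \<theta>)\<^sup>2 + \<omega>\<^sup>2)) t"
  proof (rule abs_mean_le[OF growth(1) quadratic_growth_cmult[OF quadratic_growth_add[OF growth']] t])
    fix \<theta> \<omega>
    have "\<bar>(field t \<theta> * q \<theta>) * \<omega>\<bar> = \<bar>q \<theta>\<bar> * (\<bar>field t \<theta>\<bar> * \<bar>\<omega>\<bar>)"
      by (simp add: abs_mult)
    also have "\<dots> \<le> 4 * (\<bar>field t \<theta>\<bar> * \<bar>\<omega>\<bar>)"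
      by (intro mult_right_mono q) simp
    also have "\<dots> \<le> 2 * (\<bar>field t \<theta>\<bar>\<^sup>2 + \<bar>\<omega>\<bar>\<^sup>2)"
      using sum_squares_bound[of "\<bar>field t \<theta>\<bar>" "\<bar>\<omega>\<bar>"] by simp
    finally show "\<bar>(field t \<theta> * q \<theta>) * \<omega>\<bar> \<le> 2 * ((field t \<theta>)\<^sup>2 + \<omega>\<^sup>2)"
      by simp
  qed
  moreover have "mean (\<lambda>\<theta> \<omega>. 2 * ((field t \<theta>)\<^sup>2 + \<omega>\<^sup>2)) t = 2 * (misalignment t + energy t)"
    using t growth' by (simp only: mean_add mean_cmult misalignment_def energy_def)
  ultimately show ?thesis
    by simp
qed

lemma order_square_moment_tendsto:
  assumes a: "continuous_on UNIV a"
    and q: "\<And>t. continuous_on UNIV (q t)" "\<And>t \<theta>. t \<ge> 0 \<Longrightarrow> \<bar>q t \<theta>\<bar> \<le> 2"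
    and eq: "\<And>t \<theta>. order_square t * a \<theta> = k t + field t \<theta> * q t \<theta>"
  shows "((\<lambda>t. order_square t * mean (\<lambda>\<theta> \<omega>. a \<theta>) t - k t) \<longlongrightarrow> 0) at_top"
proof -
  let ?D = "\<lambda>t. order_square t * mean (\<lambda>\<theta> \<omega>. a \<theta>) t - k t"
  have bound: "(?D t)\<^sup>2 \<le> 4 * misalignment t" if t: "t \<ge> 0" for t
  proof -
    have cont: "continuous_on UNIV (\<lambda>\<theta>. field t \<theta> * q t \<theta>)"
      by (intro continuous_on_mult continuous_field q)
    have growth: "quadratic_growth (\<lambda>\<theta> \<omega>. field t \<theta> * q t \<theta>)" "quadratic_growth (\<lambda>\<theta> \<omega>. (field t \<theta> * q t \<theta>)\<^sup>2)"
      "quadratic_growth (\<lambda>\<theta> \<omega>. (field t \<theta>)\<^sup>2)"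
      by (intro quadratic_growth_angle continuous_on_power cont continuous_field)+
    have "order_square t * mean (\<lambda>\<theta> \<omega>. a \<theta>) t = mean (\<lambda>\<theta> \<omega>. k t + field t \<theta> * q t \<theta>) t"
      unfolding mean_cmult[symmetric] eq ..
    also have "\<dots> = k t + mean (\<lambda>\<theta> \<omega>. field t \<theta> * q t \<theta>) t"
      using t growth by (simp add: mean_add mean_const quadratic_growth_angle)
    finally have "(?D t)\<^sup>2 = (mean (\<lambda>\<theta> \<omega>. field t \<theta> * q t \<theta>) t)\<^sup>2"
      by simp
    also have "\<dots> \<le> mean (\<lambda>\<theta> \<omega>. (field t \<theta> * q t \<theta>)\<^sup>2) t"
      by (rule jensen[OF growth(1,2) t])
    also have "\<dots> \<le> mean (\<lambda>\<theta> \<omega>. 4 * (field t \<theta>)\<^sup>2) t"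
    proof (rule mean_mono[OF growth(2) quadratic_growth_cmult[OF growth(3)] t])
      fix \<theta>
      have "(q t \<theta>)\<^sup>2 \<le> 2\<^sup>2"
        using power_mono[OF q(2)[OF t, of \<theta>] abs_ge_zero, of 2] by simp
      then show "(field t \<theta> * q t \<theta>)\<^sup>2 \<le> 4 * (field t \<theta>)\<^sup>2"
        using mult_right_mono[of "(q t \<theta>)\<^sup>2" 4 "(field t \<theta>)\<^sup>2"] by (simp add: power_mult_distrib mult.commute)
    qed
    also have "\<dots> = 4 * misalignment t"
      by (simp only: mean_cmult misalignment_def)
    finally show ?thesis .
  qed
  have "((\<lambda>t. (?D t)\<^sup>2) \<longlongrightarrow> 0) at_top"
  proof (rule Lim_null_comparison)
    show "\<forall>\<^sub>F t in at_top. norm ((?D t)\<^sup>2) \<le> 4 * misalignment t"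
      using eventually_ge_at_top[of 0] by eventually_elim (use bound in simp)
    show "((\<lambda>t. 4 * misalignment t) \<longlongrightarrow> 0) at_top"
      using tendsto_mult_left[OF misalignment_tendsto_0, of 4] by simp
  qed
  from tendsto_real_sqrt[OF this] show ?thesis
    by (simp add: tendsto_rabs_zero_iff)
qed

lemma angle_moment_converges:
  assumes pos: "order_square 0 > 0" and a: "torus_C1 a a'"
    and q: "\<And>t. continuous_on UNIV (q t)" "\<And>t \<theta>. t \<ge> 0 \<Longrightarrow> \<bar>q t \<theta>\<bar> \<le> 4"
    and eq: "\<And>t \<theta>. order_square t * a' \<theta> = k t + field t \<theta> * q t \<theta>"
    and k: "\<And>t. t \<ge> 0 \<Longrightarrow> \<bar>k t\<bar> \<le> 2"
  shows "\<exists>l. (mean (\<lambda>\<theta> \<omega>. a \<theta>) \<longlongrightarrow> l) at_top"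
proof -
  obtain r where r: "r > 0" "(order_square \<longlongrightarrow> r) at_top"
    using order_square_converges[OF pos] by blast
  have "\<forall>\<^sub>F t in at_top. order_square t > r / 2"
    using r by (intro order_tendstoD(1)[OF r(2)]) simp
  then obtain t1 where t1: "\<And>t. t \<ge> t1 \<Longrightarrow> order_square t > r / 2"
    by (auto simp: eventually_at_top_linorder)
  obtain G G' B where G: "\<And>t. t \<ge> 0 \<Longrightarrow> (G has_real_derivative G' t) (at t within {0..})"
    "\<And>t. t \<ge> 0 \<Longrightarrow> misalignment t \<le> G' t" "\<And>t. t \<ge> 0 \<Longrightarrow> G t \<le> B"
    using misalignment_integrable by blast
  define S where "S t = - (m / \<gamma>) * (\<bar>momentum 0\<bar> * exp (- (\<gamma> / m) * t))" for t
  define H where "H t = 4 / r * (S t + G t + - (m / \<gamma>) * total_energy t)" for t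
  define H' where "H' t = 4 / r * (\<bar>momentum t\<bar> + G' t + energy t)" for t
  have S: "(S has_real_derivative \<bar>momentum t\<bar>) (at t within {0..})" if "t \<ge> 0" for t
  proof -
    have "((\<lambda>t. exp (- (\<gamma> / m) * t)) has_real_derivative exp (- (\<gamma> / m) * t) * - (\<gamma> / m))
        (at t within {0..})"
      using m by (auto intro!: derivative_eq_intros)
    then have "((\<lambda>t. - (m / \<gamma>) * (\<bar>momentum 0\<bar> * exp (- (\<gamma> / m) * t))) has_real_derivative
        - (m / \<gamma>) * (\<bar>momentum 0\<bar> * (exp (- (\<gamma> / m) * t) * - (\<gamma> / m)))) (at t within {0..})"
      by (intro DERIV_cmult)
    moreover have "- (m / \<gamma>) * (\<bar>momentum 0\<bar> * (exp (- (\<gamma> / m) * t) * - (\<gamma> / m))) = \<bar>momentum t\<bar>"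
      using m \<gamma> unfolding momentum_eq[OF that] by (simp add: abs_mult)
    ultimately show ?thesis
      unfolding S_def[abs_def] by (simp only:)
  qed
  have H: "(H has_real_derivative H' t) (at t within {0..})" if "t \<ge> 0" for t
  proof -
    have "((\<lambda>t. S t + G t + - (m / \<gamma>) * total_energy t) has_real_derivative
        \<bar>momentum t\<bar> + G' t + energy t) (at t within {0..})"
      using S[OF that] G(1)[OF that] neg_total_energy_deriv[OF that] by (intro DERIV_add)
    then show ?thesis
      unfolding H_def[abs_def] H'_def by (rule DERIV_cmult)
  qed
  obtain A where A: "A \<ge> 0" "\<And>\<theta>. \<bar>a \<theta>\<bar> \<le> A"
    by (rule torus_continuous_bounded[OF torus_C1_continuous[OF a]]) (rule that)
  show ?thesis
  proof (rule dominated_deriv_converges[where X' = "mean (\<lambda>\<theta> \<omega>. a' \<theta> * \<omega>)" and H = H and H' = H'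
        and ?t0.0 = "max t1 0" and A = A and B = "4 / r * (0 + B + m / \<gamma> * (\<kappa> / (2 * m)))"])
    show "(mean (\<lambda>\<theta> \<omega>. a \<theta>) has_real_derivative mean (\<lambda>\<theta> \<omega>. a' \<theta> * \<omega>) t) (at t within {0..})"
      if "t \<ge> 0" for t
      by (rule angle_moment_deriv[OF a that])
    show "(H has_real_derivative H' t) (at t within {0..})" if "t \<ge> 0" for t
      by (rule H[OF that])
    show "max t1 0 \<ge> 0" by simp
    fix t assume "t \<ge> max t1 0"
    then have t: "t \<ge> t1" "t \<ge> 0" by auto
    have "r / 2 * \<bar>mean (\<lambda>\<theta> \<omega>. a' \<theta> * \<omega>) t\<bar> \<le> order_square t * \<bar>mean (\<lambda>\<theta> \<omega>. a' \<theta> * \<omega>) t\<bar>"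
      using t1[OF t(1)] by (intro mult_right_mono) auto
    also have "\<dots> = \<bar>order_square t * mean (\<lambda>\<theta> \<omega>. a' \<theta> * \<omega>) t\<bar>"
      using order_square_nonneg[of t] by (simp add: abs_mult)
    also have "\<dots> \<le> 2 * (\<bar>momentum t\<bar> + misalignment t + energy t)"
      using a by (intro order_square_flux_le[OF t(2) _ q(1) q(2)[OF t(2)] eq k[OF t(2)]])
        (simp add: torus_C1_def)
    also have "\<dots> \<le> 2 * (\<bar>momentum t\<bar> + G' t + energy t)"
      using G(2)[OF t(2)] by simp
    finally show "\<bar>mean (\<lambda>\<theta> \<omega>. a' \<theta> * \<omega>) t\<bar> \<le> H' t"
      using r(1) by (simp add: H'_def field_simps)
    have "S t \<le> 0"
      unfolding S_def using m \<gamma> by (simp add: mult_nonpos_nonneg)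
    moreover have "- (m / \<gamma>) * total_energy t \<le> m / \<gamma> * (\<kappa> / (2 * m))"
      using mult_left_mono[OF neg_total_energy_le[OF t(2)], of "m / \<gamma>"] m \<gamma> by simp
    ultimately show "H t \<le> 4 / r * (0 + B + m / \<gamma> * (\<kappa> / (2 * m)))"
      unfolding H_def using r(1) G(3)[OF t(2)] by (intro mult_left_mono add_mono) auto
    show "mean (\<lambda>\<theta> \<omega>. a \<theta>) t \<le> A"
      using abs_mean_angle_le[OF torus_C1_continuous[OF a] t(2) A(2)] by simp
  qed
qed

text \<open>The averages of the second harmonics converge, hence \<open>z\<^sup>2\<close> does; its limit has modulus \<open>lim R\<^sup>2 > 0\<close>, so
  \<open>z\<close> itself converges.\<close>

lemma phase_converges:
  assumes pos: "order_square 0 > 0"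
  shows "\<exists>\<rho> \<phi>. \<rho> > 0 \<and> (mean_cos \<longlongrightarrow> \<rho> * cos \<phi>) at_top \<and> (mean_sin \<longlongrightarrow> \<rho> * sin \<phi>) at_top \<and>
    (mean_cos_cos \<longlongrightarrow> (cos \<phi>)\<^sup>2) at_top \<and> (mean_sin_cos \<longlongrightarrow> sin \<phi> * cos \<phi>) at_top"
proof -
  obtain r where r: "r > 0" "(order_square \<longlongrightarrow> r) at_top"
    using order_square_converges[OF pos] by blast
  note cont = continuous_on_mult continuous_on_add continuous_on_diff continuous_on_const
    continuous_torus_cos continuous_torus_sin
  note le = abs_moment_combination_le[OF _ abs_torus_cos_le abs_torus_sin_le]
    abs_moment_combination_le[OF _ abs_torus_sin_le abs_torus_cos_le]
  have sq: "(mean_cos t)\<^sup>2 \<le> 1" "(mean_sin t)\<^sup>2 \<le> 1" "\<bar>mean_sin t * mean_cos t\<bar> \<le> 1" if "t \<ge> 0" for t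
    using abs_mean_cos_le[OF that] abs_mean_sin_le[OF that]
      mult_mono[OF abs_mean_sin_le[OF that] abs_mean_cos_le[OF that]]
    by (simp_all add: abs_square_le_1 abs_mult)
  have cos_deriv: "order_square t * (- torus_sin \<theta> * torus_cos \<theta> + - torus_sin \<theta> * torus_cos \<theta>) =
      - 2 * (mean_sin t * mean_cos t)
      + field t \<theta> * (- 2 * (mean_sin t * torus_sin \<theta> - mean_cos t * torus_cos \<theta>))" for t \<theta>
    using order_square_sin_cos[of t \<theta>] by (simp add: algebra_simps)
  have "\<exists>l. (mean_cos_cos \<longlongrightarrow> l) at_top"
    unfolding mean_cos_cos_def
  proof (rule angle_moment_converges[OF pos torus_C1_mult[OF torus_C1_cos torus_C1_cos] _ _ cos_deriv])
    show "continuous_on UNIV (\<lambda>\<theta>. - 2 * (mean_sin t * torus_sin \<theta> - mean_cos t * torus_cos \<theta>))" for t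
      by (intro cont)
    show "\<bar>- 2 * (mean_sin t * torus_sin \<theta> - mean_cos t * torus_cos \<theta>)\<bar> \<le> 4" if "t \<ge> 0" for t \<theta>
      unfolding abs_mult using le(4)[OF that, of \<theta> \<theta>] by simp
    show "\<bar>- 2 * (mean_sin t * mean_cos t)\<bar> \<le> 2" if "t \<ge> 0" for t
      unfolding abs_mult[of "- 2"] using sq(3)[OF that] by simp
  qed
  then obtain l1 where l1: "(mean_cos_cos \<longlongrightarrow> l1) at_top" by blast
  have "\<exists>l. (mean_sin_cos \<longlongrightarrow> l) at_top"
    unfolding mean_sin_cos_def
  proof (rule angle_moment_converges[OF pos torus_C1_mult[OF torus_C1_sin torus_C1_cos] _ _ order_square_cos_double])
    show "\<bar>(mean_cos t)\<^sup>2 - (mean_sin t)\<^sup>2\<bar> \<le> 2" if "t \<ge> 0" for t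
      using sq[OF that] zero_le_power2[of "mean_cos t"] zero_le_power2[of "mean_sin t"] by linarith
    show "continuous_on UNIV (\<lambda>\<theta>. 2 * (mean_sin t * torus_cos \<theta> + mean_cos t * torus_sin \<theta>))" for t
      by (intro cont)
    show "\<bar>2 * (mean_sin t * torus_cos \<theta> + mean_cos t * torus_sin \<theta>)\<bar> \<le> 4" if "t \<ge> 0" for t \<theta>
      unfolding abs_mult[of 2] using le(1)[OF that, of \<theta> \<theta>] by simp
  qed
  then obtain l2 where l2: "(mean_sin_cos \<longlongrightarrow> l2) at_top" by blast
  have "((\<lambda>t. order_square t * mean_cos_cos t - (mean_cos t)\<^sup>2) \<longlongrightarrow> 0) at_top"
    unfolding mean_cos_cos_def
    by (rule order_square_moment_tendsto[OF _ _ _ order_square_cos_cos]) (use le in \<open>auto intro!: cont\<close>)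
  from tendsto_diff[OF tendsto_mult[OF r(2) l1] this]
  have x2: "((\<lambda>t. (mean_cos t)\<^sup>2) \<longlongrightarrow> r * l1) at_top" by simp
  have "((\<lambda>t. order_square t * mean_sin_cos t - mean_sin t * mean_cos t) \<longlongrightarrow> 0) at_top"
    unfolding mean_sin_cos_def
    by (rule order_square_moment_tendsto[OF _ _ _ order_square_sin_cos]) (use le in \<open>auto intro!: cont\<close>)
  from tendsto_diff[OF tendsto_mult[OF r(2) l2] this]
  have xy: "((\<lambda>t. mean_sin t * mean_cos t) \<longlongrightarrow> r * l2) at_top" by simp
  from tendsto_diff[OF r(2) x2]
  have y2: "((\<lambda>t. (mean_sin t)\<^sup>2) \<longlongrightarrow> r - r * l1) at_top" by (simp add: order_square_def)
  define z where "z t = Complex (mean_cos t) (mean_sin t)" for t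
  define \<zeta> where "\<zeta> = Complex (r * l1 - (r - r * l1)) (2 * (r * l2))"
  have z2: "((\<lambda>t. (z t)\<^sup>2) \<longlongrightarrow> \<zeta>) at_top"
  proof -
    have "(z t)\<^sup>2 = Complex ((mean_cos t)\<^sup>2 - (mean_sin t)\<^sup>2) (2 * (mean_sin t * mean_cos t))" for t
      by (simp add: z_def complex_eq_iff power2_eq_square)
    then show ?thesis
      unfolding \<zeta>_def by (simp only:) (intro tendsto_Complex tendsto_diff tendsto_mult_left x2 y2 xy)
  qed
  have norm_z: "(cmod (z t))\<^sup>2 = order_square t" for t
    by (simp add: z_def cmod_power2 order_square_def)
  have "((\<lambda>t. cmod ((z t)\<^sup>2)) \<longlongrightarrow> cmod \<zeta>) at_top"
    by (rule tendsto_norm[OF z2])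
  then have "(order_square \<longlongrightarrow> cmod \<zeta>) at_top"
    by (simp add: norm_power norm_z)
  then have "cmod \<zeta> = r"
    by (rule tendsto_unique[OF trivial_limit_at_top_linorder _ r(2)])
  then have "\<zeta> \<noteq> 0"
    using r(1) by auto
  moreover have "continuous_on {0..} z"
    unfolding z_def[abs_def] Complex_eq
    by (intro continuous_intros continuous_mean_cos continuous_mean_sin)
  ultimately obtain \<xi> where \<xi>: "(z \<longlongrightarrow> \<xi>) at_top"
    using square_converges_imp_converges[OF _ z2] by blast
  define \<rho> where "\<rho> = cmod \<xi>"
  define \<phi> where "\<phi> = Arg \<xi>"
  have polar: "Re \<xi> = \<rho> * cos \<phi>" "Im \<xi> = \<rho> * sin \<phi>"
    using rcis_cmod_Arg[of \<xi>] unfolding \<rho>_def \<phi>_def by (metis Re_rcis, metis Im_rcis)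
  have x: "(mean_cos \<longlongrightarrow> \<rho> * cos \<phi>) at_top" and y: "(mean_sin \<longlongrightarrow> \<rho> * sin \<phi>) at_top"
    using tendsto_Re[OF \<xi>] tendsto_Im[OF \<xi>] by (simp_all add: z_def polar)
  have "((\<lambda>t. (cmod (z t))\<^sup>2) \<longlongrightarrow> \<rho>\<^sup>2) at_top"
    unfolding \<rho>_def by (intro tendsto_power tendsto_norm \<xi>)
  then have "(order_square \<longlongrightarrow> \<rho>\<^sup>2) at_top"
    by (simp add: norm_z)
  then have \<rho>r: "\<rho>\<^sup>2 = r"
    by (rule tendsto_unique[OF trivial_limit_at_top_linorder _ r(2)])
  then have \<rho>: "\<rho> > 0"
    using r(1) by (auto simp: \<rho>_def)
  have "(\<rho> * cos \<phi>)\<^sup>2 = r * l1"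
    by (rule tendsto_unique[OF trivial_limit_at_top_linorder tendsto_power[OF x] x2])
  then have "l1 = (cos \<phi>)\<^sup>2"
    using r(1) by (simp add: \<rho>r power_mult_distrib)
  moreover have "(\<rho> * sin \<phi>) * (\<rho> * cos \<phi>) = r * l2"
    by (rule tendsto_unique[OF trivial_limit_at_top_linorder tendsto_mult[OF y x] xy])
  then have "r * (sin \<phi> * cos \<phi>) = r * l2"
    by (simp add: \<rho>r[symmetric] power2_eq_square mult_ac)
  then have "l2 = sin \<phi> * cos \<phi>"
    using r(1) by simp
  ultimately show ?thesis
    using \<rho> x y l1 l2 by blast
qed

end

section \<open>Convergence and stationarity of the solution\<close>

context kuramoto_flow
begin

lemma order_parameter_square:
  assumes t: "t \<ge> 0"
  shows "(order_parameter (f t))\<^sup>2 = order_square t"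
proof -
  have int: "integrable (f t) (\<lambda>z. torus_cos (fst z))" "integrable (f t) (\<lambda>z. torus_sin (fst z))"
    using integrable_growth[OF quadratic_growth_angle[OF continuous_torus_cos] t]
      integrable_growth[OF quadratic_growth_angle[OF continuous_torus_sin] t] by simp_all
  have "(\<integral>(\<theta>, \<omega>). torus_cis \<theta> \<partial>f t) =
      (\<integral>z. complex_of_real (torus_cos (fst z)) + \<i> * complex_of_real (torus_sin (fst z)) \<partial>f t)"
    by (intro Bochner_Integration.integral_cong) (auto simp: torus_cis_eq Complex_eq)
  also have "\<dots> = complex_of_real (mean_cos t) + \<i> * complex_of_real (mean_sin t)"
    using int by (subst Bochner_Integration.integral_add)
      (auto simp: mean_cos_def mean_sin_def mean_def)
  finally show ?thesis
    by (simp add: order_parameter_def cmod_power2 order_square_def)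
qed

lemma AE_frequency_zero:
  assumes "t \<ge> 0" "energy t = 0"
  shows "AE z in f t. snd z = 0"
  using assms integral_nonneg_eq_0_iff_AE[OF integrable_square[OF assms(1)]]
  by (simp add: energy_def mean_def)

text \<open>When all oscillators rest, the measure is determined by its phase marginal, and no phase observable
  changes in time.\<close>

lemma stationary_if_energy_zero:
  assumes zero: "\<And>t. t \<ge> 0 \<Longrightarrow> energy t = 0" and t: "t \<ge> 0"
  shows "f t = f 0"
proof -
  have angle: "mean (\<lambda>\<theta> \<omega>. a \<theta>) t = mean (\<lambda>\<theta> \<omega>. a \<theta>) 0" if a: "torus_C1 a a'" for a a'
  proof -
    have "(mean (\<lambda>\<theta> \<omega>. a \<theta>) has_real_derivative 0) (at s within {0..})" if s: "s \<ge> 0" for s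
    proof -
      have "mean (\<lambda>\<theta> \<omega>. a' \<theta> * \<omega>) s = (\<integral>z. 0 \<partial>f s)"
        unfolding mean_def
      proof (rule integral_cong_AE)
        have "continuous_on UNIV a'"
          using a by (simp add: torus_C1_def)
        then show "(\<lambda>z. a' (fst z) * snd z) \<in> borel_measurable (f s)"
          using integrable_growth[OF quadratic_growth_first s] by blast
        show "AE z in f s. a' (fst z) * snd z = 0"
          using AE_frequency_zero[OF s zero[OF s]] by eventually_elim simp
      qed simp
      then show ?thesis
        using angle_moment_deriv[OF a s] by simp
    qed
    note deriv = this
    have "mean (\<lambda>\<theta> \<omega>. a \<theta>) 0 \<le> mean (\<lambda>\<theta> \<omega>. a \<theta>) t"
      by (rule increment_nonneg[OF deriv order_refl t]) simp_all
    moreover have "- mean (\<lambda>\<theta> \<omega>. a \<theta>) 0 \<le> - mean (\<lambda>\<theta> \<omega>. a \<theta>) t"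
      by (rule increment_nonneg[where h = "\<lambda>s. - mean (\<lambda>\<theta> \<omega>. a \<theta>) s", OF DERIV_minus[OF deriv] order_refl t])
        simp_all
    ultimately show ?thesis by simp
  qed
  have fst_meas: "fst \<in> f s \<rightarrow>\<^sub>M borel" if "s \<ge> 0" for s
    unfolding measurable_cong_sets[OF sets_f[OF that] refl]
    by (intro borel_measurable_continuous_onI continuous_on_fst continuous_on_id)
  have "distr (f t) borel fst = distr (f 0) borel fst"
  proof (rule torus_measure_eqI)
    show "prob_space (distr (f t) borel fst)" "prob_space (distr (f 0) borel fst)"
      using t by (intro prob_space.prob_space_distr prob fst_meas; simp)+
    show "(\<integral>\<theta>. a \<theta> \<partial>distr (f t) borel fst) = (\<integral>\<theta>. a \<theta> \<partial>distr (f 0) borel fst)" if a: "torus_C1 a a'" for a a'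
    proof -
      have "a \<in> borel_measurable borel"
        by (rule borel_measurable_continuous_onI[OF torus_C1_continuous[OF a]])
      then show ?thesis
        using angle[OF a] t by (simp add: integral_distr fst_meas mean_def)
    qed
  qed simp_all
  note marginal = this
  show ?thesis
  proof (rule measure_eqI)
    show "sets (f t) = sets (f 0)"
      using t by (simp add: sets_f)
    fix S assume "S \<in> sets (f t)"
    then have S: "S \<in> sets borel"
      using t by (simp add: sets_f)
    let ?S0 = "(\<lambda>\<theta>. (\<theta>, 0)) -` S"
    have "(\<lambda>\<theta>. (\<theta>, 0::real)) \<in> borel \<rightarrow>\<^sub>M (borel :: phase_space measure)"
      by (intro borel_measurable_continuous_onI continuous_intros)
    from measurable_sets[OF this S] have S0: "?S0 \<in> sets (borel :: torus measure)"
      by simp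
    have "emeasure (f s) S = emeasure (distr (f s) borel fst) ?S0" if s: "s \<ge> 0" for s
    proof -
      have "emeasure (f s) S = emeasure (f s) (fst -` ?S0 \<inter> space (f s))"
      proof (rule emeasure_eq_AE)
        show "AE z in f s. z \<in> S \<longleftrightarrow> z \<in> fst -` ?S0 \<inter> space (f s)"
          using AE_frequency_zero[OF s zero[OF s]] AE_space
        proof eventually_elim
          case (elim z)
          then have "(fst z, 0) = z" by (simp add: prod_eq_iff)
          then show ?case using elim by simp
        qed
        show "S \<in> sets (f s)" using S s by (simp add: sets_f)
        show "fst -` ?S0 \<inter> space (f s) \<in> sets (f s)"
          by (rule measurable_sets[OF fst_meas[OF s] S0])
      qed
      then show ?thesis
        by (simp add: emeasure_distr[OF fst_meas[OF s] S0])
    qed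
    then show "emeasure (f t) S = emeasure (f 0) S"
      using marginal t by simp
  qed
qed

text \<open>The kinetic energy and the spread \<open>\<langle>sin\<^sup>2 (\<theta> - \<phi>)\<rangle>\<close> confine the mass to the two poles, and the
  order parameter then fixes how it is divided between them.\<close>

lemma tends_to_bipolar:
  assumes energy: "(energy \<longlongrightarrow> 0) at_top"
    and lim: "(mean_cos \<longlongrightarrow> \<rho> * cos \<phi>) at_top" "(mean_sin \<longlongrightarrow> \<rho> * sin \<phi>) at_top"
      "(mean_cos_cos \<longlongrightarrow> (cos \<phi>)\<^sup>2) at_top" "(mean_sin_cos \<longlongrightarrow> sin \<phi> * cos \<phi>) at_top"
    and \<rho>: "0 \<le> \<rho>" "\<rho> \<le> 1"
  shows "tends_weakly f (two_diracs ((1 + \<rho>) / 2) (to_torus \<phi>) ((1 - \<rho>) / 2) (to_torus \<phi> + to_torus pi)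
    \<Otimes>\<^sub>M return borel 0) at_top"
  unfolding tends_weakly_def
proof (intro allI impI)
  fix g :: "phase_space \<Rightarrow> real"
  assume g: "continuous_on UNIV g" "bounded (range g)"
  let ?P = "to_torus \<phi>" and ?Q = "to_torus \<phi> + to_torus pi"
  define g0 where "g0 = g (?P, 0)"
  define g1 where "g1 = g (?Q, 0)"
  obtain B where B: "\<And>z. \<bar>g z\<bar> \<le> B"
    using g(2) by (auto simp: bounded_iff)
  have B0: "B \<ge> 0"
    using order_trans[OF abs_ge_zero B] .
  define c where "c = (\<lambda>\<theta>. torus_cos (\<theta> - ?P))"
  define s where "s = (\<lambda>\<theta>. torus_sin (\<theta> - ?P))"
  have cont: "continuous_on UNIV c" "continuous_on UNIV s"
    by (simp_all add: c_def s_def continuous_torus_cos_diff continuous_torus_sin_diff)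
  \<comment> \<open>The subtracted function of the phase interpolates \<open>g\<close> at the two poles, and its average is a
      function of the order parameter.\<close>
  define h where "h z = g z - ((g0 + g1) / 2 + (g0 - g1) / 2 * c (fst z))" for z
  have cont_h: "continuous_on UNIV h"
    unfolding h_def[abs_def] by (intro continuous_intros g continuous_on_compose2[OF cont(1)]) auto
  have h_bound: "\<bar>h z\<bar> \<le> 3 * B" for z
  proof -
    have "\<bar>(g0 - g1) / 2 * c (fst z)\<bar> \<le> B * 1"
      unfolding abs_mult using B[of "(?P, 0)"] B[of "(?Q, 0)"] B0 abs_torus_cos_le
      by (intro mult_mono) (auto simp: g0_def g1_def c_def)
    moreover have "\<bar>(g0 + g1) / 2\<bar> \<le> B"
      using B[of "(?P, 0)"] B[of "(?Q, 0)"] by (simp add: g0_def g1_def)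
    moreover have "\<bar>h z\<bar> \<le> \<bar>g z\<bar> + (\<bar>(g0 + g1) / 2\<bar> + \<bar>(g0 - g1) / 2 * c (fst z)\<bar>)"
      unfolding h_def by (rule order_trans[OF abs_triangle_ineq4 add_left_mono[OF abs_triangle_ineq]])
    ultimately show ?thesis
      using B[of z] by simp
  qed
  have c_poles: "c ?P = 1" "c ?Q = - 1"
    using torus_cos_to_torus[of 0] by (simp_all add: c_def zero_torus.abs_eq[symmetric])
  have h_poles: "h (?P, 0) = 0" "h (?Q, 0) = 0"
  proof -
    have "h (?P, 0) = g0 - ((g0 + g1) / 2 + (g0 - g1) / 2 * 1)"
      "h (?Q, 0) = g1 - ((g0 + g1) / 2 + (g0 - g1) / 2 * - 1)"
      by (simp_all only: h_def fst_conv c_poles g0_def g1_def)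
    then show "h (?P, 0) = 0" "h (?Q, 0) = 0"
      by (simp_all add: field_simps)
  qed
  have growth_g: "quadratic_growth (\<lambda>\<theta> \<omega>. g (\<theta>, \<omega>))" and growth_h: "quadratic_growth (\<lambda>\<theta> \<omega>. h (\<theta>, \<omega>))"
  proof -
    have "\<bar>g (\<theta>, \<omega>)\<bar> \<le> B * (1 + \<omega>\<^sup>2)" "\<bar>h (\<theta>, \<omega>)\<bar> \<le> 3 * B * (1 + \<omega>\<^sup>2)" for \<theta> \<omega>
      using mult_left_mono[OF one_le_quadratic, of B \<omega>] mult_left_mono[OF one_le_quadratic, of "3 * B" \<omega>]
        B0 B[of "(\<theta>, \<omega>)"] h_bound[of "(\<theta>, \<omega>)"] by linarith+
    then show "quadratic_growth (\<lambda>\<theta> \<omega>. g (\<theta>, \<omega>))" "quadratic_growth (\<lambda>\<theta> \<omega>. h (\<theta>, \<omega>))"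
      using g(1) cont_h by (auto intro!: quadratic_growthI)
  qed
  have growth: "quadratic_growth (\<lambda>\<theta> \<omega>. c \<theta>)" "quadratic_growth (\<lambda>\<theta> \<omega>. (s \<theta>)\<^sup>2)"
    by (intro quadratic_growth_angle continuous_on_power cont)+
  have mean_c: "mean (\<lambda>\<theta> \<omega>. c \<theta>) t = cos \<phi> * mean_cos t + sin \<phi> * mean_sin t" if t: "t \<ge> 0" for t
  proof -
    have "mean (\<lambda>\<theta> \<omega>. c \<theta>) t = mean (\<lambda>\<theta> \<omega>. cos \<phi> * torus_cos \<theta> + sin \<phi> * torus_sin \<theta>) t"
      by (simp add: c_def torus_cos_diff mult.commute)
    then show ?thesis
      using t unfolding mean_cos_def mean_sin_def
      by (simp only: mean_add mean_cmult quadratic_growth_cmult quadratic_growth_angle torus_continuous)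
  qed
  define V where "V t = (cos \<phi>)\<^sup>2 +
    (((sin \<phi>)\<^sup>2 - (cos \<phi>)\<^sup>2) * mean_cos_cos t + - 2 * sin \<phi> * cos \<phi> * mean_sin_cos t)" for t
  have mean_s: "mean (\<lambda>\<theta> \<omega>. (s \<theta>)\<^sup>2) t = V t" if t: "t \<ge> 0" for t
  proof -
    have "(s \<theta>)\<^sup>2 = (cos \<phi>)\<^sup>2 * ((torus_sin \<theta>)\<^sup>2 + (torus_cos \<theta>)\<^sup>2) +
      (((sin \<phi>)\<^sup>2 - (cos \<phi>)\<^sup>2) * (torus_cos \<theta> * torus_cos \<theta>)
        + - 2 * sin \<phi> * cos \<phi> * (torus_sin \<theta> * torus_cos \<theta>))" for \<theta>
      by (simp add: s_def torus_sin_diff power2_eq_square algebra_simps)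
    then have "mean (\<lambda>\<theta> \<omega>. (s \<theta>)\<^sup>2) t = mean (\<lambda>\<theta> \<omega>. (cos \<phi>)\<^sup>2 +
      (((sin \<phi>)\<^sup>2 - (cos \<phi>)\<^sup>2) * (torus_cos \<theta> * torus_cos \<theta>)
        + - 2 * sin \<phi> * cos \<phi> * (torus_sin \<theta> * torus_cos \<theta>))) t"
      by (simp add: torus_sin_cos_squared)
    then show ?thesis
      using t unfolding V_def mean_cos_cos_def mean_sin_cos_def
      by (simp only: mean_add mean_cmult mean_const quadratic_growth_add quadratic_growth_cmult
          quadratic_growth_angle torus_continuous continuous_on_mult continuous_on_const)
  qed
  have lim_c: "((\<lambda>t. cos \<phi> * mean_cos t + sin \<phi> * mean_sin t) \<longlongrightarrow> \<rho>) at_top"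
  proof -
    have "((\<lambda>t. cos \<phi> * mean_cos t + sin \<phi> * mean_sin t) \<longlongrightarrow>
        cos \<phi> * (\<rho> * cos \<phi>) + sin \<phi> * (\<rho> * sin \<phi>)) at_top"
      by (intro tendsto_intros lim)
    also have "cos \<phi> * (\<rho> * cos \<phi>) + sin \<phi> * (\<rho> * sin \<phi>) = \<rho> * ((sin \<phi>)\<^sup>2 + (cos \<phi>)\<^sup>2)"
      by (simp only: power2_eq_square) algebra
    finally show ?thesis
      by simp
  qed
  have lim_s: "(V \<longlongrightarrow> 0) at_top"
  proof -
    have "(V \<longlongrightarrow> (cos \<phi>)\<^sup>2 +
      (((sin \<phi>)\<^sup>2 - (cos \<phi>)\<^sup>2) * (cos \<phi>)\<^sup>2 + - 2 * sin \<phi> * cos \<phi> * (sin \<phi> * cos \<phi>))) at_top"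
      unfolding V_def[abs_def] by (intro tendsto_intros lim)
    also have "(cos \<phi>)\<^sup>2 + (((sin \<phi>)\<^sup>2 - (cos \<phi>)\<^sup>2) * (cos \<phi>)\<^sup>2 + - 2 * sin \<phi> * cos \<phi> * (sin \<phi> * cos \<phi>)) =
        (cos \<phi>)\<^sup>2 * (1 - ((sin \<phi>)\<^sup>2 + (cos \<phi>)\<^sup>2))"
      by (simp only: power2_eq_square) algebra
    finally show ?thesis
      by simp
  qed
  have lim_h: "(mean (\<lambda>\<theta> \<omega>. h (\<theta>, \<omega>)) \<longlongrightarrow> 0) at_top"
  proof (rule tendstoI)
    fix \<epsilon> :: real assume \<epsilon>: "\<epsilon> > 0"
    then obtain C where C: "C \<ge> 0" "\<And>\<theta> \<omega>. \<bar>h (\<theta>, \<omega>)\<bar> \<le> \<epsilon> / 2 + C * ((s \<theta>)\<^sup>2 + \<omega>\<^sup>2)"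
      using controlled_by_distance_to_poles[OF cont_h h_bound h_poles, of "\<epsilon> / 2"] unfolding s_def by auto
    have mean_le: "\<bar>mean (\<lambda>\<theta> \<omega>. h (\<theta>, \<omega>)) t\<bar> \<le> \<epsilon> / 2 + C * (mean (\<lambda>\<theta> \<omega>. (s \<theta>)\<^sup>2) t + energy t)"
      if t: "t \<ge> 0" for t
    proof -
      have *: "quadratic_growth (\<lambda>\<theta> \<omega>. \<epsilon> / 2)" "quadratic_growth (\<lambda>\<theta> \<omega>. C * ((s \<theta>)\<^sup>2 + \<omega>\<^sup>2))"
        by (intro quadratic_growth_angle quadratic_growth_cmult quadratic_growth_add growth
            quadratic_growth_energy continuous_on_const)+
      have "\<bar>mean (\<lambda>\<theta> \<omega>. h (\<theta>, \<omega>)) t\<bar> \<le> mean (\<lambda>\<theta> \<omega>. \<epsilon> / 2 + C * ((s \<theta>)\<^sup>2 + \<omega>\<^sup>2)) t"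
        by (rule abs_mean_le[OF growth_h quadratic_growth_add[OF *] t C(2)])
      also have "\<dots> = \<epsilon> / 2 + C * (mean (\<lambda>\<theta> \<omega>. (s \<theta>)\<^sup>2) t + energy t)"
        using t * growth(2) quadratic_growth_energy
        by (simp only: mean_add mean_cmult mean_const energy_def)
      finally show ?thesis .
    qed
    have "((\<lambda>t. \<epsilon> / 2 + C * (V t + energy t)) \<longlongrightarrow> \<epsilon> / 2 + C * (0 + 0)) at_top"
      by (intro tendsto_add tendsto_mult_left tendsto_const lim_s energy)
    then have "\<forall>\<^sub>F t in at_top. \<epsilon> / 2 + C * (V t + energy t) < \<epsilon>"
      by (rule order_tendstoD(2)) (use \<epsilon> in simp)
    then show "\<forall>\<^sub>F t in at_top. dist (mean (\<lambda>\<theta> \<omega>. h (\<theta>, \<omega>)) t) 0 < \<epsilon>"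
      using eventually_ge_at_top[of 0]
    proof eventually_elim
      case (elim t)
      then show ?case
        using mean_le[of t] by (simp add: mean_s dist_real_def)
    qed
  qed
  have split: "mean (\<lambda>\<theta> \<omega>. g (\<theta>, \<omega>)) t = mean (\<lambda>\<theta> \<omega>. h (\<theta>, \<omega>)) t +
      ((g0 + g1) / 2 + (g0 - g1) / 2 * (cos \<phi> * mean_cos t + sin \<phi> * mean_sin t))" if t: "t \<ge> 0" for t
  proof -
    have "mean (\<lambda>\<theta> \<omega>. g (\<theta>, \<omega>)) t = mean (\<lambda>\<theta> \<omega>. h (\<theta>, \<omega>) + ((g0 + g1) / 2 + (g0 - g1) / 2 * c \<theta>)) t"
      by (simp add: h_def)
    then show ?thesis
      using t growth_h growth(1) mean_c[OF t]
      by (simp only: mean_add mean_cmult mean_const quadratic_growth_add quadratic_growth_cmult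
          quadratic_growth_angle continuous_on_const)
  qed
  have "((\<lambda>t. mean (\<lambda>\<theta> \<omega>. h (\<theta>, \<omega>)) t +
      ((g0 + g1) / 2 + (g0 - g1) / 2 * (cos \<phi> * mean_cos t + sin \<phi> * mean_sin t)))
      \<longlongrightarrow> 0 + ((g0 + g1) / 2 + (g0 - g1) / 2 * \<rho>)) at_top"
    by (intro tendsto_add tendsto_mult_left tendsto_const lim_h lim_c)
  moreover have "\<forall>\<^sub>F t in at_top. mean (\<lambda>\<theta> \<omega>. h (\<theta>, \<omega>)) t +
      ((g0 + g1) / 2 + (g0 - g1) / 2 * (cos \<phi> * mean_cos t + sin \<phi> * mean_sin t)) = (\<integral>z. g z \<partial>f t)"
    using eventually_ge_at_top[of 0] by eventually_elim (subst split[symmetric], simp_all add: mean_def)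
  ultimately have "((\<lambda>t. \<integral>z. g z \<partial>f t) \<longlongrightarrow> 0 + ((g0 + g1) / 2 + (g0 - g1) / 2 * \<rho>)) at_top"
    by (rule Lim_transform_eventually)
  also have "0 + ((g0 + g1) / 2 + (g0 - g1) / 2 * \<rho>) = (1 + \<rho>) / 2 * g0 + (1 - \<rho>) / 2 * g1"
    by (simp add: field_simps)
  also have "\<dots> = (\<integral>z. g z \<partial>(two_diracs ((1 + \<rho>) / 2) ?P ((1 - \<rho>) / 2) ?Q \<Otimes>\<^sub>M return borel 0))"
    unfolding g0_def g1_def
    by (rule integral_two_diracs[symmetric, OF _ _ _ opposite_pole_neq[symmetric] g(1)])
      (use \<rho> in \<open>auto simp: field_simps\<close>)
  finally show "((\<lambda>t. \<integral>z. g z \<partial>f t) \<longlongrightarrow>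
      (\<integral>z. g z \<partial>(two_diracs ((1 + \<rho>) / 2) ?P ((1 - \<rho>) / 2) ?Q \<Otimes>\<^sub>M return borel 0))) at_top" .
qed

end

theorem theorem3p7:
  fixes m \<gamma> \<kappa> :: real
    and f_in :: "(torus \<times> real) measure"
    and f :: "real \<Rightarrow> (torus \<times> real) measure"
  assumes "m > 0" and "\<gamma> > 0" and "\<kappa> > 0"
    and "Linf_P2 f"
    and "global_measure_valued_solution m \<gamma> \<kappa> f_in f"
    and "1 / 2 * (\<integral>(\<theta>, \<omega>). \<omega>\<^sup>2 \<partial>f_in) \<le> \<kappa> * (order_parameter (f 0))\<^sup>2 / (2 * m)"
  shows "(order_parameter (f 0) = 0 \<longrightarrow>
            (\<forall>t\<ge>0. f t = f_in \<and> phase_locked (f t)) \<and>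
            (\<forall>t>0. order_parameter (f t) = 0)) \<and>
         (order_parameter (f 0) > 0 \<longrightarrow>
            (\<exists>c1 c2 \<nu>. bipolar_state c1 c2 \<nu> \<and> tends_weakly f \<nu> at_top))"
proof -
  have f_in: "f_in = f 0"
    using assms(5) zero_less_one
    unfolding global_measure_valued_solution_def measure_valued_solution_def by blast
  interpret kuramoto_flow m \<gamma> \<kappa> f
    using assms(1-5) by unfold_locales (simp_all add: f_in)
  interpret low_energy_flow m \<gamma> \<kappa> f
  proof
    show "total_energy 0 \<le> 0"
      using assms(6) unfolding f_in order_parameter_square[OF order_refl] total_energy_def
      by (simp add: energy_def mean_def case_prod_beta')
  qed
  show ?thesis
  proof (intro conjI impI)
    assume "order_parameter (f 0) = 0"
    then have "order_square 0 = 0"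
      using order_parameter_square[of 0] by simp
    note zero = order_zero_stays_zero[OF this]
    show "\<forall>t\<ge>0. f t = f_in \<and> phase_locked (f t)"
    proof (intro allI impI conjI)
      fix t :: real assume t: "0 \<le> t"
      show "f t = f_in"
        unfolding f_in by (rule stationary_if_energy_zero[OF zero(2) t])
      show "phase_locked (f t)"
        using AE_frequency_zero[OF t zero(2)[OF t]] by (simp add: phase_locked_def case_prod_beta')
    qed
    show "\<forall>t>0. order_parameter (f t) = 0"
      using zero(1) order_parameter_square by (metis less_imp_le power_eq_0_iff)
  next
    assume "order_parameter (f 0) > 0"
    then have "order_square 0 > 0"
      using order_parameter_square[of 0] by (metis order_refl zero_less_power)
    then obtain \<rho> \<phi> where \<rho>: "\<rho> > 0" and lim: "(mean_cos \<longlongrightarrow> \<rho> * cos \<phi>) at_top"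
      "(mean_sin \<longlongrightarrow> \<rho> * sin \<phi>) at_top" "(mean_cos_cos \<longlongrightarrow> (cos \<phi>)\<^sup>2) at_top"
      "(mean_sin_cos \<longlongrightarrow> sin \<phi> * cos \<phi>) at_top"
      using phase_converges by blast
    have "(order_square \<longlongrightarrow> (\<rho> * cos \<phi>)\<^sup>2 + (\<rho> * sin \<phi>)\<^sup>2) at_top"
      unfolding order_square_def[abs_def] by (intro tendsto_intros lim)
    moreover have "(\<rho> * cos \<phi>)\<^sup>2 + (\<rho> * sin \<phi>)\<^sup>2 = \<rho>\<^sup>2 * ((sin \<phi>)\<^sup>2 + (cos \<phi>)\<^sup>2)"
      by (simp only: power_mult_distrib distrib_left add.commute)
    ultimately have "(order_square \<longlongrightarrow> \<rho>\<^sup>2) at_top"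
      by simp
    moreover have "\<forall>\<^sub>F t in at_top. order_square t \<le> 1"
      using eventually_ge_at_top[of 0] by eventually_elim (rule order_square_le)
    ultimately have "\<rho>\<^sup>2 \<le> 1"
      by (rule tendsto_upperbound) simp
    then have "\<rho> \<le> 1"
      using \<rho> by (simp add: abs_square_le_1)
    then have "bipolar_state ((1 + \<rho>) / 2) ((1 - \<rho>) / 2)
        (two_diracs ((1 + \<rho>) / 2) (to_torus \<phi>) ((1 - \<rho>) / 2) (to_torus \<phi> + to_torus pi) \<Otimes>\<^sub>M return borel 0)"
      unfolding bipolar_state_def
    proof (intro conjI exI[of _ "to_torus \<phi>"] refl)
      show "(1 - \<rho>) / 2 < (1 + \<rho>) / 2" "0 \<le> (1 - \<rho>) / 2" "(1 + \<rho>) / 2 + (1 - \<rho>) / 2 = 1"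
        using \<rho> \<open>\<rho> \<le> 1\<close> by (simp_all add: field_simps)
    qed
    moreover have "tends_weakly f (two_diracs ((1 + \<rho>) / 2) (to_torus \<phi>) ((1 - \<rho>) / 2)
        (to_torus \<phi> + to_torus pi) \<Otimes>\<^sub>M return borel 0) at_top"
      using \<rho> \<open>\<rho> \<le> 1\<close> by (intro tends_to_bipolar energy_tendsto_0 lim) simp_all
    ultimately show "\<exists>c1 c2 \<nu>. bipolar_state c1 c2 \<nu> \<and> tends_weakly f \<nu> at_top"
      by blast
  qed
qed

end
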